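(* Assume conditions (A) and (B), with the limit $F$ of $F_n$ an unbounded function, and assume $R_n'(0)\to a$ for some $a\in\mathbb R$. Let $\check m_n=\big[\sum_{k=1}^ny_n(k-1)\big]^{-1}\sum_{k=1}^n(y_n(k)-\eta_n(k))$ and $m_n=g_n'(1)$. Then $$n(\check m_n-m_n)\xrightarrow{d}\frac{Y(1)-a\int_0^1Y(s)ds-Y'(1)}{\int_0^1Y(t)dt},$$ where $(Y,Y')$ is the limit process of Theorem 2.1.
   Context: For each $n\ge1$, $\{\xi_n(k,j):k,j\ge1\}$ and $\{\eta_n(k):k\ge1\}$ are independent families of i.i.d. $\mathbb N$-valued random variables with generating functions $g_n,h_n$; $y_n(0)=0$, $y_n(k)=\sum_{j=1}^{y_n(k-1)}\xi_n(k,j)+\eta_n(k)$; $Y_n(t)=y_n([nt])$, $Y_n'(t)=\sum_{k=1}^{[nt]}\eta_n(k)$. Let $b_n\to\infty$ be positive, $R_n(\lambda)=nb_n[(1-\lambda/b_n)-g_n(1-\lambda/b_n)]$ and $F_n(\lambda)=n[1-h_n(1-\lambda/b_n)]$ for $0\le\lambda\le b_n$. (A): $(R_n)$ uniformly Lipschitz on bounded intervals and converging to a continuous $R$; (B): $(F_n)$ converges to a continuous $F$. Theorem 2.1: under (A),(B), $(Y_n/b_n,Y_n'/b_n)$ converges in distribution on $D([0,\infty),\mathbb R_+^2)$ to the Markov process $(Y,Y')$ started at $(0,0)$ with $\int e^{-\langle z,u\rangle}P_t(x,du)=\exp\{-x_1\psi_t(z_1)-x_2z_2-\int_0^tF(\psi_s(z_1)+z_2)ds\}$,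 $\frac{d}{dt}\psi_t=R(\psi_t)$, $\psi_0=z_1$. *)

theory Defs
  imports "HOL-Probability.Probability"
begin

definition gen :: "nat pmf \<Rightarrow> real \<Rightarrow> real" where
  "gen p s = (\<Sum>j. pmf p j * s ^ j)"

fun bpi :: "(nat \<Rightarrow> nat \<Rightarrow> 'a \<Rightarrow> nat) \<Rightarrow> (nat \<Rightarrow> 'a \<Rightarrow> nat) \<Rightarrow> nat \<Rightarrow> 'a \<Rightarrow> nat" where
  "bpi xi eta 0 w = 0"
| "bpi xi eta (Suc k) w = (\<Sum>j=1..bpi xi eta k w. xi (Suc k) j w) + eta (Suc k) w"

text \<open>R_n and F_n of the paper (meaningful for 0 <= lambda <= b_n).\<close>
definition Rfun :: "nat \<Rightarrow> real \<Rightarrow> nat pmf \<Rightarrow> real \<Rightarrow> real" where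
  "Rfun n b p x = real n * b * ((1 - x / b) - gen p (1 - x / b))"

definition Ffun :: "nat \<Rightarrow> real \<Rightarrow> nat pmf \<Rightarrow> real \<Rightarrow> real" where
  "Ffun n b q x = real n * (1 - gen q (1 - x / b))"

definition mcheck :: "(nat \<Rightarrow> nat \<Rightarrow> 'a \<Rightarrow> nat) \<Rightarrow> (nat \<Rightarrow> 'a \<Rightarrow> nat) \<Rightarrow> nat \<Rightarrow> 'a \<Rightarrow> real" where
  "mcheck xi eta n w =
     (\<Sum>k=1..n. real (bpi xi eta k w) - real (eta k w)) / (\<Sum>k=1..n. real (bpi xi eta (k - 1) w))"

definition cadlag :: "(real \<Rightarrow> real) \<Rightarrow> bool" where
  "cadlag f \<longleftrightarrow> (\<forall>t\<ge>0. continuous (at_right t) f) \<and> (\<forall>t>0. \<exists>L. (f \<longlongrightarrow> L) (at_left t))"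

definition psi_sol :: "(real \<Rightarrow> real) \<Rightarrow> (real \<Rightarrow> real \<Rightarrow> real) \<Rightarrow> bool" where
  "psi_sol R \<psi> \<longleftrightarrow> (\<forall>z\<ge>0. \<psi> z 0 = z \<and>
      (\<forall>t\<ge>0. \<psi> z t \<ge> 0 \<and> ((\<psi> z) has_real_derivative R (\<psi> z t)) (at t within {0..})))"

text \<open>(Y,Y') on the probability space N is the limit process of Theorem 2.1:
  started at (0,0), nonnegative cadlag paths, and Markov (w.r.t. its natural filtration)
  with transition semigroup characterised by
  int exp(-<z,u>) P_s(x,du) = exp(-x1 psi_s(z1) - x2 z2 - int_0^s F(psi_u(z1)+z2) du).\<close>
definition natfilt :: "'b measure \<Rightarrow> (real \<Rightarrow> 'b \<Rightarrow> real) \<Rightarrow> (real \<Rightarrow> 'b \<Rightarrow> real) \<Rightarrow> real \<Rightarrow> 'b set set" where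
  "natfilt N Y Y' t = sigma_sets (space N)
     (\<Union>u\<in>{0..t}. {(\<lambda>w. (Y u w, Y' u w)) -` B \<inter> space N | B. B \<in> sets (borel :: (real \<times> real) measure)})"

definition limit_process ::
  "(real \<Rightarrow> real) \<Rightarrow> (real \<Rightarrow> real) \<Rightarrow> (real \<Rightarrow> real \<Rightarrow> real) \<Rightarrow> 'b measure \<Rightarrow>
   (real \<Rightarrow> 'b \<Rightarrow> real) \<Rightarrow> (real \<Rightarrow> 'b \<Rightarrow> real) \<Rightarrow> bool" where
  "limit_process R F \<psi> N Y Y' \<longleftrightarrow>
     prob_space N \<and>
     (\<forall>t. Y t \<in> borel_measurable N \<and> Y' t \<in> borel_measurable N) \<and>
     (\<forall>w\<in>space N. Y 0 w = 0 \<and> Y' 0 w = 0 \<and> cadlag (\<lambda>t. Y t w) \<and> cadlag (\<lambda>t. Y' t w) \<and>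
        (\<forall>t\<ge>0. Y t w \<ge> 0 \<and> Y' t w \<ge> 0)) \<and>
     (\<forall>t s z1 z2 A. 0 \<le> t \<longrightarrow> 0 \<le> s \<longrightarrow> 0 \<le> z1 \<longrightarrow> 0 \<le> z2 \<longrightarrow> A \<in> natfilt N Y Y' t \<longrightarrow>
        (\<integral>w. indicator A w * exp (- (z1 * Y (t + s) w + z2 * Y' (t + s) w)) \<partial>N) =
        (\<integral>w. indicator A w * exp (- (Y t w * \<psi> z1 s + Y' t w * z2
               + integral {0..s} (\<lambda>u. F (\<psi> z1 u + z2)))) \<partial>N))"

end

theory Submission
  imports Defs
begin

text \<open>
  Writing \<open>A = y(n)/b\<close>, \<open>B = (\<Sum>\<eta>)/b\<close> and \<open>C = (\<Sum>y(k-1))/(n b)\<close>, the centred estimator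
  is \<open>(A - B)/C - R_n'(0)\<close>, so it suffices to find the joint limit of \<open>(A, B, C)\<close>; no functional limit
  theorem is needed. Conditioning backwards in time turns the joint
  Laplace transform of \<open>(A, B, C)\<close> into a product of values of \<open>h_n\<close> along an Euler scheme of step \<open>1/n\<close> for
  \<open>v' = R(v) + \<theta>\<close>. The Markov property gives the Laplace transform of \<open>Y(1)\<close>, \<open>Y'(1)\<close> and a Riemann sum of \<open>Y\<close>
  along the splitting scheme \<open>w \<mapsto> \<psi>\<^bsub>1/n\<^esub>(w) + \<theta>/n\<close> for the same equation, and a discrete
  Gronwall estimate shows that the two schemes merge. Letting \<open>\<theta>\<close> tend to infinity, unboundedness of \<open>F\<close>
  forces the integral of \<open>Y\<close> to be positive almost surely. Finally, integer Laplace arguments are the moments of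
  \<open>(exp(-A), exp(-B), exp(-C))\<close> in the unit cube, so Stone-Weierstrass and continuous mapping conclude.
\<close>

subsection \<open>Generating functions\<close>

text \<open>The obstacle is that the limit process is known only through its transition Laplace
  transforms: the joint law with the time integral has to be derived, and the equation with source
  \<theta> comes without a solution. So the two discrete exponents are compared with each other.
  Both stay close to one Riemann sum of \<open>F\<close>, and the limit of that sum is read off the
  process, as an expectation.

  Merging the schemes requires one compact interval containing both, while the Lipschitz constants
  are local. It comes from concavity of \<open>R_n\<close>, which bounds \<open>R_n(x)\<close> above
  by a fixed multiple of \<open>x\<close> on its whole domain. For \<open>F_n\<close> no Lipschitz
  bound is given, and monotonicity takes its place.

  Division by zero shapes the end. The ratio is discontinuous at C = 0, an event that may have
  positive probability for every \<open>n\<close>; the mapping argument tolerates it because it is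
  null for the limit law.\<close>

lemma integrable_power_pmf:
  assumes "0 \<le> s" "s \<le> 1"
  shows "integrable (measure_pmf p) (\<lambda>j::nat. s ^ j :: real)"
  using assms by (intro measure_pmf.integrable_const_bound[where B = 1]) (auto simp: power_le_one)

lemma gen_eq_expectation:
  assumes "0 \<le> s" "s \<le> 1"
  shows "gen p s = measure_pmf.expectation p (\<lambda>j. s ^ j)"
proof -
  have "integrable (count_space UNIV) (\<lambda>j. pmf p j * s ^ j)"
    using integrable_power_pmf[OF assms, of p]
    by (simp add: measure_pmf_eq_density integrable_density)
  then have "gen p s = (\<integral>j. pmf p j * s ^ j \<partial>count_space UNIV)"
    by (simp add: gen_def integral_count_space_nat)
  then show ?thesis
    by (simp add: measure_pmf_eq_density integral_density)
qed

lemma gen_1 [simp]: "gen p 1 = 1"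
  by (simp add: gen_eq_expectation)

lemma gen_nonneg: "0 \<le> s \<Longrightarrow> s \<le> 1 \<Longrightarrow> 0 \<le> gen p s"
  by (simp add: gen_eq_expectation)

lemma gen_mono:
  assumes "0 \<le> s" "s \<le> t" "t \<le> 1"
  shows "gen p s \<le> gen p t"
proof -
  have "measure_pmf.expectation p (\<lambda>j. s ^ j) \<le> measure_pmf.expectation p (\<lambda>j. t ^ j)"
    using assms by (intro integral_mono integrable_power_pmf) (auto intro: power_mono)
  then show ?thesis
    using assms by (simp add: gen_eq_expectation)
qed

lemma gen_le_1: "0 \<le> s \<Longrightarrow> s \<le> 1 \<Longrightarrow> gen p s \<le> 1"
  using gen_mono[of s 1 p] by simp

text \<open>Convexity of the power along the chord from \<open>s\<close> to 1, obtained
  algebraically: in the inductive step the defect is exactly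
  \<open>(1 - t) * t * ((1 - s) * (1 - s ^ j))\<close>.\<close>

lemma power_chord:
  fixes s t :: real
  assumes "0 \<le> s" "s \<le> 1" "0 \<le> t" "t \<le> 1"
  shows "(1 - t + t * s) ^ j \<le> 1 - t + t * s ^ j"
proof (induction j)
  case (Suc j)
  have x: "0 \<le> 1 - t + t * s" using assms by simp
  have "(1 - t + t * s) ^ Suc j \<le> (1 - t + t * s) * (1 - t + t * s ^ j)"
    using Suc x by (simp add: mult_left_mono)
  also have "\<dots> = 1 - t + t * s ^ Suc j - (1 - t) * t * ((1 - s) * (1 - s ^ j))"
    by (simp add: algebra_simps)
  also have "\<dots> \<le> 1 - t + t * s ^ Suc j"
    using assms by (simp add: power_le_one)
  finally show ?case .
qed simp

lemma gen_chord:
  assumes "0 \<le> s" "s \<le> 1" "0 \<le> t" "t \<le> 1"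
  shows "gen p (1 - t + t * s) \<le> 1 - t + t * gen p s"
proof -
  have r: "0 \<le> 1 - t + t * s" "1 - t + t * s \<le> 1"
    using assms mult_left_le[of s t] by auto
  have "measure_pmf.expectation p (\<lambda>j. (1 - t + t * s) ^ j)
      \<le> measure_pmf.expectation p (\<lambda>j. 1 - t + t * s ^ j)"
    using assms r
    by (intro integral_mono integrable_power_pmf power_chord) (auto intro!: integrable_power_pmf)
  also have "\<dots> = 1 - t + t * measure_pmf.expectation p (\<lambda>j. s ^ j)"
    using assms by (subst Bochner_Integration.integral_add) (auto intro!: integrable_power_pmf)
  finally show ?thesis
    using assms r by (simp add: gen_eq_expectation)
qed

lemma Rfun_0 [simp]: "Rfun n b p 0 = 0"
  by (simp add: Rfun_def)

lemma Ffun_0 [simp]: "Ffun n b p 0 = 0"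
  by (simp add: Ffun_def)

text \<open>Concavity of \<open>Rfun\<close> turns a Lipschitz bound near 0 into a global linear bound.\<close>
lemma Rfun_linear_bound:
  assumes b: "1 \<le> b" and x: "0 \<le> x" "x \<le> b"
    and lip: "\<And>y. 0 \<le> y \<Longrightarrow> y \<le> 1 \<Longrightarrow> Rfun n b p y \<le> K * y"
  shows "Rfun n b p x \<le> K * x"
proof (cases "x \<le> 1")
  case False
  \<comment> \<open>With this weight 1 - 1/b is the convex combination of 1 and 1 - x/b, so the
    chord inequality compares \<open>Rfun\<close> at \<open>x\<close> with its value at 1, the end
    of the interval where the hypothesis applies.\<close>
  define t where "t = 1 / x"
  have t: "0 \<le> t" "t \<le> 1" and tx: "t * x = 1" using False by (auto simp: t_def)
  have s: "0 \<le> 1 - x / b" "1 - x / b \<le> 1" using b x by auto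
  have "1 - t + t * (1 - x / b) = 1 - 1 / b"
    using tx by (simp add: algebra_simps)
  then have "gen p (1 - 1 / b) \<le> 1 - t + t * gen p (1 - x / b)"
    using gen_chord[OF s t, of p] by (simp only:)
  then have "t * ((1 - x / b) - gen p (1 - x / b)) \<le> (1 - 1 / b) - gen p (1 - 1 / b)"
    using tx by (simp add: algebra_simps)
  then have "n * b * (t * ((1 - x / b) - gen p (1 - x / b))) \<le> n * b * ((1 - 1 / b) - gen p (1 - 1 / b))"
    using b by (intro mult_left_mono) auto
  then have "t * Rfun n b p x \<le> Rfun n b p 1"
    by (simp add: Rfun_def mult_ac)
  also have "\<dots> \<le> K" using lip[of 1] by simp
  finally have "x * (t * Rfun n b p x) \<le> x * K"
    using x by (intro mult_left_mono) auto
  then show ?thesis using tx by (simp add: mult.commute mult.left_commute mult.assoc[symmetric])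
qed (use lip x in auto)

subsection \<open>The joint generating function of the branching process\<close>

text \<open>The two sample points may live in different spaces. This lets the process be evaluated
  on a configuration of the variables up to time \<open>k\<close> in place of a point of the
  probability space.\<close>

lemma bpi_cong:
  assumes "\<And>i j. 1 \<le> i \<Longrightarrow> i \<le> k \<Longrightarrow> 1 \<le> j \<Longrightarrow> xi i j w = xi' i j w'"
    and "\<And>i. 1 \<le> i \<Longrightarrow> i \<le> k \<Longrightarrow> eta i w = eta' i w'"
  shows "bpi xi eta k w = bpi xi' eta' k w'"
  using assms
proof (induction k)
  case (Suc k)
  have "bpi xi eta k w = bpi xi' eta' k w'" using Suc by simp
  then show ?case using Suc.prems by (auto intro!: sum.cong)
qed simp

lemma measurable_sum_nat [measurable (raw)]:
  fixes f :: "'i \<Rightarrow> 'a \<Rightarrow> nat"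
  assumes "\<And>i. i \<in> I \<Longrightarrow> f i \<in> measurable M (count_space UNIV)"
  shows "(\<lambda>w. \<Sum>i\<in>I. f i w) \<in> measurable M (count_space UNIV)"
proof -
  have eq: "measurable M (count_space UNIV :: nat measure) = measurable M borel"
    by (rule measurable_cong_sets) (simp_all add: sets_borel_eq_count_space)
  show ?thesis using assms unfolding eq by (rule borel_measurable_sum)
qed

text \<open>Measurability is asked only of the variables that the first \<open>k\<close> generations
  use, since the lemma is also applied to the coordinate maps of a product over the past.\<close>

lemma bpi_measurable:
  assumes "\<And>i j. 1 \<le> i \<Longrightarrow> i \<le> k \<Longrightarrow> 1 \<le> j \<Longrightarrow> xi i j \<in> measurable M (count_space UNIV)"
    and "\<And>i. 1 \<le> i \<Longrightarrow> i \<le> k \<Longrightarrow> eta i \<in> measurable M (count_space UNIV)"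
  shows "bpi xi eta k \<in> measurable M (count_space UNIV)"
  using assms
proof (induction k)
  case 0
  have "bpi xi eta 0 = (\<lambda>w. 0)" by (simp add: fun_eq_iff)
  then show ?case by simp
next
  case (Suc k)
  have [measurable]: "bpi xi eta k \<in> measurable M (count_space UNIV)" using Suc by simp
  have [measurable]: "(\<lambda>w. \<Sum>j=1..t. xi (Suc k) j w) \<in> measurable M (count_space UNIV)" for t
    using Suc.prems by (intro measurable_sum_nat) auto
  have [measurable]: "eta (Suc k) \<in> measurable M (count_space UNIV)" using Suc.prems by simp
  have [measurable]: "(\<lambda>w. \<Sum>j=1..bpi xi eta k w. xi (Suc k) j w) \<in> measurable M (count_space UNIV)"
    by (rule measurable_compose_countable[where f = "\<lambda>t w. \<Sum>j=1..t. xi (Suc k) j w"]) measurable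
  have eq: "bpi xi eta (Suc k) = (\<lambda>w. (\<Sum>j=1..bpi xi eta k w. xi (Suc k) j w) + eta (Suc k) w)"
    by (simp add: fun_eq_iff)
  show ?case unfolding eq by measurable
qed

text \<open>Serves as conditioning on \<open>T\<close>: its values are countably many, so an
  integral is the limit of the finite sums over fibres, by dominated convergence along the events
  \<open>T w < m\<close>.\<close>

lemma (in finite_measure) integral_eq_by_fibres:
  fixes f g :: "'a \<Rightarrow> real" and T :: "'a \<Rightarrow> nat"
  assumes [measurable]: "f \<in> borel_measurable M" "g \<in> borel_measurable M"
      "T \<in> measurable M (count_space UNIV)"
    and bdd: "\<And>w. w \<in> space M \<Longrightarrow> \<bar>f w\<bar> \<le> 1" "\<And>w. w \<in> space M \<Longrightarrow> \<bar>g w\<bar> \<le> 1"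
    and eq: "\<And>t. (\<integral>w. indicator {w. T w = t} w * f w \<partial>M) = (\<integral>w. indicator {w. T w = t} w * g w \<partial>M)"
  shows "(\<integral>w. f w \<partial>M) = (\<integral>w. g w \<partial>M)"
proof -
  have lim: "(\<lambda>m. \<Sum>t<m. \<integral>w. indicator {w. T w = t} w * h w \<partial>M) \<longlonglongrightarrow> (\<integral>w. h w \<partial>M)"
    if [measurable]: "h \<in> borel_measurable M" and h: "\<And>w. w \<in> space M \<Longrightarrow> \<bar>h w\<bar> \<le> 1" for h :: "'a \<Rightarrow> real"
  proof -
    have ih: "integrable M h"
      by (rule integrable_const_bound[where B = 1]) (use h in auto)
    have it: "integrable M (\<lambda>w. indicator {w. T w = t} w * h w)" for t
      by (rule integrable_const_bound[where B = 1]) (use h in \<open>auto simp: indicator_def\<close>)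
    have pt: "(\<Sum>t<m. indicator {w. T w = t} w * h w) = indicator {w. T w < m} w * h w" for m w
      by (induction m) (auto simp: indicator_def less_Suc_eq)
    have "(\<lambda>m. \<integral>w. indicator {w. T w < m} w * h w \<partial>M) \<longlonglongrightarrow> (\<integral>w. h w \<partial>M)"
    proof (rule integral_dominated_convergence[where w = "\<lambda>_. 1"])
      show "AE w in M. (\<lambda>m. indicator {w. T w < m} w * h w) \<longlonglongrightarrow> h w"
      proof (rule AE_I2)
        fix w
        have "\<forall>\<^sub>F m in sequentially. indicator {w. T w < m} w * h w = h w"
          using eventually_gt_at_top[of "T w"] by eventually_elim simp
        then show "(\<lambda>m. indicator {w. T w < m} w * h w) \<longlonglongrightarrow> h w"
          by (rule tendsto_eventually)
      qed
    qed (use h in \<open>auto simp: indicator_def\<close>)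
    also have "(\<lambda>m. \<integral>w. indicator {w. T w < m} w * h w \<partial>M)
        = (\<lambda>m. \<Sum>t<m. \<integral>w. indicator {w. T w = t} w * h w \<partial>M)"
      by (simp only: pt[symmetric] Bochner_Integration.integral_sum[OF it])
    finally show ?thesis .
  qed
  show ?thesis
    using lim[OF assms(1) bdd(1)] lim[OF assms(2) bdd(2)] unfolding eq by (rule LIMSEQ_unique)
qed

text \<open>The random variable whose expectation is the joint generating function of the population
  at time \<open>k\<close>, the total immigration, and the total population over times 0 to
  \<open>k - 1\<close>, the denominator of \<open>mcheck\<close>.\<close>

definition bpi_mgf ::
  "(nat \<Rightarrow> nat \<Rightarrow> 'a \<Rightarrow> nat) \<Rightarrow> (nat \<Rightarrow> 'a \<Rightarrow> nat) \<Rightarrow> nat \<Rightarrow> real \<Rightarrow> real \<Rightarrow> real \<Rightarrow> 'a \<Rightarrow> real" where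
  "bpi_mgf xi eta k s r c w =
     s ^ bpi xi eta k w * (\<Prod>i=1..k. r ^ eta i w * c ^ bpi xi eta (i - 1) w)"

lemma bpi_mgf_cong:
  assumes "\<And>i j. 1 \<le> i \<Longrightarrow> i \<le> k \<Longrightarrow> 1 \<le> j \<Longrightarrow> xi i j w = xi' i j w'"
    and "\<And>i. 1 \<le> i \<Longrightarrow> i \<le> k \<Longrightarrow> eta i w = eta' i w'"
  shows "bpi_mgf xi eta k s r c w = bpi_mgf xi' eta' k s r c w'"
proof -
  have "bpi xi eta l w = bpi xi' eta' l w'" if "l \<le> k" for l
    using assms that by (intro bpi_cong) auto
  then show ?thesis
    unfolding bpi_mgf_def using assms(2) by (auto intro!: arg_cong2[where f = "(*)"] prod.cong)
qed

lemma bpi_mgf_measurable: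
  assumes "\<And>i j. 1 \<le> i \<Longrightarrow> i \<le> k \<Longrightarrow> 1 \<le> j \<Longrightarrow> xi i j \<in> measurable M (count_space UNIV)"
    and "\<And>i. 1 \<le> i \<Longrightarrow> i \<le> k \<Longrightarrow> eta i \<in> measurable M (count_space UNIV)"
  shows "bpi_mgf xi eta k s r c \<in> borel_measurable M"
proof -
  have b: "(\<lambda>w. d ^ bpi xi eta l w) \<in> borel_measurable M" if "l \<le> k" for l and d :: real
    using assms that by (intro measurable_compose[OF bpi_measurable, of _ _ _ _ "\<lambda>n. d ^ n"]) auto
  have e: "(\<lambda>w. d ^ eta i w) \<in> borel_measurable M" if "1 \<le> i" "i \<le> k" for i and d :: real
    using assms that by (intro measurable_compose[of "eta i" _ _ "\<lambda>n. d ^ n"]) auto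
  have "bpi_mgf xi eta k s r c =
      (\<lambda>w. s ^ bpi xi eta k w * (\<Prod>i=1..k. r ^ eta i w * c ^ bpi xi eta (i - 1) w))"
    by (simp add: fun_eq_iff bpi_mgf_def)
  then show ?thesis
    by (auto intro!: borel_measurable_times borel_measurable_prod b e)
qed

lemma bpi_mgf_bounds:
  assumes "0 \<le> s" "s \<le> 1" "0 \<le> r" "r \<le> 1" "0 \<le> c" "c \<le> 1"
  shows "0 \<le> bpi_mgf xi eta k s r c w" "bpi_mgf xi eta k s r c w \<le> 1"
proof -
  show "0 \<le> bpi_mgf xi eta k s r c w"
    unfolding bpi_mgf_def using assms by (intro mult_nonneg_nonneg prod_nonneg) auto
  have "(\<Prod>i=1..k. r ^ eta i w * c ^ bpi xi eta (i - 1) w) \<le> 1"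
    using assms by (intro prod_le_1) (auto intro!: mult_le_one power_le_one)
  then show "bpi_mgf xi eta k s r c w \<le> 1"
    unfolding bpi_mgf_def using assms
    by (intro mult_le_one) (auto intro!: power_le_one prod_nonneg)
qed

section \<open>Backward recursion for the joint generating function\<close>

locale branching = prob_space M for M :: "'a measure" +
  fixes xi :: "nat \<Rightarrow> nat \<Rightarrow> 'a \<Rightarrow> nat" and eta :: "nat \<Rightarrow> 'a \<Rightarrow> nat" and p q :: "nat pmf"
  assumes indep: "indep_vars (\<lambda>_. count_space UNIV)
          (\<lambda>i. case i of Inl (k, j) \<Rightarrow> xi k j | Inr k \<Rightarrow> eta k)
          ({(k, j). k \<ge> 1 \<and> j \<ge> 1} <+> {k. k \<ge> 1})"
    and xi_law: "\<And>k j. k \<ge> 1 \<Longrightarrow> j \<ge> 1 \<Longrightarrow> distr M (count_space UNIV) (xi k j) = measure_pmf p"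
    and eta_law: "\<And>k. k \<ge> 1 \<Longrightarrow> distr M (count_space UNIV) (eta k) = measure_pmf q"
begin

definition "X = (\<lambda>i. case i of Inl (k, j) \<Rightarrow> xi k j | Inr k \<Rightarrow> eta k)"

lemma xi_measurable: "k \<ge> 1 \<Longrightarrow> j \<ge> 1 \<Longrightarrow> xi k j \<in> measurable M (count_space UNIV)"
  using indep unfolding indep_vars_def2 by (auto dest!: bspec[where x = "Inl (k, j)"])

lemma eta_measurable: "k \<ge> 1 \<Longrightarrow> eta k \<in> measurable M (count_space UNIV)"
  using indep unfolding indep_vars_def2 by (auto dest!: bspec[where x = "Inr k"])

lemma bpi_rv: "bpi xi eta k \<in> measurable M (count_space UNIV)"
  by (intro bpi_measurable xi_measurable eta_measurable)

lemma bpi_mgf_rv: "bpi_mgf xi eta k s r c \<in> borel_measurable M"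
  by (intro bpi_mgf_measurable xi_measurable eta_measurable)

lemma expectation_power_xi:
  assumes "k \<ge> 1" "j \<ge> 1" "0 \<le> s" "s \<le> 1"
  shows "expectation (\<lambda>w. s ^ xi k j w) = gen p s"
proof -
  have "expectation (\<lambda>w. s ^ xi k j w) = (\<integral>x. s ^ x \<partial>distr M (count_space UNIV) (xi k j))"
    by (rule integral_distr[symmetric]) (use assms xi_measurable in auto)
  then show ?thesis using assms by (simp add: xi_law gen_eq_expectation)
qed

lemma expectation_power_eta:
  assumes "k \<ge> 1" "0 \<le> s" "s \<le> 1"
  shows "expectation (\<lambda>w. s ^ eta k w) = gen q s"
proof -
  have "expectation (\<lambda>w. s ^ eta k w) = (\<integral>x. s ^ x \<partial>distr M (count_space UNIV) (eta k))"
    by (rule integral_distr[symmetric]) (use assms eta_measurable in auto)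
  then show ?thesis using assms by (simp add: eta_law gen_eq_expectation)
qed

text \<open>On the event that the population at time \<open>k\<close> equals \<open>t\<close>, the next generation is
  a function of finitely many variables that are independent of the past, grouped here as the
  block indexed by \<open>None\<close>.\<close>
lemma expectation_fibre:
  assumes s: "0 \<le> s" "s \<le> 1" and r: "0 \<le> r" "r \<le> 1" and c: "0 \<le> c" "c \<le> 1"
  shows "expectation (\<lambda>w. indicator {w. bpi xi eta k w = t} w * bpi_mgf xi eta (Suc k) s r c w) =
    gen q (s * r) *
      expectation (\<lambda>w. indicator {w. bpi xi eta k w = t} w * bpi_mgf xi eta k (gen p s * c) r c w)"
proof -
  define I :: "(nat \<times> nat + nat) set" where "I = {(k, j). k \<ge> 1 \<and> j \<ge> 1} <+> {k. k \<ge> 1}"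
  define past :: "(nat \<times> nat + nat) set" where "past = {(i, j). 1 \<le> i \<and> i \<le> k \<and> j \<ge> 1} <+> {i. 1 \<le> i \<and> i \<le> k}"
  \<comment> \<open>On the fibre where the population is \<open>t\<close>, generation
    \<open>k + 1\<close> uses only these \<open>t + 1\<close> variables, so the factorisation runs
    over a finite index set.\<close>
  define New :: "(nat \<times> nat + nat) set" where "New = insert (Inr (Suc k)) ((\<lambda>j. Inl (Suc k, j)) ` {1..t})"
  define L where "L = insert None (Some ` New)"
  define B where "B = (\<lambda>l. case l of None \<Rightarrow> past | Some i \<Rightarrow> {i :: nat \<times> nat + nat})"
  \<comment> \<open>Coordinate maps in the role of offspring and immigration numbers: the past
    becomes a branching process on configurations, so \<open>\<Phi>\<close> depends on the block
    \<open>past\<close> alone.\<close>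
  define PX where "PX = (\<lambda>i j (f :: nat \<times> nat + nat \<Rightarrow> nat). f (Inl (i, j)))"
  define PE where "PE = (\<lambda>i (f :: nat \<times> nat + nat \<Rightarrow> nat). f (Inr i))"
  \<comment> \<open>On the fibre the weight of the population at time \<open>k\<close> is the
    constant \<open>c ^ t\<close>; the terminal argument is 1 because the power of \<open>s\<close>
    is carried by the new variables.\<close>
  define \<Phi> where "\<Phi> = (\<lambda>f. indicator {f. bpi PX PE k f = t} f * (c ^ t * bpi_mgf PX PE k 1 r c f))"
  \<comment> \<open>New immigrants enter both the population and the immigration total, hence the
    base \<open>s * r\<close>; offspring enter the population only.\<close>
  define G where "G = (\<lambda>l. case l of None \<Rightarrow> \<Phi> | Some i \<Rightarrow>
      (\<lambda>f :: nat \<times> nat + nat \<Rightarrow> nat. (case i of Inl _ \<Rightarrow> s | Inr _ \<Rightarrow> s * r) ^ f i))"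
  define Z where "Z = (\<lambda>l w. G l (restrict (\<lambda>i. X i w) (B l)))"
  have sr: "0 \<le> s * r" "s * r \<le> 1" using s r by (auto intro: mult_le_one)
  have ind: "indep_vars (\<lambda>_. count_space UNIV) X I"
    using indep by (simp add: X_def I_def)
  have "indep_vars (\<lambda>l. PiM (B l) (\<lambda>_. count_space UNIV)) (\<lambda>l w. restrict (\<lambda>i. X i w) (B l)) L"
  proof (rule indep_vars_restrict[OF ind])
    show "B l \<subseteq> I" if "l \<in> L" for l
      using that by (auto simp: L_def B_def New_def past_def I_def)
    show "disjoint_family_on B L"
      by (auto simp: disjoint_family_on_def L_def B_def New_def past_def)
  qed
  then have indZ: "indep_vars (\<lambda>_. borel) Z L"
    unfolding Z_def
  proof (rule indep_vars_compose2)
    fix l assume "l \<in> L"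
    show "G l \<in> measurable (PiM (B l) (\<lambda>_. count_space UNIV)) borel"
    proof (cases l)
      case None
      have mX: "PX i j \<in> measurable (PiM past (\<lambda>_. count_space UNIV)) (count_space UNIV)"
        if "1 \<le> i" "i \<le> k" "1 \<le> j" for i j
        unfolding PX_def using that by (intro measurable_component_singleton) (auto simp: past_def)
      have mE: "PE i \<in> measurable (PiM past (\<lambda>_. count_space UNIV)) (count_space UNIV)"
        if "1 \<le> i" "i \<le> k" for i
        unfolding PE_def using that by (intro measurable_component_singleton) (auto simp: past_def)
      have [measurable]: "bpi PX PE k \<in> measurable (PiM past (\<lambda>_. count_space UNIV)) (count_space UNIV)"
        by (intro bpi_measurable mX mE)
      have [measurable]: "bpi_mgf PX PE k 1 r c \<in> borel_measurable (PiM past (\<lambda>_. count_space UNIV))"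
        by (intro bpi_mgf_measurable mX mE)
      have "\<Phi> \<in> borel_measurable (PiM past (\<lambda>_. count_space UNIV))"
        unfolding \<Phi>_def by measurable
      then show ?thesis by (simp add: None G_def B_def)
    next
      case (Some i)
      have "(\<lambda>f. f i) \<in> measurable (PiM {i} (\<lambda>_. count_space UNIV)) (count_space UNIV)"
        by (rule measurable_component_singleton) simp
      then show ?thesis
        by (auto simp: Some G_def B_def intro!: measurable_compose[of "\<lambda>f. f i"])
    qed
  qed
  have fin: "finite L" by (simp add: L_def New_def)
  have bdd: "\<bar>Z l w\<bar> \<le> 1" if "l \<in> L" for l w
  proof (cases l)
    case None
    then show ?thesis
      using bpi_mgf_bounds[of 1 r c PX PE k] r c
      by (auto simp: Z_def G_def \<Phi>_def indicator_def abs_mult power_abs intro!: mult_le_one power_le_one)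
  next
    case (Some i)
    then show ?thesis
      using s sr by (auto simp: Z_def G_def abs_mult power_abs split: sum.splits intro!: mult_le_one power_le_one)
  qed
  have int: "integrable M (Z l)" if "l \<in> L" for l
    by (rule integrable_const_bound[where B = 1])
       (use that bdd indZ in \<open>auto simp: indep_vars_def\<close>)
  have prod: "expectation (\<lambda>w. \<Prod>l\<in>L. Z l w) = (\<Prod>l\<in>L. expectation (Z l))"
    by (rule indep_vars_lebesgue_integral[OF fin indZ int])
  have ZN: "Z None w = indicator {w. bpi xi eta k w = t} w * (c ^ t * bpi_mgf xi eta k 1 r c w)" for w
  proof -
    have "bpi PX PE k (restrict (\<lambda>i. X i w) past) = bpi xi eta k w"
      by (rule bpi_cong) (auto simp: PX_def PE_def X_def past_def)
    moreover have "bpi_mgf PX PE k 1 r c (restrict (\<lambda>i. X i w) past) = bpi_mgf xi eta k 1 r c w"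
      by (rule bpi_mgf_cong) (auto simp: PX_def PE_def X_def past_def)
    ultimately show ?thesis by (simp add: Z_def G_def B_def \<Phi>_def indicator_def)
  qed
  have split: "(\<Prod>l\<in>L. u l) = u None * (u (Some (Inr (Suc k))) * (\<Prod>j=1..t. u (Some (Inl (Suc k, j)))))"
    for u :: "_ \<Rightarrow> real"
  proof -
    have "(\<Prod>l\<in>L. u l) = u None * (\<Prod>l\<in>Some ` New. u l)"
      unfolding L_def by (rule prod.insert) (auto simp: New_def)
    also have "(\<Prod>l\<in>Some ` New. u l) = (\<Prod>i\<in>New. u (Some i))"
      by (subst prod.reindex) auto
    also have "\<dots> = u (Some (Inr (Suc k))) * (\<Prod>i\<in>(\<lambda>j. Inl (Suc k, j)) ` {1..t}. u (Some i))"
      unfolding New_def by (rule prod.insert) auto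
    also have "(\<Prod>i\<in>(\<lambda>j. Inl (Suc k, j)) ` {1..t}. u (Some i)) = (\<Prod>j=1..t. u (Some (Inl (Suc k, j))))"
      by (subst prod.reindex) (auto simp: inj_on_def)
    finally show ?thesis .
  qed
  have ZE: "Z (Some (Inr (Suc k))) = (\<lambda>w. (s * r) ^ eta (Suc k) w)"
    by (simp add: Z_def G_def B_def X_def fun_eq_iff)
  have ZX: "Z (Some (Inl (Suc k, j))) = (\<lambda>w. s ^ xi (Suc k) j w)" for j
    by (simp add: Z_def G_def B_def X_def fun_eq_iff)
  have step: "bpi_mgf xi eta (Suc k) s r c w = c ^ bpi xi eta k w * bpi_mgf xi eta k 1 r c w *
      ((s * r) ^ eta (Suc k) w * (\<Prod>j=1..bpi xi eta k w. s ^ xi (Suc k) j w))" for w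
  proof -
    define P where "P = (\<Prod>i=1..k. r ^ eta i w * c ^ bpi xi eta (i - 1) w)"
    have "bpi_mgf xi eta (Suc k) s r c w = s ^ bpi xi eta (Suc k) w * (P * (r ^ eta (Suc k) w * c ^ bpi xi eta k w))"
      unfolding bpi_mgf_def P_def by simp
    also have "s ^ bpi xi eta (Suc k) w = (\<Prod>j=1..bpi xi eta k w. s ^ xi (Suc k) j w) * s ^ eta (Suc k) w"
      by (simp only: bpi.simps power_add power_sum)
    also have "P = bpi_mgf xi eta k 1 r c w" by (simp add: bpi_mgf_def P_def)
    finally show ?thesis by (simp only: power_mult_distrib mult_ac)
  qed
  have lhs: "indicator {w. bpi xi eta k w = t} w * bpi_mgf xi eta (Suc k) s r c w = (\<Prod>l\<in>L. Z l w)" for w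
    unfolding split ZN ZE ZX step by (simp add: indicator_def)
  have rhs: "(\<Prod>l\<in>L. expectation (Z l)) =
      gen q (s * r) * (gen p s ^ t * expectation (Z None))"
  proof -
    have "expectation (Z (Some (Inr (Suc k)))) = gen q (s * r)"
      using expectation_power_eta[of "Suc k" "s * r"] sr by (simp add: ZE)
    moreover have "expectation (Z (Some (Inl (Suc k, j)))) = gen p s" if "j \<in> {1..t}" for j
      using expectation_power_xi[of "Suc k" j s] s that by (simp add: ZX)
    ultimately show ?thesis unfolding split by simp
  qed
  \<comment> \<open>On the fibre \<open>gen p s ^ t * c ^ t\<close> is a power of
    \<open>gen p s * c\<close> whose exponent is the population at time \<open>k\<close>, so the
    constants turn into a new terminal argument.\<close>
  have "gen p s ^ t * expectation (Z None) = expectation (\<lambda>w. gen p s ^ t * Z None w)"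
    by simp
  also have "\<dots> = expectation (\<lambda>w. indicator {w. bpi xi eta k w = t} w * bpi_mgf xi eta k (gen p s * c) r c w)"
    by (rule Bochner_Integration.integral_cong)
       (simp_all add: ZN indicator_def bpi_mgf_def power_mult_distrib)
  finally show ?thesis
    unfolding lhs prod rhs by simp
qed

lemma expectation_bpi_mgf_Suc:
  assumes s: "0 \<le> s" "s \<le> 1" and r: "0 \<le> r" "r \<le> 1" and c: "0 \<le> c" "c \<le> 1"
  shows "expectation (bpi_mgf xi eta (Suc k) s r c) =
    gen q (s * r) * expectation (bpi_mgf xi eta k (gen p s * c) r c)"
proof -
  have sr: "0 \<le> s * r" "s * r \<le> 1" using s r by (auto intro: mult_le_one)
  have gc: "0 \<le> gen p s * c" "gen p s * c \<le> 1"
    using s c gen_nonneg gen_le_1 by (auto intro: mult_le_one)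
  have [measurable]: "bpi_mgf xi eta k' s' r' c' \<in> borel_measurable M" for k' s' r' c'
    by (rule bpi_mgf_rv)
  have [measurable]: "bpi xi eta k' \<in> measurable M (count_space UNIV)" for k' by (rule bpi_rv)
  have "expectation (bpi_mgf xi eta (Suc k) s r c) =
      expectation (\<lambda>w. gen q (s * r) * bpi_mgf xi eta k (gen p s * c) r c w)"
  proof (rule integral_eq_by_fibres[where T = "bpi xi eta k"])
    fix w
    show "\<bar>bpi_mgf xi eta (Suc k) s r c w\<bar> \<le> 1"
      using bpi_mgf_bounds[OF s r c, of xi eta "Suc k" w] by simp
    show "\<bar>gen q (s * r) * bpi_mgf xi eta k (gen p s * c) r c w\<bar> \<le> 1"
      using bpi_mgf_bounds[OF gc r c, of xi eta k w] gen_nonneg[OF sr] gen_le_1[OF sr]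
      by (simp add: abs_mult mult_le_one)
  next
    fix t
    have "expectation (\<lambda>w. indicator {w. bpi xi eta k w = t} w * (gen q (s * r) * bpi_mgf xi eta k (gen p s * c) r c w))
      = expectation (\<lambda>w. gen q (s * r) * (indicator {w. bpi xi eta k w = t} w * bpi_mgf xi eta k (gen p s * c) r c w))"
      by (simp add: mult_ac)
    then show "expectation (\<lambda>w. indicator {w. bpi xi eta k w = t} w * bpi_mgf xi eta (Suc k) s r c w)
      = expectation (\<lambda>w. indicator {w. bpi xi eta k w = t} w * (gen q (s * r) * bpi_mgf xi eta k (gen p s * c) r c w))"
      using expectation_fibre[OF assms, of k t] by simp
  qed simp_all
  then show ?thesis by simp
qed

text \<open>Every backward step emits one factor \<open>gen q\<close> and replaces the terminal
  argument \<open>s\<close> by \<open>gen p s * c\<close>. As the population starts at 0, nothing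
  else remains after \<open>k\<close> steps. The argument changes on the way, hence the induction
  for arbitrary \<open>s\<close>.\<close>

lemma expectation_bpi_mgf:
  assumes s: "0 \<le> s" "s \<le> 1" and r: "0 \<le> r" "r \<le> 1" and c: "0 \<le> c" "c \<le> 1"
  shows "expectation (bpi_mgf xi eta k s r c) =
    (\<Prod>j<k. gen q (((\<lambda>s. gen p s * c) ^^ j) s * r))"
  using s
proof (induction k arbitrary: s)
  case 0
  then show ?case by (simp add: bpi_mgf_def[abs_def] prob_space)
next
  case (Suc k)
  have gc: "0 \<le> gen p s * c" "gen p s * c \<le> 1"
    using Suc.prems c gen_nonneg gen_le_1 by (auto intro: mult_le_one)
  have "expectation (bpi_mgf xi eta (Suc k) s r c) =
      gen q (s * r) * (\<Prod>j<k. gen q (((\<lambda>s. gen p s * c) ^^ j) (gen p s * c) * r))"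
    using expectation_bpi_mgf_Suc[OF Suc.prems r c] Suc.IH[OF gc] by simp
  then show ?case
    unfolding prod.lessThan_Suc_shift by (simp add: funpow_Suc_right del: funpow.simps)
qed

end

subsection \<open>Comparison of Euler schemes\<close>

text \<open>The induction carries \<open>exp (K * j / n) * (e 0 + j * \<epsilon> / n)\<close>, which
  for \<open>j \<le> n\<close> is bounded independently of \<open>n\<close>. The growth factor is an
  exponential because the flow over time 1/n supplies it in this form, and the factor 1 + K/n of an
  Euler step is smaller.\<close>

lemma discrete_gronwall:
  fixes e :: "nat \<Rightarrow> real" and n :: nat
  assumes step: "\<And>j. j < n \<Longrightarrow> e (Suc j) \<le> exp (K / n) * e j + \<epsilon> / n"
    and K: "0 \<le> K" and \<epsilon>: "0 \<le> \<epsilon>" and e0: "0 \<le> e 0" and j: "j \<le> n"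
  shows "e j \<le> exp K * (e 0 + \<epsilon>)"
proof (cases "n = 0")
  case True
  have "1 * (e 0 + 0) \<le> exp K * (e 0 + \<epsilon>)"
    using K \<epsilon> e0 by (intro mult_mono) auto
  then show ?thesis using True j by simp
next
  case False
  have "e j \<le> exp (K * j / n) * (e 0 + j * \<epsilon> / n)"
    using j
  proof (induction j)
    case (Suc j)
    have "e (Suc j) \<le> exp (K / n) * e j + \<epsilon> / n"
      using Suc.prems by (intro step) simp
    also have "\<dots> \<le> exp (K / n) * (exp (K * j / n) * (e 0 + j * \<epsilon> / n)) + 1 * (\<epsilon> / n)"
      using Suc by simp
    also have "\<dots> \<le> exp (K / n) * (exp (K * j / n) * (e 0 + j * \<epsilon> / n)) + exp (K * Suc j / n) * (\<epsilon> / n)"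
      using K \<epsilon> by (intro add_left_mono mult_right_mono) auto
    also have "\<dots> = exp (K * Suc j / n) * (e 0 + Suc j * \<epsilon> / n)"
      using False by (simp add: exp_add[symmetric] field_simps)
    finally show ?case .
  qed simp
  also have "\<dots> \<le> exp K * (e 0 + \<epsilon>)"
  proof (intro mult_mono add_left_mono)
    have jn: "real j / n \<le> 1" using j False by simp
    show "exp (K * j / n) \<le> exp K"
      using mult_left_mono[OF jn K] by simp
    show "j * \<epsilon> / n \<le> \<epsilon>"
      using mult_right_mono[OF jn \<epsilon>] by simp
    show "0 \<le> e 0 + j * \<epsilon> / n" using e0 \<epsilon> by simp
  qed simp
  finally show ?thesis .
qed

text \<open>The second bound follows from \<open>exp (- x) \<le> 1 / (1 + x)\<close> and (1 - x +
  x^2)(1 + x) = 1 + x^3. Its quadratic coefficient is not sharp; only the order of the error matters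
  later.\<close>

lemma exp_minus_bounds:
  fixes x :: real
  assumes "0 \<le> x"
  shows "1 - exp (- x) \<le> x" "x - x\<^sup>2 \<le> 1 - exp (- x)"
proof -
  show "1 - exp (- x) \<le> x" using exp_ge_add_one_self[of "- x"] by simp
  have "exp (- x) \<le> 1 / (1 + x)"
    using exp_ge_add_one_self[of x] assms by (simp add: exp_minus field_simps)
  also have "\<dots> \<le> 1 - x + x\<^sup>2"
  proof -
    have "1 \<le> (1 - x + x\<^sup>2) * (1 + x)"
      using assms by (simp add: algebra_simps power2_eq_square)
    then show ?thesis using assms by (simp add: divide_le_eq)
  qed
  finally show "x - x\<^sup>2 \<le> 1 - exp (- x)" by simp
qed

text \<open>\<open>b * (1 - exp (- z / b))\<close> is the Laplace argument \<open>z\<close>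
  translated to the scale of \<open>Rfun\<close> and \<open>Ffun\<close>. The first bound, free of
  an error term, feeds the a priori estimates; the second measures the translation error.\<close>

lemma scaled_exp_error:
  fixes b z :: real
  assumes "0 < b" "0 \<le> z"
  shows "b * (1 - exp (- z / b)) \<le> z" "\<bar>b * (1 - exp (- z / b)) - z\<bar> \<le> z\<^sup>2 / b"
proof -
  have "b * (1 - exp (- (z / b))) \<le> b * (z / b)" "b * (z / b - (z / b)\<^sup>2) \<le> b * (1 - exp (- (z / b)))"
    using assms exp_minus_bounds[of "z / b"] by (intro mult_left_mono; simp)+
  moreover have "b * (z / b) = z" "b * (z / b - (z / b)\<^sup>2) = z - z\<^sup>2 / b"
    using assms by (simp_all add: field_simps power2_eq_square)
  moreover have "0 \<le> z\<^sup>2 / b" using assms by simp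
  ultimately show "b * (1 - exp (- z / b)) \<le> z" "\<bar>b * (1 - exp (- z / b)) - z\<bar> \<le> z\<^sup>2 / b"
    unfolding minus_divide_left by linarith+
qed

lemma abs_exp_minus_diff:
  fixes x y :: real
  assumes "0 \<le> x" "0 \<le> y"
  shows "\<bar>exp (- x) - exp (- y)\<bar> \<le> \<bar>x - y\<bar>"
proof -
  have *: "\<bar>exp (- x) - exp (- y)\<bar> \<le> y - x" if "0 \<le> x" "x \<le> y" for x y :: real
  proof -
    have "exp (- x) - exp (- y) = exp (- x) * (1 - exp (- (y - x)))"
      by (simp add: algebra_simps exp_add[symmetric])
    also have "\<dots> \<le> 1 * (y - x)"
      using that exp_minus_bounds[of "y - x"] by (intro mult_mono) auto
    finally show ?thesis using that by simp
  qed
  show ?thesis using *[of x y] *[of y x] assms by (cases "x \<le> y") (auto simp: abs_minus_commute)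
qed

text \<open>Finite subcover argument shared by \<open>Rfun_uniform\<close> and
  \<open>Ffun_uniform\<close>, which obtain the local estimate differently: from a common Lipschitz
  constant in one case, from monotonicity in the other.\<close>

lemma eventually_uniform_on_compact:
  fixes f :: "nat \<Rightarrow> real \<Rightarrow> real"
  assumes "compact S"
    and "\<And>x. x \<in> S \<Longrightarrow> \<exists>d>0. \<forall>\<^sub>F n in sequentially. \<forall>y\<in>S \<inter> ball x d. \<bar>f n y - g y\<bar> < e"
  shows "\<forall>\<^sub>F n in sequentially. \<forall>y\<in>S. \<bar>f n y - g y\<bar> < e"
proof -
  obtain d where d: "\<And>x. x \<in> S \<Longrightarrow> d x > 0"
      "\<And>x. x \<in> S \<Longrightarrow> \<forall>\<^sub>F n in sequentially. \<forall>y\<in>S \<inter> ball x (d x). \<bar>f n y - g y\<bar> < e"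
    using bchoice[of S "\<lambda>x d. d > 0 \<and> (\<forall>\<^sub>F n in sequentially. \<forall>y\<in>S \<inter> ball x d. \<bar>f n y - g y\<bar> < e)"] assms(2)
    by blast
  obtain C where C: "C \<subseteq> S" "finite C" "S \<subseteq> (\<Union>x\<in>C. ball x (d x))"
    by (rule compactE_image[OF assms(1), of S "\<lambda>x. ball x (d x)"]) (use d in auto)
  have "\<forall>\<^sub>F n in sequentially. \<forall>x\<in>C. \<forall>y\<in>S \<inter> ball x (d x). \<bar>f n y - g y\<bar> < e"
    using C d by (intro eventually_ball_finite) auto
  then show ?thesis
    by eventually_elim (use C(3) in blast)
qed

section \<open>The limits R and F: growth, monotonicity, locally uniform convergence\<close>

locale scaling_limit =
  fixes p q :: "nat \<Rightarrow> nat pmf" and b :: "nat \<Rightarrow> real" and R F :: "real \<Rightarrow> real"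
    and \<psi> :: "real \<Rightarrow> real \<Rightarrow> real"
  assumes b_pos: "\<And>n. n \<ge> 1 \<Longrightarrow> b n > 0"
    and b_lim: "filterlim b at_top sequentially"
    and A_lip: "\<And>c. c \<ge> 0 \<Longrightarrow> \<exists>K. \<forall>n \<ge> 1. \<forall>x y. 0 \<le> x \<longrightarrow> x \<le> c \<longrightarrow> x \<le> b n \<longrightarrow>
          0 \<le> y \<longrightarrow> y \<le> c \<longrightarrow> y \<le> b n \<longrightarrow>
          \<bar>Rfun n (b n) (p n) x - Rfun n (b n) (p n) y\<bar> \<le> K * \<bar>x - y\<bar>"
    and A_lim: "\<And>x. x \<ge> 0 \<Longrightarrow> (\<lambda>n. Rfun n (b n) (p n) x) \<longlonglongrightarrow> R x"
    and B_lim: "\<And>x. x \<ge> 0 \<Longrightarrow> (\<lambda>n. Ffun n (b n) (q n) x) \<longlonglongrightarrow> F x"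
    and B_cont: "continuous_on {0..} F"
    and psi: "psi_sol R \<psi>"
begin

lemma eventually_b_ge: "\<forall>\<^sub>F n in sequentially. c \<le> b n"
  using b_lim by (auto simp: filterlim_at_top)

lemma eventually_div_b_less: "e > 0 \<Longrightarrow> \<forall>\<^sub>F n in sequentially. c / b n < e"
proof -
  assume "e > 0"
  have "(\<lambda>n. c / b n) \<longlonglongrightarrow> 0"
    by (rule tendsto_divide_0[OF tendsto_const filterlim_at_top_imp_at_infinity[OF b_lim]])
  then show ?thesis using \<open>e > 0\<close> by (rule order_tendstoD)
qed

lemma eventually_div_n_less: "e > 0 \<Longrightarrow> \<forall>\<^sub>F n in sequentially. c / real n < e"
  by (rule order_tendstoD[OF lim_const_over_n])

lemma R_0 [simp]: "R 0 = 0"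
  using A_lim[of 0] by (simp add: LIMSEQ_const_iff)

text \<open>Fixes for each \<open>c\<close> one Lipschitz constant on [0, c] valid for all
  \<open>n\<close>, so that explicit constants such as \<open>exp (Lip 1)\<close> can be passed from
  one statement to another.\<close>

definition Lip :: "real \<Rightarrow> real" where
  "Lip c = (SOME K. 0 \<le> K \<and> (\<forall>n \<ge> 1. \<forall>x y. 0 \<le> x \<longrightarrow> x \<le> c \<longrightarrow> x \<le> b n \<longrightarrow>
          0 \<le> y \<longrightarrow> y \<le> c \<longrightarrow> y \<le> b n \<longrightarrow>
          \<bar>Rfun n (b n) (p n) x - Rfun n (b n) (p n) y\<bar> \<le> K * \<bar>x - y\<bar>))"

lemma
  assumes "0 \<le> c"
  shows Lip_nonneg: "0 \<le> Lip c"
    and Rfun_lipschitz: "\<And>n x y. n \<ge> 1 \<Longrightarrow> 0 \<le> x \<Longrightarrow> x \<le> c \<Longrightarrow> x \<le> b n \<Longrightarrow> 0 \<le> y \<Longrightarrow> y \<le> c \<Longrightarrow> y \<le> b n \<Longrightarrow>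
      \<bar>Rfun n (b n) (p n) x - Rfun n (b n) (p n) y\<bar> \<le> Lip c * \<bar>x - y\<bar>"
proof -
  obtain K0 where K0: "\<And>n x y. n \<ge> 1 \<Longrightarrow> 0 \<le> x \<Longrightarrow> x \<le> c \<Longrightarrow> x \<le> b n \<Longrightarrow> 0 \<le> y \<Longrightarrow> y \<le> c \<Longrightarrow> y \<le> b n \<Longrightarrow>
      \<bar>Rfun n (b n) (p n) x - Rfun n (b n) (p n) y\<bar> \<le> K0 * \<bar>x - y\<bar>"
    using A_lip[OF assms] by blast
  define K where "K = max K0 0"
  have "\<bar>Rfun n (b n) (p n) x - Rfun n (b n) (p n) y\<bar> \<le> K * \<bar>x - y\<bar>"
    if "n \<ge> 1" "0 \<le> x" "x \<le> c" "x \<le> b n" "0 \<le> y" "y \<le> c" "y \<le> b n" for n x y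
  proof -
    have "K0 * \<bar>x - y\<bar> \<le> K * \<bar>x - y\<bar>" unfolding K_def by (intro mult_right_mono) auto
    then show ?thesis using K0[OF that] by linarith
  qed
  then have "\<exists>K. 0 \<le> K \<and> (\<forall>n \<ge> 1. \<forall>x y. 0 \<le> x \<longrightarrow> x \<le> c \<longrightarrow> x \<le> b n \<longrightarrow>
          0 \<le> y \<longrightarrow> y \<le> c \<longrightarrow> y \<le> b n \<longrightarrow>
          \<bar>Rfun n (b n) (p n) x - Rfun n (b n) (p n) y\<bar> \<le> K * \<bar>x - y\<bar>)"
    by (intro exI[of _ K]) (auto simp: K_def)
  from someI_ex[OF this, folded Lip_def]
  show "0 \<le> Lip c" "\<And>n x y. n \<ge> 1 \<Longrightarrow> 0 \<le> x \<Longrightarrow> x \<le> c \<Longrightarrow> x \<le> b n \<Longrightarrow> 0 \<le> y \<Longrightarrow> y \<le> c \<Longrightarrow> y \<le> b n \<Longrightarrow>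
      \<bar>Rfun n (b n) (p n) x - Rfun n (b n) (p n) y\<bar> \<le> Lip c * \<bar>x - y\<bar>"
    by blast+
qed

lemma R_lipschitz:
  assumes "0 \<le> x" "x \<le> c" "0 \<le> y" "y \<le> c"
  shows "\<bar>R x - R y\<bar> \<le> Lip c * \<bar>x - y\<bar>"
proof (rule tendsto_upperbound)
  show "(\<lambda>n. \<bar>Rfun n (b n) (p n) x - Rfun n (b n) (p n) y\<bar>) \<longlonglongrightarrow> \<bar>R x - R y\<bar>"
    using assms by (intro tendsto_intros A_lim)
  show "\<forall>\<^sub>F n in sequentially. \<bar>Rfun n (b n) (p n) x - Rfun n (b n) (p n) y\<bar> \<le> Lip c * \<bar>x - y\<bar>"
    using eventually_b_ge[of c] eventually_ge_at_top[of 1]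
    by eventually_elim (use assms in \<open>auto intro!: Rfun_lipschitz\<close>)
qed simp

text \<open>The Lipschitz constants are tied to bounded intervals; concavity extends the slope on
  [0, 1] to a one-sided linear bound on all of [0, b n]. This is what keeps both schemes
  bounded.\<close>

lemma Rfun_growth:
  assumes "n \<ge> 1" "1 \<le> b n" "0 \<le> x" "x \<le> b n"
  shows "Rfun n (b n) (p n) x \<le> Lip 1 * x"
proof (rule Rfun_linear_bound)
  show "Rfun n (b n) (p n) y \<le> Lip 1 * y" if "0 \<le> y" "y \<le> 1" for y
    using Rfun_lipschitz[of 1 n y 0] assms that by auto
qed (use assms in auto)

lemma R_growth: "0 \<le> x \<Longrightarrow> R x \<le> Lip 1 * x"
proof (rule tendsto_upperbound[OF A_lim])
  assume "0 \<le> x"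
  show "\<forall>\<^sub>F n in sequentially. Rfun n (b n) (p n) x \<le> Lip 1 * x"
    using eventually_b_ge[of x] eventually_b_ge[of 1] eventually_ge_at_top[of 1]
    by eventually_elim (use \<open>0 \<le> x\<close> Rfun_growth in auto)
qed simp_all

lemma Rfun_uniform:
  assumes c: "0 \<le> c" and e: "0 < e"
  shows "\<forall>\<^sub>F n in sequentially. \<forall>x\<in>{0..c}. \<bar>Rfun n (b n) (p n) x - R x\<bar> < e"
proof (rule eventually_uniform_on_compact)
  fix x assume x: "x \<in> {0..c}"
  define K where "K = Lip c"
  have K: "0 \<le> K" using Lip_nonneg[OF c] by (simp add: K_def)
  define d where "d = e / (3 * (K + 1))"
  have d: "0 < d" "K * d \<le> e / 3"
    using e K by (auto simp: d_def field_simps)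
  have "\<forall>\<^sub>F n in sequentially. dist (Rfun n (b n) (p n) x) (R x) < e / 3"
    using x e by (intro tendstoD A_lim) auto
  then have "\<forall>\<^sub>F n in sequentially. \<forall>y\<in>{0..c} \<inter> ball x d. \<bar>Rfun n (b n) (p n) y - R y\<bar> < e"
    using eventually_b_ge[of c] eventually_ge_at_top[of 1]
  proof eventually_elim
    case (elim n)
    show ?case
    proof
      fix y assume y: "y \<in> {0..c} \<inter> ball x d"
      have "K * \<bar>x - y\<bar> \<le> K * d" using K y by (intro mult_left_mono) (auto simp: dist_real_def)
      moreover have "\<bar>Rfun n (b n) (p n) x - Rfun n (b n) (p n) y\<bar> \<le> K * \<bar>x - y\<bar>"
        unfolding K_def using x y elim c by (intro Rfun_lipschitz) auto
      moreover have "\<bar>R x - R y\<bar> \<le> K * \<bar>x - y\<bar>" unfolding K_def using x y by (intro R_lipschitz) auto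
      moreover have "\<bar>Rfun n (b n) (p n) x - R x\<bar> < e / 3" using elim by (simp add: dist_real_def)
      ultimately show "\<bar>Rfun n (b n) (p n) y - R y\<bar> < e" using d(2) by linarith
    qed
  qed
  with d show "\<exists>d>0. \<forall>\<^sub>F n in sequentially. \<forall>y\<in>{0..c} \<inter> ball x d. \<bar>Rfun n (b n) (p n) y - R y\<bar> < e"
    by blast
qed simp

lemma Ffun_mono:
  assumes "n \<ge> 1" "0 \<le> x" "x \<le> y" "y \<le> b n"
  shows "Ffun n (b n) (q n) x \<le> Ffun n (b n) (q n) y"
proof -
  have "gen (q n) (1 - y / b n) \<le> gen (q n) (1 - x / b n)"
    using assms b_pos[of n] by (intro gen_mono) (auto simp: divide_right_mono)
  then show ?thesis by (simp add: Ffun_def mult_left_mono)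
qed

lemma F_mono:
  assumes "0 \<le> x" "x \<le> y"
  shows "F x \<le> F y"
proof (rule tendsto_le)
  show "(\<lambda>n. Ffun n (b n) (q n) x) \<longlonglongrightarrow> F x" "(\<lambda>n. Ffun n (b n) (q n) y) \<longlonglongrightarrow> F y"
    using assms by (auto intro: B_lim)
  show "\<forall>\<^sub>F n in sequentially. Ffun n (b n) (q n) x \<le> Ffun n (b n) (q n) y"
    using eventually_b_ge[of y] eventually_ge_at_top[of 1]
    by eventually_elim (use assms in \<open>auto intro: Ffun_mono\<close>)
qed simp

lemma F_0 [simp]: "F 0 = 0"
  using B_lim[of 0] by (simp add: LIMSEQ_const_iff)

lemma F_nonneg: "0 \<le> x \<Longrightarrow> 0 \<le> F x"
  using F_mono[of 0 x] by simp

text \<open>Polya's argument: monotonicity and continuity of the limit make the convergence uniform.\<close>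
lemma Ffun_uniform:
  assumes c: "0 \<le> c" and e: "0 < e"
  shows "\<forall>\<^sub>F n in sequentially. \<forall>x\<in>{0..c}. \<bar>Ffun n (b n) (q n) x - F x\<bar> < e"
proof (rule eventually_uniform_on_compact)
  fix x assume x: "x \<in> {0..c}"
  obtain d0 where d0: "d0 > 0" "\<And>y. 0 \<le> y \<Longrightarrow> \<bar>y - x\<bar> < d0 \<Longrightarrow> \<bar>F y - F x\<bar> < e / 4"
  proof -
    have "x \<in> {0..}" "e / 4 > 0" using x e by auto
    then obtain d0 where "d0 > 0" "\<forall>y\<in>{0..}. dist y x < d0 \<longrightarrow> dist (F y) (F x) < e / 4"
      using B_cont unfolding continuous_on_iff by metis
    then show ?thesis using that by (auto simp: dist_real_def)
  qed
  define d where "d = d0 / 2"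
  have d: "0 < d" "d < d0" using d0 by (auto simp: d_def)
  \<comment> \<open>\<open>lo\<close> is cut off at 0, where the domain ends; \<open>hi\<close> may
    exceed \<open>c\<close>, and the requirement \<open>hi \<le> b n\<close> imposed below keeps it
    in the range where \<open>Ffun\<close> is monotone.\<close>
  define lo hi where "lo = max 0 (x - d)" and "hi = x + d"
  have lh: "0 \<le> lo" "0 \<le> hi" "\<bar>lo - x\<bar> < d0" "\<bar>hi - x\<bar> < d0" using d x by (auto simp: lo_def hi_def)
  have "\<forall>\<^sub>F n in sequentially. dist (Ffun n (b n) (q n) lo) (F lo) < e / 4"
    "\<forall>\<^sub>F n in sequentially. dist (Ffun n (b n) (q n) hi) (F hi) < e / 4"
    using lh e by (auto simp del: less_divide_eq_numeral1 intro!: tendstoD B_lim)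
  then have "\<forall>\<^sub>F n in sequentially. \<forall>y\<in>{0..c} \<inter> ball x d. \<bar>Ffun n (b n) (q n) y - F y\<bar> < e"
    using eventually_b_ge[of hi] eventually_ge_at_top[of 1]
  proof eventually_elim
    case (elim n)
    show ?case
    proof
      fix y assume y: "y \<in> {0..c} \<inter> ball x d"
      then have ly: "lo \<le> y" "y \<le> hi" "0 \<le> y" "\<bar>y - x\<bar> < d0"
        using d by (auto simp: lo_def hi_def dist_real_def)
      have "Ffun n (b n) (q n) lo \<le> Ffun n (b n) (q n) y" "Ffun n (b n) (q n) y \<le> Ffun n (b n) (q n) hi"
        using elim ly lh by (auto intro!: Ffun_mono)
      moreover have "\<bar>F y - F x\<bar> < e / 4" "\<bar>F lo - F x\<bar> < e / 4" "\<bar>F hi - F x\<bar> < e / 4"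
        using d0(2) ly lh by auto
      ultimately show "\<bar>Ffun n (b n) (q n) y - F y\<bar> < e"
        using elim unfolding dist_real_def by linarith
    qed
  qed
  with d show "\<exists>d>0. \<forall>\<^sub>F n in sequentially. \<forall>y\<in>{0..c} \<inter> ball x d. \<bar>Ffun n (b n) (q n) y - F y\<bar> < e"
    by blast
qed simp

section \<open>The flow of R: growth and one-step estimates\<close>

lemma psi_0: "0 \<le> z \<Longrightarrow> \<psi> z 0 = z"
  and psi_nonneg: "0 \<le> z \<Longrightarrow> 0 \<le> t \<Longrightarrow> 0 \<le> \<psi> z t"
  and psi_deriv: "0 \<le> z \<Longrightarrow> 0 \<le> t \<Longrightarrow> (\<psi> z has_real_derivative R (\<psi> z t)) (at t within {0..})"
  using psi unfolding psi_sol_def by auto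

lemma psi_mvt:
  assumes "0 \<le> z" "0 \<le> t"
  obtains s where "0 \<le> s" "s \<le> t" "\<psi> z t - z = R (\<psi> z s) * t"
proof -
  have "(\<psi> z has_derivative (*) (R (\<psi> z x))) (at x within {0..t})" if "0 \<le> x" "x \<le> t" for x
    using has_field_derivative_subset[OF psi_deriv[OF assms(1) that(1)], of "{0..t}"]
    by (auto simp: has_field_derivative_def)
  from mvt_very_simple[OF assms(2) this] show ?thesis
    using that psi_0[OF assms(1)] by auto
qed

text \<open>Gronwall's lemma through the mean value theorem: \<open>R x \<le> Lip 1 * x\<close>
  makes the derivative of \<open>\<psi> z t * exp (- (Lip 1 * t))\<close> nonpositive.\<close>

lemma psi_growth:
  assumes z: "0 \<le> z" and t: "0 \<le> t"
  shows "\<psi> z t \<le> z * exp (Lip 1 * t)"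
proof -
  define A where "A = Lip 1"
  define h where "h = (\<lambda>t. \<psi> z t * exp (- (A * t)))"
  define h' where "h' = (\<lambda>t. (R (\<psi> z t) - A * \<psi> z t) * exp (- (A * t)))"
  have "(h has_derivative (*) (h' x)) (at x within {0..t})" if "0 \<le> x" "x \<le> t" for x
  proof -
    have "(\<psi> z has_real_derivative R (\<psi> z x)) (at x within {0..t})"
      by (rule has_field_derivative_subset[OF psi_deriv[OF z that(1)]]) auto
    then have "(h has_real_derivative h' x) (at x within {0..t})"
      unfolding h_def h'_def by (auto intro!: derivative_eq_intros simp: algebra_simps)
    then show ?thesis by (simp add: has_field_derivative_def)
  qed
  from mvt_very_simple[OF t this] obtain s where s: "s \<in> {0..t}" "h t - h 0 = h' s * t" by auto
  have "h' s \<le> 0"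
    using R_growth[of "\<psi> z s"] psi_nonneg[OF z, of s] s by (auto simp: h'_def A_def intro!: mult_nonpos_nonneg)
  then have "h' s * t \<le> 0" using t by (rule mult_nonpos_nonneg)
  then have "h t \<le> h 0" using s by linarith
  then have "\<psi> z t * exp (- (A * t)) \<le> z"
    using psi_0[OF z] by (simp add: h_def)
  then show ?thesis by (simp add: A_def exp_minus field_simps)
qed

text \<open>For starting points in [0, B], \<open>B2\<close> bounds the flow up to time 1,
  \<open>M0\<close> bounds the modulus of \<open>R\<close> on [0, B2], and
  \<open>Lip B2 * M0\<close> is the constant of the second-order error. The maximum serves all three
  estimates below.\<close>

definition step_const :: "real \<Rightarrow> real" where
  "step_const B = (let B2 = B * exp (Lip 1); M0 = Lip B2 * B2 in max B2 (max M0 (Lip B2 * M0)))"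

text \<open>By the mean value theorem the increment is \<open>R (\<psi> z s) * t\<close> for some
  intermediate \<open>s\<close>. Replacing \<open>\<psi> z s\<close> by \<open>z\<close> costs a
  Lipschitz constant times an increment already known to be O(t), which gives the second-order bound
  for a merely Lipschitz \<open>R\<close>.\<close>

lemma
  assumes "0 \<le> B"
  shows step_const_nonneg: "0 \<le> step_const B"
    and psi_le: "\<And>z t. 0 \<le> z \<Longrightarrow> z \<le> B \<Longrightarrow> 0 \<le> t \<Longrightarrow> t \<le> 1 \<Longrightarrow> \<psi> z t \<le> step_const B"
    and psi_step1: "\<And>z t. 0 \<le> z \<Longrightarrow> z \<le> B \<Longrightarrow> 0 \<le> t \<Longrightarrow> t \<le> 1 \<Longrightarrow> \<bar>\<psi> z t - z\<bar> \<le> step_const B * t"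
    and psi_step2: "\<And>z t. 0 \<le> z \<Longrightarrow> z \<le> B \<Longrightarrow> 0 \<le> t \<Longrightarrow> t \<le> 1 \<Longrightarrow> \<bar>\<psi> z t - z - R z * t\<bar> \<le> step_const B * t * t"
proof -
  define A where "A = Lip 1"
  have A: "0 \<le> A" using Lip_nonneg by (simp add: A_def)
  define B2 where "B2 = B * exp A"
  have B2: "0 \<le> B2" using assms by (simp add: B2_def)
  have "B * 1 \<le> B * exp A" using assms A by (intro mult_left_mono) auto
  then have BB2: "B \<le> B2" by (simp add: B2_def)
  define K where "K = Lip B2"
  have K: "0 \<le> K" using Lip_nonneg[OF B2] by (simp add: K_def)
  have RK: "\<bar>R x - R y\<bar> \<le> K * \<bar>x - y\<bar>" if "0 \<le> x" "x \<le> B2" "0 \<le> y" "y \<le> B2" for x y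
    unfolding K_def using that by (rule R_lipschitz)
  define M0 where "M0 = K * B2"
  have M0: "0 \<le> M0" using K B2 by (simp add: M0_def)
  have Rb: "\<bar>R x\<bar> \<le> M0" if "0 \<le> x" "x \<le> B2" for x
    using RK[of x 0] that B2 mult_left_mono[of x B2 K] K by (auto simp: M0_def)
  have bd: "\<psi> z t \<le> B2" "0 \<le> \<psi> z t" if "0 \<le> z" "z \<le> B" "0 \<le> t" "t \<le> 1" for z t
  proof -
    have "\<psi> z t \<le> z * exp (A * t)" unfolding A_def using that by (intro psi_growth) auto
    also have "\<dots> \<le> B * exp A"
      using that A assms mult_left_mono[of t 1 A] by (intro mult_mono) auto
    finally show "\<psi> z t \<le> B2" by (simp add: B2_def)
    show "0 \<le> \<psi> z t" using that by (intro psi_nonneg)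
  qed
  have one: "\<bar>\<psi> z t - z\<bar> \<le> M0 * t" if "0 \<le> z" "z \<le> B" "0 \<le> t" "t \<le> 1" for z t
  proof -
    note h = that
    obtain s where s: "0 \<le> s" "s \<le> t" "\<psi> z t - z = R (\<psi> z s) * t"
      using psi_mvt[OF h(1,3)] .
    have "\<bar>R (\<psi> z s)\<bar> \<le> M0" using Rb bd[of z s] s that by auto
    then show ?thesis using s that by (simp add: abs_mult mult_right_mono)
  qed
  have two: "\<bar>\<psi> z t - z - R z * t\<bar> \<le> K * M0 * t * t" if "0 \<le> z" "z \<le> B" "0 \<le> t" "t \<le> 1" for z t
  proof -
    note h = that
    obtain s where s: "0 \<le> s" "s \<le> t" "\<psi> z t - z = R (\<psi> z s) * t"
      using psi_mvt[OF h(1,3)] .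
    have "\<bar>R (\<psi> z s) - R z\<bar> \<le> K * \<bar>\<psi> z s - z\<bar>"
      using bd[of z s] s that B2 BB2 by (intro RK) auto
    also have "\<dots> \<le> K * (M0 * s)" using one[of z s] s that K by (intro mult_left_mono) auto
    also have "\<dots> \<le> K * (M0 * t)" using s K M0 by (intro mult_left_mono) auto
    finally have "\<bar>R (\<psi> z s) - R z\<bar> * t \<le> K * (M0 * t) * t" using that by (intro mult_right_mono)
    moreover have "\<psi> z t - z - R z * t = (R (\<psi> z s) - R z) * t"
      using s by (simp add: algebra_simps)
    ultimately show ?thesis using that by (simp add: abs_mult mult_ac)
  qed
  have M: "step_const B = max B2 (max M0 (K * M0))"
    by (simp add: step_const_def Let_def A_def B2_def K_def M0_def)
  show "0 \<le> step_const B" using B2 by (simp add: M)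
  fix z t :: real assume h: "0 \<le> z" "z \<le> B" "0 \<le> t" "t \<le> 1"
  show "\<psi> z t \<le> step_const B" using bd(1)[OF h] by (simp add: M)
  have "M0 * t \<le> step_const B * t" using h by (intro mult_right_mono) (auto simp: M)
  then show "\<bar>\<psi> z t - z\<bar> \<le> step_const B * t" using one[OF h] by linarith
  have "K * M0 * t * t \<le> step_const B * t * t" using h by (intro mult_right_mono) (auto simp: M)
  then show "\<bar>\<psi> z t - z - R z * t\<bar> \<le> step_const B * t * t" using two[OF h] by linarith
qed

section \<open>Two discretisations of the flow with a constant source\<close>

definition psi_scheme :: "real \<Rightarrow> nat \<Rightarrow> real \<Rightarrow> nat \<Rightarrow> real" where
  "psi_scheme \<theta> n z i = ((\<lambda>x. \<psi> x (1 / n) + \<theta> / n) ^^ i) z"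

lemma psi_scheme_0 [simp]: "psi_scheme \<theta> n z 0 = z"
  and psi_scheme_Suc: "psi_scheme \<theta> n z (Suc i) = \<psi> (psi_scheme \<theta> n z i) (1 / n) + \<theta> / n"
  by (simp_all add: psi_scheme_def)

text \<open>The form in which the Markov property consumes the scheme: conditioning at the last grid
  point but one changes the starting point, and the remaining steps form a shorter scheme.\<close>

lemma psi_scheme_Suc_shift: "psi_scheme \<theta> n z (Suc i) = psi_scheme \<theta> n (\<psi> z (1 / n) + \<theta> / n) i"
  by (induction i) (simp_all add: psi_scheme_Suc)

lemma psi_scheme_nonneg: "0 \<le> \<theta> \<Longrightarrow> 0 \<le> z \<Longrightarrow> 0 \<le> psi_scheme \<theta> n z i"
  by (induction i) (auto simp: psi_scheme_Suc intro!: add_nonneg_nonneg psi_nonneg)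

text \<open>The arguments of the generating functions after \<open>j\<close> conditioning steps backwards in time;
  \<open>gf_scheme\<close> rescales them to the argument of \<open>Rfun\<close>.\<close>
definition gf_iter :: "real \<Rightarrow> nat \<Rightarrow> real \<Rightarrow> nat \<Rightarrow> real" where
  "gf_iter \<theta> n z j = ((\<lambda>s. gen (p n) s * exp (- \<theta> / (n * b n))) ^^ j) (exp (- z / b n))"

definition gf_scheme :: "real \<Rightarrow> nat \<Rightarrow> real \<Rightarrow> nat \<Rightarrow> real" where
  "gf_scheme \<theta> n z j = b n * (1 - gf_iter \<theta> n z j)"

lemma gf_iter_bounds:
  assumes "n \<ge> 1" "0 \<le> \<theta>" "0 \<le> z"
  shows "0 \<le> gf_iter \<theta> n z j" "gf_iter \<theta> n z j \<le> 1"
proof -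
  have "0 \<le> gf_iter \<theta> n z j \<and> gf_iter \<theta> n z j \<le> 1"
  proof (induction j)
    case 0
    then show ?case using assms b_pos[of n] by (simp add: gf_iter_def)
  next
    case (Suc j)
    have c: "exp (- \<theta> / (n * b n)) \<le> 1" using assms b_pos[of n] by simp
    have "gf_iter \<theta> n z (Suc j) = gen (p n) (gf_iter \<theta> n z j) * exp (- \<theta> / (n * b n))" by (simp add: gf_iter_def)
    then show ?case using Suc c gen_nonneg[of "gf_iter \<theta> n z j" "p n"] gen_le_1[of "gf_iter \<theta> n z j" "p n"]
      by (auto intro: mult_le_one)
  qed
  then show "0 \<le> gf_iter \<theta> n z j" "gf_iter \<theta> n z j \<le> 1" by auto
qed

lemma gf_scheme_bounds:
  assumes "n \<ge> 1" "0 \<le> \<theta>" "0 \<le> z"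
  shows "0 \<le> gf_scheme \<theta> n z j" "gf_scheme \<theta> n z j \<le> b n"
  using gf_iter_bounds[OF assms, of j] b_pos[OF assms(1)] mult_left_mono[of "1 - gf_iter \<theta> n z j" 1 "b n"]
  by (auto simp: gf_scheme_def)

lemma gf_iter_eq: "n \<ge> 1 \<Longrightarrow> gf_iter \<theta> n z j = 1 - gf_scheme \<theta> n z j / b n"
  using b_pos[of n] by (simp add: gf_scheme_def)

text \<open>Write 1 - ge = (1 - s) + (s - g) + g(1 - e), where s is the current argument, g the
  value of the generating function there and e the exponential weight. After multiplication by
  \<open>b n\<close> the middle term is an Euler increment of \<open>Rfun\<close>, and the last one
  is close to \<open>\<theta> / n\<close>.\<close>

lemma gf_scheme_Suc:
  assumes "n \<ge> 1"
  shows "gf_scheme \<theta> n z (Suc j) = gf_scheme \<theta> n z j + Rfun n (b n) (p n) (gf_scheme \<theta> n z j) / n +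
     gen (p n) (gf_iter \<theta> n z j) * (b n * (1 - exp (- (\<theta> / n) / b n)))"
proof -
  have "Rfun n (b n) (p n) (gf_scheme \<theta> n z j) = n * b n * (gf_iter \<theta> n z j - gen (p n) (gf_iter \<theta> n z j))"
    unfolding Rfun_def gf_iter_eq[OF assms, symmetric] ..
  then have "Rfun n (b n) (p n) (gf_scheme \<theta> n z j) / n = b n * (gf_iter \<theta> n z j - gen (p n) (gf_iter \<theta> n z j))"
    using assms by simp
  moreover have "gf_iter \<theta> n z (Suc j) = gen (p n) (gf_iter \<theta> n z j) * exp (- (\<theta> / n) / b n)"
    by (simp add: gf_iter_def)
  ultimately show ?thesis by (simp add: gf_scheme_def algebra_simps)
qed

text \<open>The bound is uniform in the grid and the same as in \<open>gf_scheme_le\<close>, so one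
  interval [0, B] carries all the constants used to compare the schemes.\<close>

lemma psi_scheme_le:
  assumes \<theta>: "0 \<le> \<theta>" and z: "0 \<le> z" and i: "i \<le> n"
  shows "psi_scheme \<theta> n z i \<le> exp (Lip 1) * (z + \<theta>)"
proof -
  have "psi_scheme \<theta> n z (Suc j) \<le> exp (Lip 1 / n) * psi_scheme \<theta> n z j + \<theta> / n" for j
    using psi_growth[OF psi_scheme_nonneg[OF \<theta> z], of "1 / n" n j] by (simp add: psi_scheme_Suc mult.commute)
  from discrete_gronwall[where e = "psi_scheme \<theta> n z", OF this Lip_nonneg \<theta> _ i]
  show ?thesis using z by simp
qed

lemma gf_scheme_le:
  assumes n: "n \<ge> 1" and bn: "1 \<le> b n" and \<theta>: "0 \<le> \<theta>" and z: "0 \<le> z" and i: "i \<le> n"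
  shows "gf_scheme \<theta> n z i \<le> exp (Lip 1) * (z + \<theta>)"
proof -
  have u0: "gf_scheme \<theta> n z 0 \<le> z"
    using scaled_exp_error(1)[of "b n" z] bn z by (simp add: gf_scheme_def gf_iter_def)
  have step: "gf_scheme \<theta> n z (Suc j) \<le> exp (Lip 1 / n) * gf_scheme \<theta> n z j + \<theta> / n" for j
  proof -
    let ?u = "gf_scheme \<theta> n z j"
    have ub: "0 \<le> ?u" "?u \<le> b n" using gf_scheme_bounds[OF n \<theta> z] by auto
    have sgb: "0 \<le> gf_iter \<theta> n z j" "gf_iter \<theta> n z j \<le> 1" using gf_iter_bounds[OF n \<theta> z] by auto
    have "gen (p n) (gf_iter \<theta> n z j) * (b n * (1 - exp (- (\<theta> / n) / b n))) \<le> 1 * (\<theta> / n)"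
      using scaled_exp_error(1)[of "b n" "\<theta> / n"] bn \<theta> gen_nonneg[OF sgb] gen_le_1[OF sgb]
      by (intro mult_mono) auto
    moreover have "Rfun n (b n) (p n) ?u / n \<le> Lip 1 * ?u / n"
      using Rfun_growth[OF n bn ub] by (simp add: divide_right_mono)
    moreover have "(1 + Lip 1 / n) * ?u \<le> exp (Lip 1 / n) * ?u"
      using ub by (intro mult_right_mono exp_ge_add_one_self) auto
    ultimately show ?thesis
      unfolding gf_scheme_Suc[OF n] by (simp add: algebra_simps)
  qed
  have "gf_scheme \<theta> n z i \<le> exp (Lip 1) * (gf_scheme \<theta> n z 0 + \<theta>)"
    by (rule discrete_gronwall[where e = "gf_scheme \<theta> n z", OF step Lip_nonneg \<theta> _ i])
       (use gf_scheme_bounds[OF n \<theta> z] in auto)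
  also have "\<dots> \<le> exp (Lip 1) * (z + \<theta>)" using u0 by simp
  finally show ?thesis .
qed

text \<open>The source \<theta>/n is reduced twice: by the factor g in front of it and by the
  curvature of the exponential. With U and Q the values of the scheme and of \<open>Rfun\<close>, 1
  - g = (U + Q/n) / b n, so both losses are of order 1/n times 1 / b n and vanish in the limit even
  when summed over \<open>n\<close> steps.\<close>

lemma gf_scheme_Suc_error:
  assumes n: "n \<ge> 1" and \<theta>: "0 \<le> \<theta>" and z: "0 \<le> z"
  shows "\<bar>gf_scheme \<theta> n z (Suc j) - gf_scheme \<theta> n z j - (Rfun n (b n) (p n) (gf_scheme \<theta> n z j) + \<theta>) / n\<bar> 
    \<le> \<theta> * (gf_scheme \<theta> n z j + \<bar>Rfun n (b n) (p n) (gf_scheme \<theta> n z j)\<bar> + \<theta>) / b n / n"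
proof -
  define g where "g = gen (p n) (gf_iter \<theta> n z j)"
  define c where "c = b n * (1 - exp (- (\<theta> / n) / b n))"
  define U where "U = gf_scheme \<theta> n z j"
  define Q where "Q = Rfun n (b n) (p n) U"
  have bn: "0 < b n" and n0: "0 < real n" and n1: "1 \<le> real n" using n b_pos by auto
  have g: "0 \<le> g" "g \<le> 1"
    using gen_nonneg gen_le_1 gf_iter_bounds[OF assms] by (auto simp: g_def)
  have c1: "c \<le> \<theta> / n" and c2: "\<bar>c - \<theta> / n\<bar> \<le> (\<theta> / n)\<^sup>2 / b n"
    using scaled_exp_error[of "b n" "\<theta> / n"] bn \<theta> n0 by (auto simp: c_def)
  have "Q = n * b n * (gf_iter \<theta> n z j - g)"
    unfolding Q_def U_def Rfun_def g_def gf_iter_eq[OF n, symmetric] ..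
  then have "1 - g = (U + Q / n) / b n"
    using bn n0 by (simp add: U_def gf_scheme_def field_simps)
  also have "\<dots> \<le> (U + \<bar>Q\<bar>) / b n"
  proof -
    have "Q / n \<le> \<bar>Q\<bar> / n" using n0 by (simp add: divide_right_mono)
    also have "\<dots> \<le> \<bar>Q\<bar>" using n1 by (simp add: divide_le_eq mult_le_cancel_left1)
    finally show ?thesis using bn by (simp add: divide_right_mono)
  qed
  finally have "(1 - g) * (\<theta> / n) \<le> (U + \<bar>Q\<bar>) / b n * (\<theta> / n)"
    using \<theta> by (intro mult_right_mono) auto
  moreover have "g * \<bar>c - \<theta> / n\<bar> \<le> \<theta> / b n * (\<theta> / n)"
  proof -
    have "g * \<bar>c - \<theta> / n\<bar> \<le> 1 * ((\<theta> / n)\<^sup>2 / b n)" using g c2 by (intro mult_mono) auto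
    also have "\<dots> = (\<theta> / n / b n) * (\<theta> / n)" by (simp add: power2_eq_square)
    also have "\<dots> \<le> \<theta> / b n * (\<theta> / n)"
      using \<theta> n1 bn by (intro mult_right_mono divide_right_mono) (auto simp: divide_le_eq mult_le_cancel_left1)
    finally show ?thesis .
  qed
  moreover have "gf_scheme \<theta> n z (Suc j) - U - (Q + \<theta>) / n = g * (c - \<theta> / n) - (1 - g) * (\<theta> / n)"
    unfolding gf_scheme_Suc[OF n] g_def[symmetric] c_def[symmetric] U_def[symmetric] Q_def[symmetric]
    by (simp add: algebra_simps add_divide_distrib diff_divide_distrib)
  moreover have "\<bar>g * (c - \<theta> / n)\<bar> = g * \<bar>c - \<theta> / n\<bar>" using g by (simp add: abs_mult)
  moreover have "0 \<le> (1 - g) * (\<theta> / n)" using g \<theta> by simp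
  \<comment> \<open>Triangle inequality for \<open>x = y - r\<close> with \<open>r \<ge> 0\<close>,
    stated for free variables so that the nonlinear terms above are matched as opaque atoms.\<close>
  moreover have "\<bar>x\<bar> \<le> c + d" if "r \<le> d" "r' \<le> c" "x = y - r" "\<bar>y\<bar> = r'" "0 \<le> r" for x y c d r r' :: real
    using that by linarith
  ultimately have "\<bar>gf_scheme \<theta> n z (Suc j) - U - (Q + \<theta>) / n\<bar> \<le> \<theta> / b n * (\<theta> / n) + (U + \<bar>Q\<bar>) / b n * (\<theta> / n)"
    by blast
  also have "\<dots> = \<theta> * (U + \<bar>Q\<bar> + \<theta>) / b n / n"
    using bn n0 by (simp add: field_simps)
  finally show ?thesis by (simp add: U_def Q_def)
qed

lemma gf_scheme_psi_scheme_close: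
  assumes \<theta>: "0 \<le> \<theta>" and z: "0 \<le> z" and e: "0 < e"
  shows "\<forall>\<^sub>F n in sequentially. \<forall>j\<le>n. \<bar>gf_scheme \<theta> n z j - psi_scheme \<theta> n z j\<bar> \<le> e"
proof -
  define B where "B = exp (Lip 1) * (z + \<theta>)"
  have B: "0 \<le> B" using \<theta> z by (simp add: B_def)
  define M where "M = step_const B"
  define K where "K = Lip B"
  have K: "0 \<le> K" using Lip_nonneg[OF B] by (simp add: K_def)
  \<comment> \<open>Gronwall multiplies four shares of \<open>\<delta>\<close> by
    \<open>exp K\<close>: the initial discrepancy and, per step, the defect of the source, the local
    error of the flow, and the distance between \<open>Rfun\<close> and \<open>R\<close>.\<close>
  define \<delta> where "\<delta> = e / (4 * exp K)"
  have \<delta>: "0 < \<delta>" "exp K * (\<delta> + 3 * \<delta>) = e" using e by (auto simp: \<delta>_def)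
  \<comment> \<open>Bounds the numerator in \<open>gf_scheme_Suc_error\<close> on [0, B]: as
    \<open>Rfun\<close> vanishes at 0, its modulus there is at most \<open>K * B\<close>.\<close>
  define C where "C = \<theta> * (B + K * B + \<theta>)"
  show ?thesis
    using eventually_ge_at_top[of 1] eventually_b_ge[of 1] Rfun_uniform[OF B \<delta>(1)]
      eventually_div_b_less[OF \<delta>(1), of C] eventually_div_n_less[OF \<delta>(1), of M]
      eventually_div_b_less[OF \<delta>(1), of "z\<^sup>2"]
  proof eventually_elim
    case (elim n)
    have n0: "0 < real n" using elim by simp
    have bn: "0 < b n" using elim by simp
    define d where "d = (\<lambda>j. \<bar>gf_scheme \<theta> n z j - psi_scheme \<theta> n z j\<bar>)"
    have d0: "d 0 \<le> \<delta>"
      using scaled_exp_error(2)[OF bn z] elim by (simp add: d_def gf_scheme_def gf_iter_def)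
    have step: "d (Suc j) \<le> exp (K / n) * d j + 3 * \<delta> / n" if j: "j < n" for j
    proof -
      define U W where "U = gf_scheme \<theta> n z j" and "W = psi_scheme \<theta> n z j"
      define Q where "Q = Rfun n (b n) (p n) U"
      have U: "0 \<le> U" "U \<le> B" "U \<le> b n" and W: "0 \<le> W" "W \<le> B"
        using gf_scheme_bounds[OF _ \<theta> z, of n j] psi_scheme_nonneg[OF \<theta> z, of n j] gf_scheme_le[OF _ _ \<theta> z, of n j] psi_scheme_le[OF \<theta> z, of j n] elim j
        by (auto simp: U_def W_def B_def)
      have "\<bar>Q\<bar> \<le> K * B"
        using Rfun_lipschitz[OF B, of n U 0] U elim B mult_left_mono[OF U(2) K] by (auto simp: Q_def K_def)
      then have "\<theta> * (U + \<bar>Q\<bar> + \<theta>) / b n \<le> C / b n"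
        unfolding C_def using U \<theta> bn by (intro divide_right_mono mult_left_mono) auto
      then have e1: "\<theta> * (U + \<bar>Q\<bar> + \<theta>) / b n / n \<le> \<delta> / n"
        using elim n0 by (intro divide_right_mono) auto
      have "\<bar>gf_scheme \<theta> n z (Suc j) - U - (Q + \<theta>) / n\<bar> \<le> \<delta> / n"
        using gf_scheme_Suc_error[OF _ \<theta> z, of n j] elim e1 by (auto simp: U_def Q_def)
      moreover have "\<bar>psi_scheme \<theta> n z (Suc j) - W - (R W + \<theta>) / n\<bar> \<le> \<delta> / n"
      proof -
        have "\<bar>\<psi> W (1 / n) - W - R W * (1 / n)\<bar> \<le> M * (1 / n) * (1 / n)"
          unfolding M_def using B W elim by (intro psi_step2) auto
        also have "\<dots> = M / n / n" by simp
        also have "\<dots> \<le> \<delta> / n" using elim n0 by (intro divide_right_mono) auto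
        finally show ?thesis
          by (simp add: psi_scheme_Suc W_def[symmetric] add_divide_distrib)
      qed
      moreover have "\<bar>Q / n - R W / n\<bar> \<le> \<delta> / n + K / n * \<bar>U - W\<bar>"
      proof -
        have "\<bar>Q - R U\<bar> < \<delta>" using elim U by (auto simp: Q_def)
        moreover have "\<bar>R U - R W\<bar> \<le> K * \<bar>U - W\<bar>" unfolding K_def using U W by (intro R_lipschitz) auto
        ultimately have "\<bar>Q - R W\<bar> \<le> \<delta> + K * \<bar>U - W\<bar>" by linarith
        then have "\<bar>Q - R W\<bar> / n \<le> (\<delta> + K * \<bar>U - W\<bar>) / n" using n0 by (intro divide_right_mono) auto
        moreover have "\<bar>Q / n - R W / n\<bar> = \<bar>Q - R W\<bar> / n" using n0 by (simp add: diff_divide_distrib[symmetric])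
        ultimately show ?thesis by (simp add: add_divide_distrib)
      qed
      ultimately have "d (Suc j) \<le> \<bar>U - W\<bar> + (K / n * \<bar>U - W\<bar> + 3 * \<delta> / n)"
        unfolding d_def add_divide_distrib by linarith
      also have "\<dots> = (1 + K / n) * \<bar>U - W\<bar> + 3 * \<delta> / n" by (simp add: algebra_simps)
      also have "\<dots> \<le> exp (K / n) * \<bar>U - W\<bar> + 3 * \<delta> / n"
        by (intro add_right_mono mult_right_mono exp_ge_add_one_self) auto
      finally show ?thesis by (simp add: d_def U_def W_def)
    qed
    show ?case
    proof (intro allI impI)
      fix j assume j: "j \<le> n"
      have "d j \<le> exp K * (d 0 + 3 * \<delta>)"
        by (rule discrete_gronwall[where e = d, OF step K _ _ j]) (use \<delta> in \<open>auto simp: d_def\<close>)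
      also have "\<dots> \<le> exp K * (\<delta> + 3 * \<delta>)" using d0 by (intro mult_left_mono) auto
      finally show "\<bar>gf_scheme \<theta> n z j - psi_scheme \<theta> n z j\<bar> \<le> e" using \<delta> by (simp add: d_def)
    qed
  qed
qed

end

section \<open>Comparison of the Laplace exponents\<close>

lemma one_minus_exp_error:
  fixes x y :: real and n :: nat
  assumes "0 \<le> y" "n \<ge> 1"
  shows "\<bar>1 - x / n - exp (- y / n)\<bar> \<le> (\<bar>x - y\<bar> + y\<^sup>2 / n) / n"
proof -
  have "\<bar>1 - exp (- (y / n)) - y / n\<bar> \<le> (y / n)\<^sup>2"
    using exp_minus_bounds[of "y / n"] assms by (auto simp: abs_le_iff)
  moreover have "\<bar>y / n - x / n\<bar> = \<bar>x - y\<bar> / n"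
    using assms by (simp add: diff_divide_distrib[symmetric] abs_minus_commute)
  ultimately have "\<bar>1 - x / n - exp (- (y / n))\<bar> \<le> \<bar>x - y\<bar> / n + (y / n)\<^sup>2" by linarith
  then show ?thesis using assms by (simp add: add_divide_distrib power2_eq_square)
qed

context scaling_limit
begin

text \<open>Meeting point of the two sides: the product of generating functions and the exact
  exponent \<open>Fint\<close> of the limit process are each compared with this Riemann sum.\<close>

definition Fsum :: "real \<Rightarrow> nat \<Rightarrow> real \<Rightarrow> real \<Rightarrow> real" where
  "Fsum \<theta> n z1 z2 = (\<Sum>i<n. F (psi_scheme \<theta> n z1 i + z2)) / n"

text \<open>All factors have modulus at most 1, so two products differ by at most the sum of the
  \<open>n\<close> differences of factors, and each of these is an arbitrarily small multiple of
  1/n.\<close>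

lemma prelimit_minus_Fsum:
  assumes \<theta>: "0 \<le> \<theta>" and z1: "0 \<le> z1" and z2: "0 \<le> z2"
  shows "(\<lambda>n. (\<Prod>j<n. gen (q n) (gf_iter \<theta> n z1 j * exp (- z2 / b n))) - exp (- Fsum \<theta> n z1 z2)) \<longlonglongrightarrow> 0"
proof (rule LIMSEQ_I)
  fix e0 :: real assume "0 < e0"
  define e where "e = e0 / 4"
  have e: "0 < e" using \<open>0 < e0\<close> by (simp add: e_def)
  define B where "B = exp (Lip 1) * (z1 + \<theta>)"
  have B: "0 \<le> B" using \<theta> z1 by (simp add: B_def)
  define C where "C = B + z2"
  have C: "0 \<le> C" using B z2 by (simp add: C_def)
  have "uniformly_continuous_on {0..C} F"
    by (intro compact_uniformly_continuous continuous_on_subset[OF B_cont]) auto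
  then obtain d where d: "0 < d" "\<And>x y. x \<in> {0..C} \<Longrightarrow> y \<in> {0..C} \<Longrightarrow> \<bar>x - y\<bar> < d \<Longrightarrow> \<bar>F x - F y\<bar> < e"
    unfolding uniformly_continuous_on_def dist_real_def using e by blast
  \<comment> \<open>Three discrepancies separate the argument \<open>\<mu> j\<close> of
    \<open>Ffun\<close> from \<open>psi_scheme \<theta> n z1 j + z2\<close>: that between the
    schemes, that between \<open>v\<close> and \<open>z2\<close>, and the factor
    \<open>gf_iter\<close> in front of \<open>v\<close>.\<close>
  have d3: "0 < d / 3" using d by simp
  have ev: "\<forall>\<^sub>F n in sequentially.
     \<bar>(\<Prod>j<n. gen (q n) (gf_iter \<theta> n z1 j * exp (- z2 / b n))) - exp (- Fsum \<theta> n z1 z2)\<bar> < e0"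
    using eventually_ge_at_top[of 1] eventually_b_ge[of 1] gf_scheme_psi_scheme_close[OF \<theta> z1 d3]
      eventually_div_b_less[OF d3, of "z2\<^sup>2"] eventually_div_b_less[OF d3, of "z2 * B"]
      Ffun_uniform[OF C e] eventually_div_n_less[OF e, of "(F C)\<^sup>2"]
  proof eventually_elim
    case (elim n)
    have n: "n \<ge> 1" and n0: "0 < real n" and bn: "0 < b n" using elim by auto
    define r where "r = exp (- z2 / b n)"
    define v where "v = b n * (1 - r)"
    have r: "0 \<le> r" "r \<le> 1" using z2 bn by (auto simp: r_def)
    have v: "0 \<le> v" "v \<le> z2"
      using scaled_exp_error(1)[OF bn z2] r bn by (auto simp: v_def r_def)
    have v3: "\<bar>v - z2\<bar> < d / 3"
      unfolding v_def r_def by (rule le_less_trans[OF scaled_exp_error(2)[OF bn z2]]) (use elim in blast)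
    \<comment> \<open>Chosen so that \<open>1 - \<mu> j / b n\<close> is the argument of the
      generating function, whose value is then expressed by \<open>Ffun\<close> at
      \<open>\<mu> j\<close>.\<close>
    define \<mu> where "\<mu> = (\<lambda>j. b n * (1 - gf_iter \<theta> n z1 j * r))"
    have approx: "\<bar>gen (q n) (gf_iter \<theta> n z1 j * r) - exp (- F (psi_scheme \<theta> n z1 j + z2) / n)\<bar> \<le> 3 * e / n"
      if j: "j < n" for j
    proof -
      let ?u = "gf_scheme \<theta> n z1 j" and ?w = "psi_scheme \<theta> n z1 j"
      have sgb: "0 \<le> gf_iter \<theta> n z1 j" "gf_iter \<theta> n z1 j \<le> 1" using gf_iter_bounds[OF n \<theta> z1] by auto
      have ub: "0 \<le> ?u" "?u \<le> B" using gf_scheme_bounds[OF n \<theta> z1] gf_scheme_le[OF n _ \<theta> z1] elim j by (auto simp: B_def)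
      have wb: "0 \<le> ?w" "?w \<le> B" using psi_scheme_nonneg[OF \<theta> z1] psi_scheme_le[OF \<theta> z1] j by (auto simp: B_def)
      have \<mu>: "\<mu> j = ?u + gf_iter \<theta> n z1 j * v"
        by (simp add: \<mu>_def gf_scheme_def v_def algebra_simps)
      have sv: "0 \<le> gf_iter \<theta> n z1 j * v" "gf_iter \<theta> n z1 j * v \<le> v"
        using sgb v by (auto simp: mult_left_le_one_le)
      have \<mu>C: "\<mu> j \<in> {0..C}" using \<mu> sv ub v by (auto simp: C_def)
      have "v - gf_iter \<theta> n z1 j * v = v * ?u / b n" using bn by (simp add: gf_scheme_def field_simps)
      also have "\<dots> \<le> z2 * B / b n"
        using v ub bn z2 by (intro divide_right_mono mult_mono) auto
      also have "\<dots> < d / 3" using elim by simp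
      finally have "\<bar>\<mu> j - (?u + v)\<bar> < d / 3" using \<mu> sv by auto
      moreover have "\<bar>?u - ?w\<bar> \<le> d / 3" using elim j by simp
      ultimately have "\<bar>\<mu> j - (?w + z2)\<bar> < d" using v3 by linarith
      then have "\<bar>F (\<mu> j) - F (?w + z2)\<bar> < e"
        using \<mu>C wb z2 by (intro d(2)) (auto simp: C_def)
      moreover have "\<bar>Ffun n (b n) (q n) (\<mu> j) - F (\<mu> j)\<bar> < e" using elim \<mu>C by blast
      ultimately have diff: "\<bar>Ffun n (b n) (q n) (\<mu> j) - F (?w + z2)\<bar> \<le> 2 * e" by linarith
      have Fw: "0 \<le> F (?w + z2)" "F (?w + z2) \<le> F C"
        using wb z2 by (auto intro!: F_nonneg F_mono simp: C_def)
      have sqe: "(F (?w + z2))\<^sup>2 / n \<le> e"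
        using Fw n0 elim divide_right_mono[of "(F (?w + z2))\<^sup>2" "(F C)\<^sup>2" n] by (auto intro: power_mono)
      have "1 - \<mu> j / b n = gf_iter \<theta> n z1 j * r" using bn by (simp add: \<mu>_def)
      then have "gen (q n) (gf_iter \<theta> n z1 j * r) = 1 - Ffun n (b n) (q n) (\<mu> j) / n"
        using n0 by (simp add: Ffun_def)
      then have "\<bar>gen (q n) (gf_iter \<theta> n z1 j * r) - exp (- F (?w + z2) / n)\<bar>
          \<le> (\<bar>Ffun n (b n) (q n) (\<mu> j) - F (?w + z2)\<bar> + (F (?w + z2))\<^sup>2 / n) / n"
        using one_minus_exp_error[OF Fw(1) n, of "Ffun n (b n) (q n) (\<mu> j)"] by simp
      also have "\<dots> \<le> (2 * e + e) / n"
        using diff sqe n0 by (intro divide_right_mono add_mono) auto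
      finally show ?thesis by simp
    qed
    have expS: "exp (- Fsum \<theta> n z1 z2) = (\<Prod>j<n. exp (- F (psi_scheme \<theta> n z1 j + z2) / n))"
      by (simp add: Fsum_def exp_sum[symmetric] sum_negf sum_divide_distrib)
    have "norm ((\<Prod>j<n. gen (q n) (gf_iter \<theta> n z1 j * r)) - (\<Prod>j<n. exp (- F (psi_scheme \<theta> n z1 j + z2) / n)))
        \<le> (\<Sum>j<n. norm (gen (q n) (gf_iter \<theta> n z1 j * r) - exp (- F (psi_scheme \<theta> n z1 j + z2) / n)))"
    proof (rule norm_prod_diff)
      fix j
      have "0 \<le> gf_iter \<theta> n z1 j * r" "gf_iter \<theta> n z1 j * r \<le> 1"
        using gf_iter_bounds[OF n \<theta> z1, of j] r by (auto intro: mult_le_one)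
      then show "norm (gen (q n) (gf_iter \<theta> n z1 j * r)) \<le> 1" using gen_nonneg gen_le_1 by simp
      have "0 \<le> F (psi_scheme \<theta> n z1 j + z2)" using psi_scheme_nonneg[OF \<theta> z1] z2 by (intro F_nonneg) auto
      then show "norm (exp (- F (psi_scheme \<theta> n z1 j + z2) / n)) \<le> 1" by simp
    qed
    also have "\<dots> \<le> (\<Sum>j<n. 3 * e / n)" using approx by (intro sum_mono) auto
    also have "\<dots> < e0" using n0 e by (simp add: e_def)
    finally show ?case by (simp add: expS r_def)
  qed
  then show "\<exists>no. \<forall>n\<ge>no. norm ((\<Prod>j<n. gen (q n) (gf_iter \<theta> n z1 j * exp (- z2 / b n))) - exp (- Fsum \<theta> n z1 z2) - 0) < e0"
    by (simp add: eventually_sequentially)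
qed

lemma psi_continuous: "0 \<le> z \<Longrightarrow> continuous_on {0..} (\<psi> z)"
  using psi_deriv[of z] by (auto simp: continuous_on_eq_continuous_within intro: DERIV_continuous)

text \<open>The exact exponent produced by \<open>n\<close> applications of the Markov property:
  from each scheme point the flow runs for time 1/n before the next addition of \<theta>/n.\<close>

definition Fint :: "real \<Rightarrow> nat \<Rightarrow> real \<Rightarrow> real \<Rightarrow> real" where
  "Fint \<theta> n z1 z2 = (\<Sum>i<n. integral {0..1 / n} (\<lambda>t. F (\<psi> (psi_scheme \<theta> n z1 i) t + z2)))"

text \<open>Within one cell the flow moves by O(1/n), uniformly over the bounded set of starting
  points, so by uniform continuity of \<open>F\<close> the integral over a cell is close to the cell
  length times the value at its left end.\<close>

lemma Fint_minus_Fsum: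
  assumes \<theta>: "0 \<le> \<theta>" and z1: "0 \<le> z1" and z2: "0 \<le> z2"
  shows "(\<lambda>n. exp (- Fint \<theta> n z1 z2) - exp (- Fsum \<theta> n z1 z2)) \<longlonglongrightarrow> 0"
proof (rule LIMSEQ_I)
  fix e0 :: real assume "0 < e0"
  define e where "e = e0 / 2"
  have e: "0 < e" using \<open>0 < e0\<close> by (simp add: e_def)
  define B where "B = exp (Lip 1) * (z1 + \<theta>)"
  have B: "0 \<le> B" using \<theta> z1 by (simp add: B_def)
  define M where "M = step_const B"
  \<comment> \<open>Covers the scheme points, bounded by \<open>B\<close>, as well as the flow
    between them, bounded by \<open>M\<close>.\<close>
  define C where "C = max M B + z2"
  have "uniformly_continuous_on {0..C} F"
    by (intro compact_uniformly_continuous continuous_on_subset[OF B_cont]) auto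
  then obtain d where d: "0 < d" "\<And>x y. x \<in> {0..C} \<Longrightarrow> y \<in> {0..C} \<Longrightarrow> \<bar>x - y\<bar> < d \<Longrightarrow> \<bar>F x - F y\<bar> < e"
    unfolding uniformly_continuous_on_def dist_real_def using e by blast
  have ev: "\<forall>\<^sub>F n in sequentially. \<bar>exp (- Fint \<theta> n z1 z2) - exp (- Fsum \<theta> n z1 z2)\<bar> < e0"
    using eventually_ge_at_top[of 1] eventually_div_n_less[OF d(1), of M]
  proof eventually_elim
    case (elim n)
    have n0: "0 < real n" using elim by auto
    have approx: "\<bar>integral {0..1 / n} (\<lambda>t. F (\<psi> W t + z2)) - F (W + z2) / n\<bar> \<le> e / n \<and>
        0 \<le> integral {0..1 / n} (\<lambda>t. F (\<psi> W t + z2))" if W: "0 \<le> W" "W \<le> B" for W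
    proof -
      have pos: "0 \<le> \<psi> W t + z2" if "0 \<le> t" for t
        using psi_nonneg[OF W(1) that] z2 by simp
      have cont: "continuous_on {0..1 / n} (\<lambda>t. F (\<psi> W t + z2))"
      proof -
        have "continuous_on {0..1 / n} (\<psi> W)"
          by (rule continuous_on_subset[OF psi_continuous[OF W(1)]]) auto
        then have "continuous_on {0..1 / n} (\<lambda>t. \<psi> W t + z2)" by (intro continuous_intros)
        then show ?thesis
          by (rule continuous_on_compose2[OF B_cont]) (auto intro: pos)
      qed
      have close: "\<bar>F (\<psi> W t + z2) - F (W + z2)\<bar> \<le> e" if t: "t \<in> {0..1 / n}" for t
      proof -
        have t1: "0 \<le> t" "t \<le> 1" using t elim order_trans[of t "1 / n" 1] by auto
        have "\<bar>\<psi> W t - W\<bar> \<le> M * t" unfolding M_def using B W t1 by (intro psi_step1) auto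
        also have "\<dots> \<le> M * (1 / n)"
          using t step_const_nonneg[OF B] by (intro mult_left_mono) (auto simp: M_def)
        also have "\<dots> < d" using elim by simp
        finally have "\<bar>(\<psi> W t + z2) - (W + z2)\<bar> < d" by simp
        moreover have "\<psi> W t \<le> M" unfolding M_def using B W t1 by (intro psi_le) auto
        ultimately show ?thesis
          using W z2 psi_nonneg[OF W(1) t1(1)] by (intro less_imp_le d(2)) (auto simp: C_def)
      qed
      have "norm (integral {0..1 / n} (\<lambda>t. F (\<psi> W t + z2) - F (W + z2))) \<le> e * (1 / n - 0)"
        by (rule integral_bound) (use n0 cont close in \<open>auto intro!: continuous_intros\<close>)
      moreover have "integral {0..1 / n} (\<lambda>t. F (\<psi> W t + z2) - F (W + z2)) =
          integral {0..1 / n} (\<lambda>t. F (\<psi> W t + z2)) - F (W + z2) / n"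
        using n0 by (subst Henstock_Kurzweil_Integration.integral_diff)
           (auto intro: integrable_continuous_interval[OF cont])
      moreover have "0 \<le> integral {0..1 / n} (\<lambda>t. F (\<psi> W t + z2))"
        by (intro Henstock_Kurzweil_Integration.integral_nonneg integrable_continuous_interval[OF cont])
          (auto intro!: F_nonneg pos)
      ultimately show ?thesis by simp
    qed
    have wb: "0 \<le> psi_scheme \<theta> n z1 i" "psi_scheme \<theta> n z1 i \<le> B" if "i < n" for i
      using psi_scheme_nonneg[OF \<theta> z1] psi_scheme_le[OF \<theta> z1] that by (auto simp: B_def)
    have "Fint \<theta> n z1 z2 - Fsum \<theta> n z1 z2 = (\<Sum>i<n. integral {0..1 / n} (\<lambda>t. F (\<psi> (psi_scheme \<theta> n z1 i) t + z2)) - F (psi_scheme \<theta> n z1 i + z2) / n)"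
      by (simp add: Fint_def Fsum_def sum_subtractf sum_divide_distrib)
    also have "\<bar>\<dots>\<bar> \<le> (\<Sum>i<n. e / n)"
      using approx wb by (intro order_trans[OF sum_abs] sum_mono) auto
    also have "\<dots> < e0" using n0 e by (simp add: e_def)
    finally have "\<bar>Fint \<theta> n z1 z2 - Fsum \<theta> n z1 z2\<bar> < e0" .
    moreover have "0 \<le> Fint \<theta> n z1 z2"
      unfolding Fint_def using approx wb by (intro sum_nonneg) auto
    moreover have "0 \<le> Fsum \<theta> n z1 z2"
      unfolding Fsum_def using psi_scheme_nonneg[OF \<theta> z1] z2 by (auto intro!: sum_nonneg divide_nonneg_nonneg F_nonneg)
    ultimately show ?case using abs_exp_minus_diff by (meson le_less_trans)
  qed
  then show "\<exists>no. \<forall>n\<ge>no. norm (exp (- Fint \<theta> n z1 z2) - exp (- Fsum \<theta> n z1 z2) - 0) < e0"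
    by (simp add: eventually_sequentially)
qed

text \<open>For large \<open>\<theta>\<close> the drift \<open>R + \<theta>\<close> lifts the scheme above the level \<open>C\<close> before time 1/2.\<close>
lemma Fsum_lower_bound:
  assumes C: "0 \<le> C"
  obtains \<theta> where "0 \<le> \<theta>" "\<forall>\<^sub>F n in sequentially. F C / 3 \<le> Fsum \<theta> n 0 0"
proof -
  \<comment> \<open>The margin of 1 above \<open>C\<close> separates the two cases below: up to
    \<open>C + 1\<close> the drift is at least \<open>- M1\<close>, and from above
    \<open>C + 1\<close> a flow step of size at most 1 cannot fall below \<open>C\<close>.\<close>
  define M1 where "M1 = Lip (C + 1) * (C + 1)"
  have C1: "0 \<le> C + 1" using C by simp
  have M1: "0 \<le> M1" using Lip_nonneg[OF C1] C by (simp add: M1_def)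
  have Rb: "- M1 \<le> R x" if "0 \<le> x" "x \<le> C + 1" for x
    using R_lipschitz[of x "C + 1" 0] that C mult_left_mono[OF that(2) Lip_nonneg[OF C1]]
    by (auto simp: M1_def)
  \<comment> \<open>\<open>M1\<close> offsets the most negative drift on [0, C + 1], 1 absorbs the
    local error of the flow step, and \<open>2 * C\<close> is the speed that reaches
    \<open>C\<close> at time 1/2.\<close>
  define \<theta> where "\<theta> = M1 + 1 + 2 * C"
  have \<theta>: "0 \<le> \<theta>" using M1 C by (simp add: \<theta>_def)
  define B where "B = exp (Lip 1) * (0 + \<theta>)"
  have B: "0 \<le> B" using \<theta> by (simp add: B_def)
  define M where "M = step_const B"
  have M: "0 \<le> M" using step_const_nonneg[OF B] by (simp add: M_def)
  have "\<forall>\<^sub>F n in sequentially. F C / 3 \<le> Fsum \<theta> n 0 0"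
    using eventually_ge_at_top[of 3] eventually_div_n_less[of 1 M, OF zero_less_one]
  proof eventually_elim
    case (elim n)
    have n0: "0 < real n" and n1: "1 \<le> real n" using elim by auto
    have ramp: "min C (2 * C * i / n) \<le> psi_scheme \<theta> n 0 i" if "i \<le> n" for i
      using that
    proof (induction i)
      case (Suc i)
      let ?w = "psi_scheme \<theta> n 0 i"
      have IH: "min C (2 * C * i / n) \<le> ?w" using Suc by simp
      have wb: "0 \<le> ?w" "?w \<le> B"
        using psi_scheme_nonneg[OF \<theta>, of 0 n i] psi_scheme_le[OF \<theta>, of 0 i n] Suc.prems by (auto simp: B_def)
      show ?case
      proof (cases "?w \<le> C + 1")
        case True
        have "\<bar>\<psi> ?w (1 / n) - ?w - R ?w * (1 / n)\<bar> \<le> M * (1 / n) * (1 / n)"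
          unfolding M_def using B wb n1 by (intro psi_step2) auto
        also have "\<dots> = (M / n) / n" by simp
        also have "\<dots> \<le> 1 / n" using elim n0 by (intro divide_right_mono) auto
        finally have "?w + R ?w / n - 1 / n \<le> \<psi> ?w (1 / n)" by (simp add: abs_le_iff)
        moreover have "- M1 / n \<le> R ?w / n" using Rb[of ?w] True wb n0 by (intro divide_right_mono) auto
        moreover have "\<theta> / n = M1 / n + 1 / n + 2 * C / n" by (simp add: \<theta>_def add_divide_distrib)
        ultimately have "?w + 2 * C / n \<le> psi_scheme \<theta> n 0 (Suc i)" by (simp add: psi_scheme_Suc)
        moreover have "min C (2 * C * Suc i / n) \<le> min C (2 * C * i / n) + 2 * C / n"
        proof -
          have "2 * C * Suc i / n = 2 * C * i / n + 2 * C / n"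
            by (simp add: add_divide_distrib algebra_simps)
          moreover have "0 \<le> 2 * C / n" using C n0 by simp
          ultimately show ?thesis by linarith
        qed
        ultimately show ?thesis using IH by linarith
      next
        case False
        have "\<bar>\<psi> ?w (1 / n) - ?w\<bar> \<le> M * (1 / n)"
          unfolding M_def using B wb n1 by (intro psi_step1) auto
        also have "\<dots> \<le> 1" using elim by simp
        finally have "C \<le> \<psi> ?w (1 / n)" using False by linarith
        moreover have "0 \<le> \<theta> / n" using \<theta> n0 by simp
        ultimately show ?thesis by (simp add: psi_scheme_Suc)
      qed
    qed (use C in simp)
    \<comment> \<open>Half of the steps, rounded up: from this index on the scheme is at least
      \<open>C\<close>. For \<open>n \<ge> 3\<close> at least a third of the indices remain, whence
      the factor 1/3.\<close>
    define h where "h = (n + 1) div 2"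
    have hn: "h \<le> n" "real n / 3 \<le> real (n - h)" "n \<le> 2 * h" using elim by (auto simp: h_def)
    have "F C / 3 * n \<le> (\<Sum>i\<in>{h..<n}. F C)"
      using hn F_nonneg[OF C] mult_right_mono[of "real n / 3" "real (n - h)" "F C"] by (simp add: mult.commute)
    also have "\<dots> \<le> (\<Sum>i\<in>{h..<n}. F (psi_scheme \<theta> n 0 i + 0))"
    proof (rule sum_mono)
      fix i assume i: "i \<in> {h..<n}"
      have "real n \<le> 2 * i" using i hn by simp
      then have "1 \<le> 2 * i / n" using n0 by simp
      then have "C * 1 \<le> C * (2 * i / n)" using C by (intro mult_left_mono) auto
      then have "C \<le> psi_scheme \<theta> n 0 i" using ramp[of i] i by (auto simp: min_def mult_ac split: if_splits)
      then show "F C \<le> F (psi_scheme \<theta> n 0 i + 0)" using C by (auto intro: F_mono)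
    qed
    also have "\<dots> \<le> (\<Sum>i<n. F (psi_scheme \<theta> n 0 i + 0))"
      by (rule sum_mono2) (auto intro!: F_nonneg psi_scheme_nonneg \<theta>)
    finally show ?case using n0 by (simp add: Fsum_def field_simps)
  qed
  with \<theta> show ?thesis by (rule that)
qed

end

subsection \<open>Riemann sums of cadlag functions\<close>

text \<open>One-sided limits bound \<open>f\<close> near each point, and compactness leaves finitely
  many of these bounds. Taking their sum avoids a maximum over a possibly empty set.\<close>

lemma cadlag_bounded:
  assumes "cadlag f"
  obtains C where "0 \<le> C" "\<And>t. 0 \<le> t \<Longrightarrow> t \<le> c \<Longrightarrow> \<bar>f t\<bar> \<le> C"
proof -
  have loc: "\<exists>d>0. \<exists>C. \<forall>s\<in>{0..c} \<inter> ball t d. \<bar>f s\<bar> \<le> C" if t: "t \<in> {0..c}" for t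
  proof -
    have "(f \<longlongrightarrow> f t) (at_right t)"
      using assms t by (auto simp: cadlag_def continuous_within)
    then have "\<forall>\<^sub>F s in at_right t. dist (f s) (f t) < 1" by (rule tendstoD) simp
    then obtain d1 where d1: "d1 > 0" "\<And>s. t < s \<Longrightarrow> dist s t < d1 \<Longrightarrow> dist (f s) (f t) < 1"
      unfolding eventually_at by auto
    obtain d2 C2 where d2: "d2 > 0" "\<And>s. 0 \<le> s \<Longrightarrow> s < t \<Longrightarrow> dist s t < d2 \<Longrightarrow> \<bar>f s\<bar> \<le> C2"
    proof (cases "t = 0")
      \<comment> \<open>No point of the interval lies to the left of 0, so any radius and any bound
        will do.\<close>
      case True
      then show ?thesis using that[of 1 0] by auto
    next
      case False
      then obtain l where "(f \<longlongrightarrow> l) (at_left t)"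
        using assms t unfolding cadlag_def by force
      then have "\<forall>\<^sub>F s in at_left t. dist (f s) l < 1" by (rule tendstoD) simp
      then obtain d2 where d2: "d2 > 0" "\<And>s. s < t \<Longrightarrow> dist s t < d2 \<Longrightarrow> dist (f s) l < 1"
        unfolding eventually_at by auto
      have "\<bar>f s\<bar> \<le> \<bar>l\<bar> + 1" if "s < t" "dist s t < d2" for s
        using d2(2)[OF that] by (simp add: dist_real_def)
      then show ?thesis using that[of d2 "\<bar>l\<bar> + 1"] d2(1) by blast
    qed
    have "\<bar>f s\<bar> \<le> max C2 (\<bar>f t\<bar> + 1)" if s: "s \<in> {0..c} \<inter> ball t (min d1 d2)" for s
    proof -
      have ds: "dist s t < d1" "dist s t < d2" using s by (auto simp: dist_commute)
      consider "s < t" | "s = t" | "t < s" by linarith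
      then show ?thesis
      proof cases
        case 1 then show ?thesis using d2(2)[of s] ds s by auto
      next
        case 3 then show ?thesis using d1(2)[of s] ds by (auto simp: dist_real_def)
      qed auto
    qed
    then show ?thesis
      using d1(1) d2(1) by (intro exI[of _ "min d1 d2"] conjI exI[of _ "max C2 (\<bar>f t\<bar> + 1)"]) auto
  qed
  obtain d where d: "\<And>t. t \<in> {0..c} \<Longrightarrow> d t > 0 \<and> (\<exists>C. \<forall>s\<in>{0..c} \<inter> ball t (d t). \<bar>f s\<bar> \<le> C)"
    using bchoice[of "{0..c}" "\<lambda>t d. d > 0 \<and> (\<exists>C. \<forall>s\<in>{0..c} \<inter> ball t d. \<bar>f s\<bar> \<le> C)"] loc by blast
  obtain C where C: "\<And>t. t \<in> {0..c} \<Longrightarrow> \<forall>s\<in>{0..c} \<inter> ball t (d t). \<bar>f s\<bar> \<le> C t"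
    using bchoice[of "{0..c}" "\<lambda>t C. \<forall>s\<in>{0..c} \<inter> ball t (d t). \<bar>f s\<bar> \<le> C"] d by blast
  obtain D where D: "D \<subseteq> {0..c}" "finite D" "{0..c} \<subseteq> (\<Union>t\<in>D. ball t (d t))"
    by (rule compactE_image[of "{0..c}" "{0..c}" "\<lambda>t. ball t (d t)"]) (use d in auto)
  show ?thesis
  proof (rule that[of "\<Sum>t\<in>D. \<bar>C t\<bar>"])
    show "0 \<le> (\<Sum>t\<in>D. \<bar>C t\<bar>)" by (simp add: sum_nonneg)
    fix s :: real assume s: "0 \<le> s" "s \<le> c"
    then obtain t where t: "t \<in> D" "s \<in> ball t (d t)" using D(3) by auto
    have "\<bar>f s\<bar> \<le> C t"
      by (rule bspec[OF C[OF subsetD[OF D(1) t(1)]]]) (use s t in simp)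
    then have "\<bar>f s\<bar> \<le> \<bar>C t\<bar>" by simp
    also have "\<dots> \<le> (\<Sum>t\<in>D. \<bar>C t\<bar>)" using t D(2) by (intro member_le_sum) auto
    finally show "\<bar>f s\<bar> \<le> (\<Sum>t\<in>D. \<bar>C t\<bar>)" .
  qed
qed

text \<open>Sampling from the right makes the step functions converge at every point.\<close>
lemma cadlag_integral_LIMSEQ:
  assumes f: "cadlag f"
  shows "f integrable_on {0..1}" "(\<lambda>n. (\<Sum>i<n. f (real i / n)) / n) \<longlonglongrightarrow> integral {0..1} f"
proof -
  \<comment> \<open>The right end of the cell of \<open>s\<close>. It is strictly larger than
    \<open>s\<close>, so it approaches \<open>s\<close> along \<open>at_right s\<close>.\<close>
  define r where "r = (\<lambda>(n::nat) (s::real). (of_int \<lfloor>n * s\<rfloor> + 1) / n)"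
  have r: "s < r n s" "r n s \<le> s + 1 / n" if "n \<ge> 1" for n s
    using that floor_correct[of "n * s"] by (auto simp: r_def field_simps)
  \<comment> \<open>The sample points may exceed 1 by up to 1/n, hence a bound on [0, 2].\<close>
  obtain C where C: "0 \<le> C" "\<And>t. 0 \<le> t \<Longrightarrow> t \<le> 2 \<Longrightarrow> \<bar>f t\<bar> \<le> C"
    using cadlag_bounded[OF f] by blast
  have step: "((\<lambda>s. f (r n s)) has_integral (\<Sum>i<k. f (Suc i / n) / n)) {0..k / n}" if n: "n \<ge> 1" for n k
  proof (induction k)
    case (Suc k)
    have "((\<lambda>s. f (Suc k / n)) has_integral (Suc k / n - k / n) *\<^sub>R f (Suc k / n)) {k / n..Suc k / n}"
      using has_integral_const_real[of "f (Suc k / n)" "k / n" "Suc k / n"] by (simp add: divide_right_mono)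
    then have "((\<lambda>s. f (r n s)) has_integral (Suc k / n - k / n) *\<^sub>R f (Suc k / n)) {k / n..Suc k / n}"
    proof (rule has_integral_spike_finite[where S = "{Suc k / n}", rotated 2])
      fix s assume s: "s \<in> {k / n..Suc k / n} - {Suc k / n}"
      then have "k \<le> n * s" "n * s < Suc k" using n by (auto simp: field_simps)
      then have "\<lfloor>n * s\<rfloor> = k" by (intro floor_unique) auto
      then show "f (r n s) = f (Suc k / n)" by (simp add: r_def add.commute)
    qed simp
    also have "(Suc k / n - k / n) *\<^sub>R f (Suc k / n) = f (Suc k / n) / n"
      using n by (simp add: diff_divide_distrib[symmetric])
    finally show ?case
      using has_integral_combine[OF _ _ Suc] n by (auto simp: divide_right_mono)
  qed (simp add: has_integral_refl)
  have int: "(\<lambda>s. f (r n s)) integrable_on {0..1}" for n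
  proof (cases "n = 0")
    case True
    then show ?thesis by (simp add: r_def integrable_const_ivl)
  next
    case False
    then show ?thesis using step[of n n] by auto
  qed
  have bdd: "norm (f (r n s)) \<le> C" if "s \<in> {0..1}" for n s
  proof (cases "n = 0")
    case True
    then show ?thesis using C(2)[of 0] by (simp add: r_def)
  next
    case False
    then have n: "n \<ge> 1" by simp
    then have "1 / real n \<le> 1" by simp
    then show ?thesis using r[OF n, of s] that C(2)[of "r n s"] by auto
  qed
  have lim: "(\<lambda>n. f (r n s)) \<longlonglongrightarrow> f s" if "s \<in> {0..1}" for s
  proof -
    have "(\<lambda>n. r n s) \<longlonglongrightarrow> s"
    proof (rule tendsto_sandwich)
      show "\<forall>\<^sub>F n in sequentially. s \<le> r n s" "\<forall>\<^sub>F n in sequentially. r n s \<le> s + 1 / n"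
        using eventually_ge_at_top[of 1] by (eventually_elim; use r in \<open>auto simp: less_imp_le\<close>)+
      show "(\<lambda>n. s + 1 / real n) \<longlonglongrightarrow> s"
        using tendsto_add[OF tendsto_const lim_const_over_n, of s 1] by simp
    qed simp
    moreover have "\<forall>\<^sub>F n in sequentially. r n s \<in> {s<..} \<and> r n s \<noteq> s"
      using eventually_ge_at_top[of 1] by eventually_elim (use r in \<open>simp add: less_imp_neq[symmetric]\<close>)
    ultimately have "filterlim (\<lambda>n. r n s) (at_right s) sequentially"
      unfolding filterlim_at by blast
    moreover have "(f \<longlongrightarrow> f s) (at_right s)"
      using f that by (auto simp: cadlag_def continuous_within)
    ultimately show ?thesis by (rule filterlim_compose[rotated])
  qed
  have dom: "f integrable_on {0..1}" "(\<lambda>n. integral {0..1} (\<lambda>s. f (r n s))) \<longlonglongrightarrow> integral {0..1} f"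
    using dominated_convergence[of "\<lambda>n s. f (r n s)" "{0..1}" "\<lambda>_. C" f] int bdd lim by auto
  then show "f integrable_on {0..1}" by simp
  \<comment> \<open>Right-end and left-end sums differ by one boundary term of order 1/n. The
    left-end form is the one that matches the populations at times \<open>k - 1\<close> in the
    denominator of the estimator.\<close>
  have "(\<lambda>n. integral {0..1} (\<lambda>s. f (r n s)) + (f 0 - f 1) / n) \<longlonglongrightarrow> integral {0..1} f + 0"
    by (intro tendsto_add dom lim_const_over_n)
  moreover have "\<forall>\<^sub>F n in sequentially.
      integral {0..1} (\<lambda>s. f (r n s)) + (f 0 - f 1) / n = (\<Sum>i<n. f (real i / n)) / n"
    using eventually_ge_at_top[of 1]
  proof eventually_elim
    case (elim n)
    have "integral {0..1} (\<lambda>s. f (r n s)) = (\<Sum>i<n. f (Suc i / n)) / n"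
      using integral_unique[OF step[OF elim, of n]] elim by (simp add: sum_divide_distrib)
    moreover have "(\<Sum>i<n. f (Suc i / n)) + f 0 = (\<Sum>i<n. f (real i / n)) + f (n / n)"
      using sum.lessThan_Suc_shift[of "\<lambda>i. f (real i / n)" n] by simp
    then have "(\<Sum>i<n. f (Suc i / n)) + (f 0 - f 1) = (\<Sum>i<n. f (real i / n))"
      using elim by simp
    ultimately show ?case by (simp add: add_divide_distrib[symmetric])
  qed
  ultimately show "(\<lambda>n. (\<Sum>i<n. f (real i / n)) / n) \<longlonglongrightarrow> integral {0..1} f"
    by (simp add: tendsto_cong)
qed

subsection \<open>Laplace functional of the limit process\<close>

locale limit_proc = scaling_limit p q b R F \<psi> + prob_space N
  for p q b R F \<psi> and N :: "'b measure" +
  fixes Y Y' :: "real \<Rightarrow> 'b \<Rightarrow> real"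
  assumes limit: "limit_process R F \<psi> N Y Y'"
begin

lemma Y_measurable [measurable]: "Y t \<in> borel_measurable N"
  and Y'_measurable [measurable]: "Y' t \<in> borel_measurable N"
  using limit unfolding limit_process_def by auto

lemma
  assumes "v \<in> space N"
  shows Y_0: "Y 0 v = 0" and Y'_0: "Y' 0 v = 0" and Y_cadlag: "cadlag (\<lambda>t. Y t v)"
    and Y_nonneg: "0 \<le> t \<Longrightarrow> 0 \<le> Y t v" and Y'_nonneg: "0 \<le> t \<Longrightarrow> 0 \<le> Y' t v"
  using limit assms unfolding limit_process_def by blast+

lemma markov:
  assumes "0 \<le> t" "0 \<le> s" "0 \<le> z1" "0 \<le> z2" "A \<in> natfilt N Y Y' t"
  shows "(\<integral>v. indicator A v * exp (- (z1 * Y (t + s) v + z2 * Y' (t + s) v)) \<partial>N) =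
        (\<integral>v. indicator A v * exp (- (Y t v * \<psi> z1 s + Y' t v * z2
               + integral {0..s} (\<lambda>u. F (\<psi> z1 u + z2)))) \<partial>N)"
  using limit assms unfolding limit_process_def by blast

text \<open>\<open>natfilt\<close> packaged as a measure, the form in which it can act as a
  subalgebra for conditional expectations.\<close>

definition filt :: "real \<Rightarrow> 'b measure" where
  "filt t = sigma (space N)
     (\<Union>u\<in>{0..t}. {(\<lambda>v. (Y u v, Y' u v)) -` B \<inter> space N | B. B \<in> sets (borel :: (real \<times> real) measure)})"

lemma space_filt [simp]: "space (filt t) = space N"
  unfolding filt_def by (rule space_measure_of) auto

lemma sets_filt: "sets (filt t) = natfilt N Y Y' t"
  unfolding filt_def natfilt_def by (rule sets_measure_of) auto

lemma subalgebra_filt: "subalgebra N (filt t)"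
  unfolding subalgebra_def sets_filt natfilt_def
proof (rule conjI[OF _ sets.sigma_sets_subset])
  have "(\<lambda>v. (Y u v, Y' u v)) -` B \<inter> space N \<in> sets N"
    if "B \<in> sets (borel :: (real \<times> real) measure)" for u B
    using that by (intro measurable_sets[OF borel_measurable_Pair]) auto
  then show "(\<Union>u\<in>{0..t}. {(\<lambda>v. (Y u v, Y' u v)) -` B \<inter> space N | B. B \<in> sets (borel :: (real \<times> real) measure)}) \<subseteq> sets N"
    by blast
qed simp

lemma filt_measurable:
  assumes "0 \<le> r" "r \<le> t"
  shows "Y r \<in> borel_measurable (filt t)" "Y' r \<in> borel_measurable (filt t)"
proof -
  have pair: "(\<lambda>v. (Y r v, Y' r v)) \<in> borel_measurable (filt t)"
  proof (rule measurableI)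
    fix B :: "(real \<times> real) set" assume "B \<in> sets borel"
    then show "(\<lambda>v. (Y r v, Y' r v)) -` B \<inter> space (filt t) \<in> sets (filt t)"
      unfolding sets_filt natfilt_def space_filt using assms by (intro sigma_sets.Basic UN_I[of r]) auto
  qed simp
  have "fst \<in> borel_measurable (borel :: (real \<times> real) measure)"
    "snd \<in> borel_measurable (borel :: (real \<times> real) measure)"
    by (auto intro!: borel_measurable_continuous_onI continuous_intros)
  from measurable_compose[OF pair this(1)] measurable_compose[OF pair this(2)]
  show "Y r \<in> borel_measurable (filt t)" "Y' r \<in> borel_measurable (filt t)" by simp_all
qed

text \<open>The identity \<open>markov\<close> tests against events of the past, hence identifies a
  conditional expectation given \<open>filt t\<close>. Pulling out what is known then admits any
  bounded weight measurable with respect to the past, such as the exponential of a partial Riemann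
  sum of \<open>Y\<close>.\<close>

lemma markov_weighted:
  assumes t: "0 \<le> t" and s: "0 \<le> s" and z1: "0 \<le> z1" and z2: "0 \<le> z2"
    and G: "G \<in> borel_measurable (filt t)" "\<And>v. v \<in> space N \<Longrightarrow> \<bar>G v\<bar> \<le> 1"
  shows "(\<integral>v. G v * exp (- (z1 * Y (t + s) v + z2 * Y' (t + s) v)) \<partial>N) =
        (\<integral>v. G v * exp (- (Y t v * \<psi> z1 s + Y' t v * z2
               + integral {0..s} (\<lambda>u. F (\<psi> z1 u + z2)))) \<partial>N)"
proof -
  interpret sub: finite_measure_subalgebra N "filt t"
    by unfold_locales (rule subalgebra_filt)
  define I where "I = integral {0..s} (\<lambda>u. F (\<psi> z1 u + z2))"
  define f1 where "f1 = (\<lambda>v. exp (- (z1 * Y (t + s) v + z2 * Y' (t + s) v)))"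
  define f2 where "f2 = (\<lambda>v. exp (- (Y t v * \<psi> z1 s + Y' t v * z2 + I)))"
  have [measurable]: "f1 \<in> borel_measurable N" "f2 \<in> borel_measurable N"
    unfolding f1_def f2_def by measurable
  have b1: "\<bar>f1 v\<bar> \<le> 1" if "v \<in> space N" for v
  proof -
    have "0 \<le> z1 * Y (t + s) v + z2 * Y' (t + s) v"
      using Y_nonneg[OF that, of "t + s"] Y'_nonneg[OF that, of "t + s"] t s z1 z2 by simp
    then show ?thesis unfolding f1_def abs_exp_cancel exp_le_one_iff by linarith
  qed
  have b2: "\<bar>f2 v\<bar> \<le> exp (- I)" if "v \<in> space N" for v
  proof -
    have "0 \<le> Y t v * \<psi> z1 s + Y' t v * z2"
      using Y_nonneg[OF that t] Y'_nonneg[OF that t] z2 psi_nonneg[OF z1 s] by simp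
    then show ?thesis unfolding f2_def abs_exp_cancel exp_le_cancel_iff by linarith
  qed
  have i1: "integrable N f1"
    by (rule integrable_const_bound[where B = 1]) (use b1 in auto)
  have i2: "integrable N f2"
    by (rule integrable_const_bound[where B = "exp (- I)"]) (use b2 in auto)
  have Gm [measurable]: "G \<in> borel_measurable N"
    by (rule measurable_from_subalg[OF subalgebra_filt G(1)])
  have iG: "integrable N (\<lambda>v. G v * f1 v)"
    by (rule integrable_const_bound[where B = 1])
       (use b1 G(2) in \<open>auto simp: abs_mult intro!: mult_le_one\<close>)
  have [measurable]: "Y t \<in> borel_measurable (filt t)" "Y' t \<in> borel_measurable (filt t)"
    using filt_measurable t by auto
  have "AE v in N. real_cond_exp N (filt t) f1 v = f2 v"
  proof (rule sub.real_cond_exp_charact[OF _ i1 i2])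
    show "f2 \<in> borel_measurable (filt t)" unfolding f2_def by measurable
    fix A assume "A \<in> sets (filt t)"
    then have "A \<in> natfilt N Y Y' t" by (simp add: sets_filt)
    from markov[OF t s z1 z2 this]
    show "(\<integral>v\<in>A. f1 v \<partial>N) = (\<integral>v\<in>A. f2 v \<partial>N)"
      by (simp add: set_lebesgue_integral_def f1_def f2_def I_def)
  qed
  then have "(\<integral>v. G v * real_cond_exp N (filt t) f1 v \<partial>N) = (\<integral>v. G v * f2 v \<partial>N)"
    by (intro integral_cong_AE) auto
  then show ?thesis
    using sub.real_cond_exp_intg(2)[OF iG G(1)] by (simp add: f1_def f2_def I_def)
qed

text \<open>The induction removes the last cell. The Markov property turns \<open>z\<close> at time
  (i+1)/n into \<open>\<psi> z (1 / n)\<close> at time i/n, and the summand at i/n adds \<theta>/n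
  to it: one step of \<open>psi_scheme\<close>. Hence \<open>z\<close> has to be arbitrary.\<close>

lemma laplace_grid:
  assumes \<theta>: "0 \<le> \<theta>" and z: "0 \<le> z" and z2: "0 \<le> z2"
  shows "(\<integral>v. exp (- (z * Y (i / n) v + z2 * Y' (i / n) v + \<theta> / n * (\<Sum>l<i. Y (real l / n) v))) \<partial>N) =
    exp (- (\<Sum>l<i. integral {0..1 / n} (\<lambda>t. F (\<psi> (psi_scheme \<theta> n z l) t + z2))))"
  using z
proof (induction i arbitrary: z)
  case 0
  have "(\<integral>v. exp (- (z * Y (real 0 / n) v + z2 * Y' (real 0 / n) v + \<theta> / n * (\<Sum>l<0. Y (real l / n) v))) \<partial>N)
      = (\<integral>v. 1 \<partial>N)"
    by (rule Bochner_Integration.integral_cong) (auto simp: Y_0 Y'_0)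
  then show ?case by (simp add: prob_space)
next
  case (Suc i)
  define G where "G = (\<lambda>v. exp (- (\<theta> / n * (\<Sum>l<Suc i. Y (real l / n) v))))"
  define I where "I = integral {0..1 / n} (\<lambda>t. F (\<psi> z t + z2))"
  define z' where "z' = \<psi> z (1 / n) + \<theta> / n"
  have t: "real (Suc i) / n = i / n + 1 / n" by (simp add: add_divide_distrib)
  have z': "0 \<le> z'" using psi_nonneg[OF Suc.prems] \<theta> by (simp add: z'_def)
  have G1: "G \<in> borel_measurable (filt (i / n))"
  proof -
    have "Y (real l / n) \<in> borel_measurable (filt (i / n))" if "l < Suc i" for l
      using that by (intro filt_measurable) (auto simp: divide_right_mono)
    then have "(\<lambda>v. \<Sum>l<Suc i. Y (real l / n) v) \<in> borel_measurable (filt (i / n))"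
      by (intro borel_measurable_sum) auto
    then show ?thesis unfolding G_def by measurable
  qed
  have G2: "\<bar>G v\<bar> \<le> 1" if "v \<in> space N" for v
  proof -
    have "0 \<le> \<theta> / n * (\<Sum>l<Suc i. Y (real l / n) v)"
      using \<theta> that by (intro mult_nonneg_nonneg divide_nonneg_nonneg sum_nonneg Y_nonneg) auto
    then show ?thesis unfolding G_def abs_exp_cancel exp_le_one_iff by linarith
  qed
  have "(\<integral>v. exp (- (z * Y (Suc i / n) v + z2 * Y' (Suc i / n) v + \<theta> / n * (\<Sum>l<Suc i. Y (real l / n) v))) \<partial>N)
      = (\<integral>v. G v * exp (- (z * Y (i / n + 1 / n) v + z2 * Y' (i / n + 1 / n) v)) \<partial>N)"
    unfolding t G_def by (simp add: exp_add[symmetric] algebra_simps del: sum.lessThan_Suc)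
  also have "\<dots> = (\<integral>v. G v * exp (- (Y (i / n) v * \<psi> z (1 / n) + Y' (i / n) v * z2 + I)) \<partial>N)"
    unfolding I_def using Suc.prems z2 G1 G2 by (intro markov_weighted) auto
  also have "\<dots> = (\<integral>v. exp (- I) * exp (- (z' * Y (i / n) v + z2 * Y' (i / n) v + \<theta> / n * (\<Sum>l<i. Y (real l / n) v))) \<partial>N)"
    by (rule Bochner_Integration.integral_cong)
       (simp_all add: G_def z'_def exp_add[symmetric] algebra_simps)
  also have "\<dots> = exp (- I) * exp (- (\<Sum>l<i. integral {0..1 / n} (\<lambda>t. F (\<psi> (psi_scheme \<theta> n z' l) t + z2))))"
    by (simp only: integral_mult_right_zero Suc.IH[OF z'])
  also have "\<dots> = exp (- (\<Sum>l<Suc i. integral {0..1 / n} (\<lambda>t. F (\<psi> (psi_scheme \<theta> n z l) t + z2))))"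
    unfolding sum.lessThan_Suc_shift
    by (simp add: I_def z'_def psi_scheme_Suc_shift exp_add[symmetric])
  finally show ?case .
qed

definition IY :: "'b \<Rightarrow> real" where
  "IY v = integral {0..1} (\<lambda>s. Y s v)"

lemma IY_LIMSEQ: "v \<in> space N \<Longrightarrow> (\<lambda>n. (\<Sum>i<n. Y (real i / n) v) / n) \<longlonglongrightarrow> IY v"
  unfolding IY_def by (rule cadlag_integral_LIMSEQ(2)[OF Y_cadlag])

lemma IY_measurable [measurable]: "IY \<in> borel_measurable N"
  by (rule borel_measurable_LIMSEQ_real[OF IY_LIMSEQ]) measurable

lemma IY_nonneg: "v \<in> space N \<Longrightarrow> 0 \<le> IY v"
  by (rule LIMSEQ_le_const[OF IY_LIMSEQ])
     (auto intro!: exI[of _ 0] divide_nonneg_nonneg sum_nonneg Y_nonneg)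

definition \<Lambda> :: "real \<Rightarrow> real \<Rightarrow> real \<Rightarrow> real" where
  "\<Lambda> \<theta> z1 z2 = (\<integral>v. exp (- (z1 * Y 1 v + z2 * Y' 1 v + \<theta> * IY v)) \<partial>N)"

text \<open>The probabilistic side supplies the limit: \<open>laplace_grid\<close> with
  \<open>i = n\<close> is exact on every grid, and the Riemann sums of \<open>Y\<close> converge
  path by path.\<close>

lemma Fsum_LIMSEQ:
  assumes \<theta>: "0 \<le> \<theta>" and z1: "0 \<le> z1" and z2: "0 \<le> z2"
  shows "(\<lambda>n. exp (- Fsum \<theta> n z1 z2)) \<longlonglongrightarrow> \<Lambda> \<theta> z1 z2"
proof -
  have "(\<lambda>n. \<integral>v. exp (- (z1 * Y 1 v + z2 * Y' 1 v + \<theta> * ((\<Sum>l<n. Y (real l / n) v) / n))) \<partial>N) \<longlonglongrightarrow> \<Lambda> \<theta> z1 z2"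
    unfolding \<Lambda>_def
  proof (rule integral_dominated_convergence[where w = "\<lambda>_. 1"])
    show "AE v in N. (\<lambda>n. exp (- (z1 * Y 1 v + z2 * Y' 1 v + \<theta> * ((\<Sum>l<n. Y (real l / n) v) / n))))
        \<longlonglongrightarrow> exp (- (z1 * Y 1 v + z2 * Y' 1 v + \<theta> * IY v))"
      by (rule AE_I2) (intro tendsto_intros IY_LIMSEQ)
    show "AE v in N. norm (exp (- (z1 * Y 1 v + z2 * Y' 1 v + \<theta> * ((\<Sum>l<n. Y (real l / n) v) / n)))) \<le> 1" for n
    proof (rule AE_I2)
      fix v assume "v \<in> space N"
      then have "0 \<le> z1 * Y 1 v + z2 * Y' 1 v + \<theta> * ((\<Sum>l<n. Y (real l / n) v) / n)"
        using assms
        by (intro add_nonneg_nonneg mult_nonneg_nonneg divide_nonneg_nonneg sum_nonneg Y_nonneg Y'_nonneg) auto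
      then show "norm (exp (- (z1 * Y 1 v + z2 * Y' 1 v + \<theta> * ((\<Sum>l<n. Y (real l / n) v) / n)))) \<le> 1"
        unfolding real_norm_def abs_exp_cancel exp_le_one_iff by linarith
    qed
  qed auto
  moreover have "\<forall>\<^sub>F n in sequentially.
     (\<integral>v. exp (- (z1 * Y 1 v + z2 * Y' 1 v + \<theta> * ((\<Sum>l<n. Y (real l / n) v) / n))) \<partial>N) = exp (- Fint \<theta> n z1 z2)"
    using eventually_ge_at_top[of 1]
  proof eventually_elim
    case (elim n)
    then show ?case using laplace_grid[OF \<theta> z1 z2, of n n] by (simp add: Fint_def)
  qed
  ultimately have "(\<lambda>n. exp (- Fint \<theta> n z1 z2)) \<longlonglongrightarrow> \<Lambda> \<theta> z1 z2"
    by (simp add: tendsto_cong)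
  from tendsto_diff[OF this Fint_minus_Fsum[OF assms]] show ?thesis by simp
qed

lemma prelimit_LIMSEQ:
  assumes \<theta>: "0 \<le> \<theta>" and z1: "0 \<le> z1" and z2: "0 \<le> z2"
  shows "(\<lambda>n. \<Prod>j<n. gen (q n) (gf_iter \<theta> n z1 j * exp (- z2 / b n))) \<longlonglongrightarrow> \<Lambda> \<theta> z1 z2"
  using tendsto_add[OF prelimit_minus_Fsum[OF assms] Fsum_LIMSEQ[OF assms]] by simp

text \<open>Where \<open>IY v = 0\<close> the weight \<open>exp (- (\<theta> * IY v))\<close> is 1,
  so this event has probability at most \<open>\<Lambda> \<theta> 0 0\<close> for every
  \<open>\<theta> \<ge> 0\<close>, and a suitable \<theta> makes that at most
  \<open>exp (- F C / 3)\<close>. A positive probability would therefore bound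
  \<open>F\<close>.\<close>

lemma AE_IY_pos:
  assumes unbdd: "\<not> bounded (F ` {0..})"
  shows "AE v in N. 0 < IY v"
proof -
  let ?E = "{v \<in> space N. IY v = 0}"
  have small: "prob ?E \<le> exp (- F C / 3)" if C: "0 \<le> C" for C
  proof -
    obtain \<theta> where \<theta>: "0 \<le> \<theta>" "\<forall>\<^sub>F n in sequentially. F C / 3 \<le> Fsum \<theta> n 0 0"
      using Fsum_lower_bound[OF C] .
    have "\<forall>\<^sub>F n in sequentially. exp (- Fsum \<theta> n 0 0) \<le> exp (- F C / 3)"
      using \<theta>(2) by eventually_elim simp
    then have up: "\<Lambda> \<theta> 0 0 \<le> exp (- F C / 3)"
      using Fsum_LIMSEQ[of \<theta> 0 0] \<theta>(1) by (intro tendsto_upperbound) auto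
    have "prob ?E = expectation (indicat_real ?E)" by simp
    also have "\<dots> \<le> expectation (\<lambda>v. exp (- (\<theta> * IY v)))"
    proof (rule integral_mono)
      show "integrable N (\<lambda>v. exp (- (\<theta> * IY v)))"
        by (rule integrable_const_bound[where B = 1]) (use \<theta>(1) IY_nonneg in auto)
      show "integrable N (indicat_real ?E)"
        by (rule integrable_const_bound[where B = 1]) (auto simp: indicator_def)
    qed (auto simp: indicator_def)
    also have "\<dots> = \<Lambda> \<theta> 0 0" by (simp add: \<Lambda>_def)
    finally show ?thesis using up by simp
  qed
  have "prob ?E = 0"
  proof (rule ccontr)
    assume "prob ?E \<noteq> 0"
    then have pos: "0 < prob ?E" by (simp add: order_less_le)
    have "bounded (F ` {0..})"
      unfolding bounded_iff
    proof (intro exI[of _ "- 3 * ln (prob ?E)"] ballI)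
      fix y assume "y \<in> F ` {0..}"
      then obtain C where C: "0 \<le> C" "y = F C" by auto
      have "ln (prob ?E) \<le> - F C / 3"
        using small[OF C(1)] pos by (simp add: ln_le_cancel_iff[symmetric] del: ln_le_cancel_iff)
      then show "norm y \<le> - 3 * ln (prob ?E)"
        using C F_nonneg[OF C(1)] by simp
    qed
    then show False using unbdd by simp
  qed
  then have "AE v in N. v \<notin> ?E"
    by (intro AE_not_in) (auto simp: null_sets_def emeasure_eq_measure)
  then show ?thesis
    by (rule AE_mp) (auto intro!: AE_I2 simp: order_less_le IY_nonneg)
qed

end

subsection \<open>Weak convergence\<close>

text \<open>At a zero of \<open>q\<close> the cutoff tends to 0 and \<open>h\<close> is bounded, so
  the product tends to 0, which is also its value there. At any other point \<open>q\<close> stays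
  positive nearby and \<open>h\<close> is continuous.\<close>

lemma continuous_on_cutoff:
  fixes h q :: "'a::metric_space \<Rightarrow> real"
  assumes q: "continuous_on K q" and h: "continuous_on {v \<in> K. 0 < q v} h"
    and q0: "\<And>v. v \<in> K \<Longrightarrow> 0 \<le> q v" and h1: "\<And>v. v \<in> K \<Longrightarrow> \<bar>h v\<bar> \<le> 1" and m: "0 \<le> m"
  shows "continuous_on K (\<lambda>v. h v * min 1 (m * q v))"
  unfolding continuous_on_iff
proof (intro ballI allI impI)
  fix v e :: _ assume v: "v \<in> K" and e: "0 < (e :: real)"
  let ?c = "\<lambda>v. min 1 (m * q v)"
  have c: "continuous_on K ?c" by (intro continuous_intros q)
  show "\<exists>d>0. \<forall>v'\<in>K. dist v' v < d \<longrightarrow> dist (h v' * ?c v') (h v * ?c v) < e"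
  proof (cases "0 < q v")
    case True
    have "continuous_on {v \<in> K. 0 < q v} (\<lambda>v. h v * ?c v)"
      by (intro continuous_on_mult h continuous_on_subset[OF c]) auto
    then obtain d1 where d1: "d1 > 0"
        "\<And>v'. v' \<in> K \<Longrightarrow> 0 < q v' \<Longrightarrow> dist v' v < d1 \<Longrightarrow> dist (h v' * ?c v') (h v * ?c v) < e"
      unfolding continuous_on_iff using v True e by blast
    obtain d2 where d2: "d2 > 0" "\<And>v'. v' \<in> K \<Longrightarrow> dist v' v < d2 \<Longrightarrow> dist (q v') (q v) < q v"
      using q v True unfolding continuous_on_iff by blast
    have "0 < q v'" if "v' \<in> K" "dist v' v < d2" for v'
      using d2(2)[OF that] by (simp add: dist_real_def)
    then show ?thesis using d1 d2(1) by (intro exI[of _ "min d1 d2"]) auto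
  next
    case False
    then have qv: "q v = 0" using q0[OF v] by simp
    obtain d where d: "d > 0" "\<And>v'. v' \<in> K \<Longrightarrow> dist v' v < d \<Longrightarrow> dist (?c v') (?c v) < e"
      using c v e unfolding continuous_on_iff by blast
    have "dist (h v' * ?c v') (h v * ?c v) < e" if "v' \<in> K" "dist v' v < d" for v'
    proof -
      have c0: "0 \<le> ?c v'" using q0[OF that(1)] m by simp
      have "\<bar>h v' * ?c v'\<bar> \<le> 1 * ?c v'"
        using h1[OF that(1)] c0 unfolding abs_mult by (intro mult_mono) auto
      also have "\<dots> < e" using d(2)[OF that] c0 by (simp add: qv dist_real_def)
      finally show ?thesis by (simp add: qv)
    qed
    then show ?thesis using d(1) by blast
  qed
qed

lemma (in prob_space) integral_cutoff_error:
  fixes f c :: "'a \<Rightarrow> real"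
  assumes [measurable]: "f \<in> borel_measurable M" "c \<in> borel_measurable M"
    and f: "\<And>v. v \<in> space M \<Longrightarrow> \<bar>f v\<bar> \<le> 1" and c: "\<And>v. v \<in> space M \<Longrightarrow> 0 \<le> c v" "\<And>v. v \<in> space M \<Longrightarrow> c v \<le> 1"
  shows "\<bar>(\<integral>v. f v \<partial>M) - (\<integral>v. f v * c v \<partial>M)\<bar> \<le> (\<integral>v. 1 - c v \<partial>M)"
proof -
  have i1: "integrable M f"
    by (rule integrable_const_bound[where B = 1]) (use f in auto)
  have i2: "integrable M (\<lambda>v. f v * c v)"
    by (rule integrable_const_bound[where B = 1])
       (use f c in \<open>auto simp: abs_mult intro!: mult_le_one\<close>)
  have i3: "integrable M (\<lambda>v. 1 - c v)"
    by (rule integrable_const_bound[where B = 1]) (use c in auto)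
  have "\<bar>(\<integral>v. f v \<partial>M) - (\<integral>v. f v * c v \<partial>M)\<bar> = \<bar>\<integral>v. f v - f v * c v \<partial>M\<bar>"
    using i1 i2 by simp
  also have "\<dots> \<le> (\<integral>v. \<bar>f v - f v * c v\<bar> \<partial>M)" by (rule integral_abs_bound)
  also have "\<dots> \<le> (\<integral>v. 1 - c v \<partial>M)"
  proof (rule integral_mono)
    show "integrable M (\<lambda>v. \<bar>f v - f v * c v\<bar>)"
      by (intro integrable_abs Bochner_Integration.integrable_diff i1 i2)
    fix v assume v: "v \<in> space M"
    have "f v - f v * c v = f v * (1 - c v)" by (simp add: algebra_simps)
    then show "\<bar>f v - f v * c v\<bar> \<le> 1 - c v"
      using f[OF v] c[OF v] mult_right_mono[of "\<bar>f v\<bar>" 1 "1 - c v"] by (simp add: abs_mult)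
  qed (rule i3)
  finally show ?thesis .
qed

text \<open>A version of the continuous mapping theorem: \<open>h\<close> may be discontinuous
  where \<open>q\<close> vanishes, an event of probability zero in the limit.\<close>
lemma integral_LIMSEQ_off_null_set:
  fixes M :: "nat \<Rightarrow> 'a measure" and N :: "'b measure"
    and V :: "nat \<Rightarrow> 'a \<Rightarrow> 'c::metric_space" and W :: "'b \<Rightarrow> 'c" and h q :: "'c \<Rightarrow> real"
  assumes M: "\<And>n. prob_space (M n)" and N: "prob_space N"
    and V [measurable]: "\<And>n. V n \<in> borel_measurable (M n)" and W [measurable]: "W \<in> borel_measurable N"
    and VK: "\<And>n v. v \<in> space (M n) \<Longrightarrow> V n v \<in> K" and WK: "\<And>v. v \<in> space N \<Longrightarrow> W v \<in> K"
    and conv: "\<And>\<phi> :: 'c \<Rightarrow> real. \<phi> \<in> borel_measurable borel \<Longrightarrow> continuous_on K \<phi> \<Longrightarrow>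
      (\<lambda>n. \<integral>v. \<phi> (V n v) \<partial>M n) \<longlonglongrightarrow> (\<integral>v. \<phi> (W v) \<partial>N)"
    and q [measurable]: "q \<in> borel_measurable borel" and qc: "continuous_on K q"
    and q0: "\<And>v. v \<in> K \<Longrightarrow> 0 \<le> q v"
    and h [measurable]: "h \<in> borel_measurable borel" and hc: "continuous_on {v \<in> K. 0 < q v} h"
    and h1: "\<And>v. \<bar>h v\<bar> \<le> 1"
    and AE: "AE v in N. 0 < q (W v)"
  shows "(\<lambda>n. \<integral>v. h (V n v) \<partial>M n) \<longlonglongrightarrow> (\<integral>v. h (W v) \<partial>N)"
proof (rule LIMSEQ_I)
  fix e :: real assume e: "0 < e"
  interpret N: prob_space N by (rule N)
  \<comment> \<open>On \<open>K\<close> these cutoffs increase to the indicator of positivity of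
    \<open>q\<close>, and \<open>1 - c m\<close> is itself a continuous test function. Its integral
    bounds the mass lost by cutting off, so smallness passes from the limit law to the prelimit
    laws.\<close>
  define c where "c = (\<lambda>(m::nat) v. min 1 (real m * q v))"
  have cm [measurable]: "c m \<in> borel_measurable borel" for m unfolding c_def by measurable
  have c01: "0 \<le> c m v" "c m v \<le> 1" if "v \<in> K" for m v using q0[OF that] by (auto simp: c_def)
  have "(\<lambda>m. \<integral>v. 1 - c m (W v) \<partial>N) \<longlonglongrightarrow> (\<integral>v. 0 \<partial>N)"
  proof (rule integral_dominated_convergence[where w = "\<lambda>_. 1"])
    show "AE v in N. (\<lambda>m. 1 - c m (W v)) \<longlonglongrightarrow> 0"
      using AE
    proof eventually_elim
      case (elim v)
      have "\<forall>\<^sub>F m in sequentially. 1 - c m (W v) = 0"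
        using eventually_ge_at_top[of "nat \<lceil>1 / q (W v)\<rceil>"]
      proof eventually_elim
        case (elim m)
        then have "1 / q (W v) \<le> m" by linarith
        then have "1 \<le> m * q (W v)" using \<open>0 < q (W v)\<close> by (simp add: divide_le_eq)
        then show ?case by (simp add: c_def)
      qed
      then show ?case by (rule tendsto_eventually)
    qed
    show "AE v in N. norm (1 - c m (W v)) \<le> 1" for m
      using c01[OF WK] by (intro AE_I2) (simp add: abs_le_iff)
  qed auto
  then have "\<forall>\<^sub>F m in sequentially. (\<integral>v. 1 - c m (W v) \<partial>N) < e / 4"
    using e by (intro order_tendstoD) auto
  then obtain m where m: "(\<integral>v. 1 - c m (W v) \<partial>N) < e / 4"
    by (auto simp: eventually_sequentially)
  have cc: "continuous_on K (c m)" unfolding c_def by (intro continuous_intros qc)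
  have hcc: "continuous_on K (\<lambda>v. h v * c m v)"
    unfolding c_def by (intro continuous_on_cutoff qc hc q0 h1) auto
  have splitN: "\<bar>(\<integral>v. h (W v) \<partial>N) - (\<integral>v. h (W v) * c m (W v) \<partial>N)\<bar> < e / 4"
    by (rule le_less_trans[OF N.integral_cutoff_error m]) (use h1 c01 WK in auto)
  have "\<forall>\<^sub>F n in sequentially. (\<integral>v. 1 - c m (V n v) \<partial>M n) < e / 4"
    by (rule order_tendstoD(2)[OF conv m]) (auto intro!: continuous_intros cc)
  moreover have "\<forall>\<^sub>F n in sequentially.
      dist (\<integral>v. h (V n v) * c m (V n v) \<partial>M n) (\<integral>v. h (W v) * c m (W v) \<partial>N) < e / 4"
    using e by (intro tendstoD conv[of "\<lambda>v. h v * c m v"] hcc) auto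
  ultimately have "\<forall>\<^sub>F n in sequentially. norm ((\<integral>v. h (V n v) \<partial>M n) - (\<integral>v. h (W v) \<partial>N)) < e"
  proof eventually_elim
    case (elim n)
    have "\<bar>(\<integral>v. h (V n v) \<partial>M n) - (\<integral>v. h (V n v) * c m (V n v) \<partial>M n)\<bar> \<le> (\<integral>v. 1 - c m (V n v) \<partial>M n)"
      by (rule prob_space.integral_cutoff_error[OF M]) (use h1 c01 VK in auto)
    then show ?case using elim splitN unfolding dist_real_def real_norm_def by linarith
  qed
  then show "\<exists>no. \<forall>n\<ge>no. norm ((\<integral>v. h (V n v) \<partial>M n) - (\<integral>v. h (W v) \<partial>N)) < e"
    by (simp add: eventually_sequentially)
qed

section \<open>From moments to continuous test functions\<close>

lemma bounded_linear_real3: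
  fixes f :: "real \<times> real \<times> real \<Rightarrow> real"
  assumes "bounded_linear f"
  shows "f (x, y, z) = f (1, 0, 0) * x + f (0, 1, 0) * y + f (0, 0, 1) * z"
proof -
  interpret bounded_linear f by (rule assms)
  have "(x, y, z) = x *\<^sub>R (1, 0, 0) + y *\<^sub>R (0, 1, 0) + z *\<^sub>R (0, 0, 1 :: real)" by simp
  then have "f (x, y, z) = f (x *\<^sub>R (1, 0, 0) + y *\<^sub>R (0, 1, 0) + z *\<^sub>R (0, 0, 1))" by simp
  then show ?thesis unfolding add scale by (simp add: mult.commute)
qed

lemma (in prob_space) integrable_continuous_on_compact:
  fixes g :: "'c::metric_space \<Rightarrow> real"
  assumes "compact K" "X \<in> borel_measurable M" "\<And>v. v \<in> space M \<Longrightarrow> X v \<in> K"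
    and "g \<in> borel_measurable borel" "continuous_on K g"
  shows "integrable M (\<lambda>v. g (X v))"
proof -
  have "bounded (g ` K)" by (intro compact_imp_bounded compact_continuous_image assms)
  then obtain B where "\<And>x. x \<in> K \<Longrightarrow> norm (g x) \<le> B" unfolding bounded_iff by blast
  then show ?thesis
    using assms by (intro integrable_const_bound[where B = B]) (auto intro: measurable_compose)
qed

lemma (in prob_space) integral_uniformly_close:
  fixes f g :: "'a \<Rightarrow> real"
  assumes "integrable M f" "integrable M g" "\<And>v. v \<in> space M \<Longrightarrow> \<bar>f v - g v\<bar> \<le> e"
  shows "\<bar>(\<integral>v. f v \<partial>M) - (\<integral>v. g v \<partial>M)\<bar> \<le> e"
proof -
  have "\<bar>(\<integral>v. f v \<partial>M) - (\<integral>v. g v \<partial>M)\<bar> = \<bar>\<integral>v. f v - g v \<partial>M\<bar>" using assms by simp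
  also have "\<dots> \<le> (\<integral>v. \<bar>f v - g v\<bar> \<partial>M)" by (rule integral_abs_bound)
  also have "\<dots> \<le> (\<integral>v. e \<partial>M)" using assms by (intro integral_mono) auto
  finally show ?thesis by (simp add: prob_space)
qed

text \<open>Since polynomials are built from linear functions by sums and products, the induction
  shows that multiplication by a polynomial preserves the set of good integrands, those whose product with every
  monomial has convergent integrals.\<close>
lemma moments_imp_integral_LIMSEQ:
  fixes M :: "nat \<Rightarrow> 'a measure" and N :: "'b measure"
    and V :: "nat \<Rightarrow> 'a \<Rightarrow> real \<times> real \<times> real" and W :: "'b \<Rightarrow> real \<times> real \<times> real"
  defines "K \<equiv> {0..1} \<times> {0..1} \<times> {0..1}"
  defines "mo \<equiv> (\<lambda>i j k v. fst v ^ i * fst (snd v) ^ j * snd (snd v) ^ k)"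
  assumes M: "\<And>n. prob_space (M n)" and N: "prob_space N"
    and V [measurable]: "\<And>n. V n \<in> borel_measurable (M n)" and W [measurable]: "W \<in> borel_measurable N"
    and VK: "\<And>n v. v \<in> space (M n) \<Longrightarrow> V n v \<in> K" and WK: "\<And>v. v \<in> space N \<Longrightarrow> W v \<in> K"
    and moments: "\<And>i j k. (\<lambda>n. \<integral>v. mo i j k (V n v) \<partial>M n) \<longlonglongrightarrow> (\<integral>v. mo i j k (W v) \<partial>N)"
    and \<phi>m [measurable]: "\<phi> \<in> borel_measurable borel" and \<phi>: "continuous_on K \<phi>"
  shows "(\<lambda>n. \<integral>v. \<phi> (V n v) \<partial>M n) \<longlonglongrightarrow> (\<integral>v. \<phi> (W v) \<partial>N :: real)"
proof -
  have K: "compact K" unfolding K_def by (intro compact_Times) auto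
  have mo_m [measurable]: "mo i j k \<in> borel_measurable borel" for i j k
    unfolding mo_def by (intro borel_measurable_continuous_onI continuous_intros)
  have mo_c: "continuous_on K (mo i j k)" for i j k
    unfolding mo_def by (intro continuous_intros)
  have int_V: "integrable (M n) (\<lambda>v. g (V n v))" and int_W: "integrable N (\<lambda>v. g (W v))"
    if "g \<in> borel_measurable borel" "continuous_on K g" for g :: "real \<times> real \<times> real \<Rightarrow> real" and n
    using that by (auto intro!: prob_space.integrable_continuous_on_compact[OF M K V VK]
      prob_space.integrable_continuous_on_compact[OF N K W WK])
  define good where "good = (\<lambda>g. g \<in> borel_measurable borel \<and> continuous_on K g \<and>
    (\<forall>i j k. (\<lambda>n. \<integral>v. mo i j k (V n v) * g (V n v) \<partial>M n) \<longlonglongrightarrow> (\<integral>v. mo i j k (W v) * g (W v) \<partial>N)))"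
  have good_add: "good (\<lambda>v. f v + g v)" if f: "good f" and g: "good g" for f g
    unfolding good_def
  proof (intro conjI allI)
    have fm [measurable]: "f \<in> borel_measurable borel" "g \<in> borel_measurable borel"
      and c: "continuous_on K f" "continuous_on K g" using f g by (auto simp: good_def)
    show "(\<lambda>v. f v + g v) \<in> borel_measurable borel" by measurable
    show "continuous_on K (\<lambda>v. f v + g v)" by (intro continuous_intros c)
    fix i j k
    have i: "integrable (M n) (\<lambda>v. mo i j k (V n v) * f (V n v))" "integrable (M n) (\<lambda>v. mo i j k (V n v) * g (V n v))"
      "integrable N (\<lambda>v. mo i j k (W v) * f (W v))" "integrable N (\<lambda>v. mo i j k (W v) * g (W v))" for n
      by (auto intro!: int_V[of "\<lambda>v. mo i j k v * f v"] int_V[of "\<lambda>v. mo i j k v * g v"]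
        int_W[of "\<lambda>v. mo i j k v * f v"] int_W[of "\<lambda>v. mo i j k v * g v"] continuous_on_mult mo_c c)
    have "(\<lambda>n. (\<integral>v. mo i j k (V n v) * f (V n v) \<partial>M n) + (\<integral>v. mo i j k (V n v) * g (V n v) \<partial>M n))
       \<longlonglongrightarrow> (\<integral>v. mo i j k (W v) * f (W v) \<partial>N) + (\<integral>v. mo i j k (W v) * g (W v) \<partial>N)"
      using f g by (intro tendsto_add) (auto simp: good_def)
    then show "(\<lambda>n. \<integral>v. mo i j k (V n v) * (f (V n v) + g (V n v)) \<partial>M n) \<longlonglongrightarrow> (\<integral>v. mo i j k (W v) * (f (W v) + g (W v)) \<partial>N)"
      by (simp only: distrib_left Bochner_Integration.integral_add i)
  qed
  have good_scale: "good (\<lambda>v. c * g v)" if g: "good g" for c g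
    unfolding good_def
  proof (intro conjI allI)
    have fm [measurable]: "g \<in> borel_measurable borel" and gc: "continuous_on K g" using g by (auto simp: good_def)
    show "(\<lambda>v. c * g v) \<in> borel_measurable borel" by measurable
    show "continuous_on K (\<lambda>v. c * g v)" by (intro continuous_intros gc)
    fix i j k
    have "(\<lambda>n. c * (\<integral>v. mo i j k (V n v) * g (V n v) \<partial>M n)) \<longlonglongrightarrow> c * (\<integral>v. mo i j k (W v) * g (W v) \<partial>N)"
      using g by (intro tendsto_mult_left) (auto simp: good_def)
    then show "(\<lambda>n. \<integral>v. mo i j k (V n v) * (c * g (V n v)) \<partial>M n) \<longlonglongrightarrow> (\<integral>v. mo i j k (W v) * (c * g (W v)) \<partial>N)"
      by (simp only: mult.left_commute[of _ c] integral_mult_right_zero)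
  qed
  have good_mo: "good (\<lambda>v. mo a b c v * g v)" if g: "good g" for a b c g
    unfolding good_def
  proof (intro conjI allI)
    have fm [measurable]: "g \<in> borel_measurable borel" and gc: "continuous_on K g" using g by (auto simp: good_def)
    show "(\<lambda>v. mo a b c v * g v) \<in> borel_measurable borel" by measurable
    show "continuous_on K (\<lambda>v. mo a b c v * g v)" by (intro continuous_on_mult mo_c gc)
    fix i j k
    have eq: "mo i j k v * (mo a b c v * y) = mo (i + a) (j + b) (k + c) v * y" for v y
      by (simp add: mo_def power_add mult_ac)
    show "(\<lambda>n. \<integral>v. mo i j k (V n v) * (mo a b c (V n v) * g (V n v)) \<partial>M n)
        \<longlonglongrightarrow> (\<integral>v. mo i j k (W v) * (mo a b c (W v) * g (W v)) \<partial>N)"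
      unfolding eq using g by (auto simp: good_def)
  qed
  have good_poly: "good (\<lambda>v. P v * g v)" if "real_polynomial_function P" "good g" for P g
    using that
  proof (induction P arbitrary: g rule: real_polynomial_function.induct)
    case (linear f)
    \<comment> \<open>A linear functional of a triple is a combination of the three coordinate
      monomials, which reduces this case to \<open>good_mo\<close>.\<close>
    have eq: "f v * y = f (1, 0, 0) * (mo 1 0 0 v * y) + (f (0, 1, 0) * (mo 0 1 0 v * y) + f (0, 0, 1) * (mo 0 0 1 v * y))" for v y
      using bounded_linear_real3[OF linear(1), of "fst v" "fst (snd v)" "snd (snd v)"]
      by (simp add: mo_def algebra_simps)
    have "good (\<lambda>v. f (1, 0, 0) * (mo 1 0 0 v * g v) + (f (0, 1, 0) * (mo 0 1 0 v * g v) + f (0, 0, 1) * (mo 0 0 1 v * g v)))"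
      by (intro good_add good_scale good_mo linear(2))
    then show ?case by (subst eq)
  next
    case (const c)
    then show ?case by (rule good_scale)
  next
    case (add f f')
    then show ?case by (simp add: distrib_right good_add)
  next
    case (mult f f')
    then show ?case by (simp add: mult.assoc)
  qed
  have "good (\<lambda>v. 1)" using moments by (simp add: good_def)
  show ?thesis
  proof (rule LIMSEQ_I)
    fix e :: real assume e: "0 < e"
    obtain P where P: "real_polynomial_function P" "\<And>v. v \<in> K \<Longrightarrow> \<bar>\<phi> v - P v\<bar> < e / 3"
      using Stone_Weierstrass_real_polynomial_function[OF K \<phi>, of "e / 3"] e by auto
    have gP: "good P" using good_poly[OF P(1) \<open>good (\<lambda>v. 1)\<close>] by simp
    then have Pm: "P \<in> borel_measurable borel" "continuous_on K P" by (auto simp: good_def)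
    have "(\<lambda>n. \<integral>v. P (V n v) \<partial>M n) \<longlonglongrightarrow> (\<integral>v. P (W v) \<partial>N)"
      using gP[unfolded good_def, THEN conjunct2, THEN conjunct2, rule_format, of 0 0 0] by (simp add: mo_def)
    then have "\<forall>\<^sub>F n in sequentially. dist (\<integral>v. P (V n v) \<partial>M n) (\<integral>v. P (W v) \<partial>N) < e / 3"
      using e by (intro tendstoD) auto
    then have "\<forall>\<^sub>F n in sequentially. norm ((\<integral>v. \<phi> (V n v) \<partial>M n) - (\<integral>v. \<phi> (W v) \<partial>N)) < e"
    proof eventually_elim
      case (elim n)
      have "\<bar>(\<integral>v. \<phi> (V n v) \<partial>M n) - (\<integral>v. P (V n v) \<partial>M n)\<bar> \<le> e / 3"
        using P(2)[OF VK] by (intro prob_space.integral_uniformly_close[OF M] int_V \<phi>m \<phi> Pm less_imp_le)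
      moreover have "\<bar>(\<integral>v. \<phi> (W v) \<partial>N) - (\<integral>v. P (W v) \<partial>N)\<bar> \<le> e / 3"
        using P(2)[OF WK] by (intro prob_space.integral_uniformly_close[OF N] int_W \<phi>m \<phi> Pm less_imp_le)
      ultimately show ?case using elim unfolding dist_real_def real_norm_def by linarith
    qed
    then show "\<exists>no. \<forall>n\<ge>no. norm ((\<integral>v. \<phi> (V n v) \<partial>M n) - (\<integral>v. \<phi> (W v) \<partial>N)) < e"
      by (simp add: eventually_sequentially)
  qed
qed

subsection \<open>The estimator\<close>

text \<open>Chain rule with inner slope -1/b. It converts the centring by the offspring mean into
  the derivative whose limit is assumed. The derivatives are one-sided, and they are unique because
  0 is an accumulation point of [0, b].\<close>

lemma Rfun_derivative_at_0:
  assumes b: "0 < b"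
    and R: "(Rfun n b p has_real_derivative D) (at 0 within {0..b})"
    and g: "(gen p has_real_derivative m) (at 1 within {0..1})"
  shows "D = n * (m - 1)"
proof -
  have img: "(\<lambda>x. 1 - x / b) ` {0..b} \<subseteq> {0..1}" using b by auto
  have l: "((\<lambda>x. 1 - x / b) has_real_derivative - (1 / b)) (at 0 within {0..b})"
    using b by (auto intro!: derivative_eq_intros)
  have "(gen p has_real_derivative m) (at (1 - 0 / b) within (\<lambda>x. 1 - x / b) ` {0..b})"
    using has_field_derivative_subset[OF g img] by simp
  from DERIV_image_chain[OF this l]
  have "((\<lambda>x. gen p (1 - x / b)) has_real_derivative m * - (1 / b)) (at 0 within {0..b})"
    by (simp add: o_def)
  with l have "((\<lambda>x. real n * b * ((1 - x / b) - gen p (1 - x / b))) has_real_derivative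
      real n * b * (- (1 / b) - m * - (1 / b))) (at 0 within {0..b})"
    by (intro DERIV_cmult DERIV_diff)
  moreover have "real n * b * (- (1 / b) - m * - (1 / b)) = n * (m - 1)"
    using b by (simp add: field_simps)
  ultimately have "(Rfun n b p has_real_derivative n * (m - 1)) (at 0 within {0..b})"
    unfolding Rfun_def[abs_def] by (simp only:)
  moreover have "at 0 within {0..b} \<noteq> bot"
    using b by (simp add: at_within_Icc_at_right)
  ultimately show ?thesis
    using R unfolding has_field_derivative_iff by (metis tendsto_unique)
qed

lemma sum_bpi: "(\<Sum>k=1..n. real (bpi xi eta k v)) = (\<Sum>k=1..n. real (bpi xi eta (k - 1) v)) + real (bpi xi eta n v)"
  by (induction n) simp_all

text \<open>As the population starts at 0, an index shift makes the numerator of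
  \<open>mcheck\<close> equal to its denominator plus the final population minus the total
  immigration. The quotient thus contributes a 1, which joins \<open>m\<close> in
  \<open>n * (m - 1)\<close>, the derivative of \<open>Rfun\<close> at 0.\<close>

lemma mcheck_eq:
  assumes "(\<Sum>k=1..n. real (bpi xi eta (k - 1) v)) \<noteq> 0"
  shows "real n * (mcheck xi eta n v - m) =
    n * (real (bpi xi eta n v) - (\<Sum>k=1..n. real (eta k v))) / (\<Sum>k=1..n. real (bpi xi eta (k - 1) v)) - n * (m - 1)"
  using assms by (simp add: mcheck_def sum_subtractf sum_bpi del: One_nat_def) (simp add: field_simps)

lemma bpi_mgf_exp:
  "bpi_mgf xi eta n (exp (- x)) (exp (- y)) (exp (- z)) v =
    exp (- (x * bpi xi eta n v + y * (\<Sum>k=1..n. real (eta k v)) + z * (\<Sum>k=1..n. real (bpi xi eta (k - 1) v))))"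
proof -
  have p: "exp (- t) ^ k = exp (- (t * k))" for t :: real and k :: nat
    by (simp add: exp_of_nat_mult[symmetric] mult.commute)
  have "(\<Prod>k=1..n. exp (- (y * eta k v)) * exp (- (z * bpi xi eta (k - 1) v))) =
      exp (\<Sum>k=1..n. - (y * eta k v) - z * bpi xi eta (k - 1) v)"
    by (simp add: exp_sum exp_add[symmetric])
  then show ?thesis
    unfolding bpi_mgf_def p
    by (simp add: exp_add[symmetric] sum_subtractf sum_negf sum_distrib_left del: One_nat_def)
qed

theorem theorem3p1:
  fixes M :: "nat \<Rightarrow> 'a measure"
    and p q :: "nat \<Rightarrow> nat pmf"
    and \<xi> :: "nat \<Rightarrow> nat \<Rightarrow> nat \<Rightarrow> 'a \<Rightarrow> nat"
    and \<eta> :: "nat \<Rightarrow> nat \<Rightarrow> 'a \<Rightarrow> nat"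
    and b :: "nat \<Rightarrow> real"
    and R F :: "real \<Rightarrow> real"
    and Rd m :: "nat \<Rightarrow> real"
    and a :: real
    and \<psi> :: "real \<Rightarrow> real \<Rightarrow> real"
    and N :: "'b measure"
    and Y Y' :: "real \<Rightarrow> 'b \<Rightarrow> real"
  assumes prob: "\<And>n. n \<ge> 1 \<Longrightarrow> prob_space (M n)"
    and indep: "\<And>n. n \<ge> 1 \<Longrightarrow> prob_space.indep_vars (M n) (\<lambda>_. count_space UNIV)
          (\<lambda>i. case i of Inl (k, j) \<Rightarrow> \<xi> n k j | Inr k \<Rightarrow> \<eta> n k)
          ({(k, j). k \<ge> 1 \<and> j \<ge> 1} <+> {k. k \<ge> 1})"
    and xi_law: "\<And>n k j. n \<ge> 1 \<Longrightarrow> k \<ge> 1 \<Longrightarrow> j \<ge> 1 \<Longrightarrow>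
          distr (M n) (count_space UNIV) (\<xi> n k j) = measure_pmf (p n)"
    and eta_law: "\<And>n k. n \<ge> 1 \<Longrightarrow> k \<ge> 1 \<Longrightarrow>
          distr (M n) (count_space UNIV) (\<eta> n k) = measure_pmf (q n)"
    and b_pos: "\<And>n. n \<ge> 1 \<Longrightarrow> b n > 0"
    and b_lim: "filterlim b at_top sequentially"
    and A_lip: "\<And>c. c \<ge> 0 \<Longrightarrow> \<exists>K. \<forall>n \<ge> 1. \<forall>x y. 0 \<le> x \<longrightarrow> x \<le> c \<longrightarrow> x \<le> b n \<longrightarrow>
          0 \<le> y \<longrightarrow> y \<le> c \<longrightarrow> y \<le> b n \<longrightarrow>
          \<bar>Rfun n (b n) (p n) x - Rfun n (b n) (p n) y\<bar> \<le> K * \<bar>x - y\<bar>"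
    and A_lim: "\<And>x. x \<ge> 0 \<Longrightarrow> (\<lambda>n. Rfun n (b n) (p n) x) \<longlonglongrightarrow> R x"
    and A_cont: "continuous_on {0..} R"
    and B_lim: "\<And>x. x \<ge> 0 \<Longrightarrow> (\<lambda>n. Ffun n (b n) (q n) x) \<longlonglongrightarrow> F x"
    and B_cont: "continuous_on {0..} F"
    and F_unbdd: "\<not> bounded (F ` {0..})"
    and Rd_def: "\<forall>\<^sub>F n in sequentially.
          (Rfun n (b n) (p n) has_real_derivative Rd n) (at 0 within {0..b n})"
    and Rd_lim: "Rd \<longlonglongrightarrow> a"
    and m_def: "\<forall>\<^sub>F n in sequentially. (gen (p n) has_real_derivative m n) (at 1 within {0..1})"
    and psi: "psi_sol R \<psi>"
    and lim: "limit_process R F \<psi> N Y Y'"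
  shows "weak_conv_m
           (\<lambda>n. distr (M n) borel (\<lambda>w. real n * (mcheck (\<xi> n) (\<eta> n) n w - m n)))
           (distr N borel (\<lambda>w. (Y 1 w - a * integral {0..1} (\<lambda>s. Y s w) - Y' 1 w)
                                 / integral {0..1} (\<lambda>t. Y t w)))"
proof -
  interpret N: prob_space N using lim by (simp add: limit_process_def)
  interpret P: limit_proc p q b R F \<psi> N Y Y'
    by unfold_locales (use b_pos b_lim A_lip A_lim B_lim B_cont psi lim in auto)
  have branching: "branching (M n) (\<xi> n) (\<eta> n) (p n) (q n)" if "n \<ge> 1" for n
    using prob[OF that] indep[OF that] xi_law[OF that] eta_law[OF that]
    by (simp add: branching_def branching_axioms_def)
  define A where "A = (\<lambda>n v. real (bpi (\<xi> n) (\<eta> n) n v) / b n)"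
  define B where "B = (\<lambda>n v. (\<Sum>k=1..n. real (\<eta> n k v)) / b n)"
  define C where "C = (\<lambda>n v. (\<Sum>k=1..n. real (bpi (\<xi> n) (\<eta> n) (k - 1) v)) / (n * b n))"
  define G where "G = (\<lambda>n v. real n * (mcheck (\<xi> n) (\<eta> n) n v - m n))"
  have [measurable]: "A n \<in> borel_measurable (M n)" "B n \<in> borel_measurable (M n)"
    "C n \<in> borel_measurable (M n)" "G n \<in> borel_measurable (M n)" if n: "n \<ge> 1" for n
  proof -
    interpret br: branching "M n" "\<xi> n" "\<eta> n" "p n" "q n" by (rule branching[OF n])
    have [measurable]: "(\<lambda>v. real (bpi (\<xi> n) (\<eta> n) k v)) \<in> borel_measurable (M n)" for k
      by (rule measurable_compose[OF br.bpi_rv]) simp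
    have e [measurable]: "(\<lambda>v. real (\<eta> n k v)) \<in> borel_measurable (M n)" if "k \<in> {1..n}" for k
      by (rule measurable_compose[OF br.eta_measurable]) (use that in simp_all)
    show "A n \<in> borel_measurable (M n)" "C n \<in> borel_measurable (M n)"
      unfolding A_def C_def by measurable
    show "B n \<in> borel_measurable (M n)" "G n \<in> borel_measurable (M n)"
      unfolding B_def G_def mcheck_def
      by (intro borel_measurable_sum borel_measurable_divide borel_measurable_diff borel_measurable_times
          borel_measurable_const e; measurable)+
  qed
  have nonneg: "0 \<le> A n v" "0 \<le> B n v" "0 \<le> C n v" if "n \<ge> 1" for n v
    using b_pos[OF that] by (auto simp: A_def B_def C_def intro!: divide_nonneg_nonneg sum_nonneg)
  define V where "V = (\<lambda>n v. (exp (- A n v), exp (- B n v), exp (- C n v)))"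
  define W where "W = (\<lambda>v. (exp (- Y 1 v), exp (- Y' 1 v), exp (- P.IY v)))"
  define K where "K = {0..1 :: real} \<times> {0..1 :: real} \<times> {0..1 :: real}"
  \<comment> \<open>In the coordinates of \<open>V\<close> the logarithms give back -A, -B and -C,
    so \<open>T\<close> is (A - B)/C - a.\<close>
  define T where "T = (\<lambda>v :: real \<times> real \<times> real. (ln (fst (snd v)) - ln (fst v)) / (- ln (snd (snd v))) - a)"
  \<comment> \<open>On the cube, \<open>Q\<close> is positive when no coordinate is 0 and the last
    is below 1, that is, for finite A, B, C with C > 0; there \<open>T\<close> is continuous. At a
    value of \<open>V\<close> it vanishes only if C = 0.\<close>
  define Q where "Q = (\<lambda>v :: real \<times> real \<times> real. fst v * fst (snd v) * snd (snd v) * (1 - snd (snd v)))"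
  \<comment> \<open>The hypotheses start at \<open>n = 1\<close>, while the convergence lemmas
    quantify over all indices; hence the shift to \<open>Suc n\<close>, undone at the end.\<close>
  have probS: "prob_space (M (Suc n))" for n by (rule prob) simp
  have VS [measurable]: "V (Suc n) \<in> borel_measurable (M (Suc n))" for n
    unfolding V_def by measurable
  have WS [measurable]: "W \<in> borel_measurable N"
    unfolding W_def by measurable
  have VK: "V (Suc n) v \<in> K" for n v
    using nonneg[of "Suc n" v] by (simp add: V_def K_def)
  have WK: "W v \<in> K" if "v \<in> space N" for v
    using P.Y_nonneg[OF that] P.Y'_nonneg[OF that] P.IY_nonneg[OF that] by (simp add: W_def K_def)
  have moments: "(\<lambda>n. \<integral>v. fst (V (Suc n) v) ^ i * fst (snd (V (Suc n) v)) ^ j * snd (snd (V (Suc n) v)) ^ k \<partial>M (Suc n))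
      \<longlonglongrightarrow> (\<integral>v. fst (W v) ^ i * fst (snd (W v)) ^ j * snd (snd (W v)) ^ k \<partial>N)" for i j k
  proof -
    have pw: "exp (- t) ^ l = exp (- (l * t))" for t :: real and l :: nat
      by (simp add: exp_of_nat_mult[symmetric])
    \<comment> \<open>The exponents \<open>i\<close>, \<open>j\<close>, \<open>k\<close> act as the
      Laplace arguments \<open>z1\<close>, \<open>z2\<close>, \<theta> of the backward
      product.\<close>
    have eq: "(\<integral>v. fst (V n v) ^ i * fst (snd (V n v)) ^ j * snd (snd (V n v)) ^ k \<partial>M n) =
        (\<Prod>l<n. gen (q n) (P.gf_iter k n i l * exp (- real j / b n)))" if n: "n \<ge> 1" for n
    proof -
      interpret br: branching "M n" "\<xi> n" "\<eta> n" "p n" "q n" by (rule branching[OF n])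
      have "fst (V n v) ^ i * fst (snd (V n v)) ^ j * snd (snd (V n v)) ^ k =
          bpi_mgf (\<xi> n) (\<eta> n) n (exp (- (i / b n))) (exp (- (j / b n))) (exp (- (k / (n * b n)))) v" for v
        unfolding bpi_mgf_exp by (simp add: V_def pw exp_add[symmetric] A_def B_def C_def)
      then have "(\<integral>v. fst (V n v) ^ i * fst (snd (V n v)) ^ j * snd (snd (V n v)) ^ k \<partial>M n) =
          br.expectation (bpi_mgf (\<xi> n) (\<eta> n) n (exp (- (i / b n))) (exp (- (j / b n))) (exp (- (k / (n * b n)))))"
        by simp
      also have "\<dots> = (\<Prod>l<n. gen (q n) (P.gf_iter k n i l * exp (- real j / b n)))"
        using b_pos[OF n] by (subst br.expectation_bpi_mgf) (simp_all add: P.gf_iter_def)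
      finally show ?thesis .
    qed
    have "(\<lambda>n. \<Prod>l<Suc n. gen (q (Suc n)) (P.gf_iter k (Suc n) i l * exp (- real j / b (Suc n)))) \<longlonglongrightarrow> P.\<Lambda> k i j"
      by (rule LIMSEQ_Suc[OF P.prelimit_LIMSEQ]) simp_all
    then have "(\<lambda>n. \<integral>v. fst (V (Suc n) v) ^ i * fst (snd (V (Suc n) v)) ^ j * snd (snd (V (Suc n) v)) ^ k \<partial>M (Suc n))
      \<longlonglongrightarrow> P.\<Lambda> k i j"
      by (simp only: eq le_add1 One_nat_def Suc_le_mono le0)
    also have "P.\<Lambda> k i j = (\<integral>v. fst (W v) ^ i * fst (snd (W v)) ^ j * snd (snd (W v)) ^ k \<partial>N)"
      by (simp add: P.\<Lambda>_def W_def pw exp_add[symmetric])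
    finally show ?thesis .
  qed
  note conv = moments_imp_integral_LIMSEQ[OF probS N.prob_space_axioms VS WS VK[unfolded K_def] WK[unfolded K_def] moments, folded K_def]
  have Qm [measurable]: "Q \<in> borel_measurable borel"
    unfolding Q_def by (intro borel_measurable_continuous_onI continuous_intros)
  have Qc: "continuous_on K Q" unfolding Q_def by (intro continuous_intros)
  have Q0: "0 \<le> Q v" if "v \<in> K" for v using that by (auto simp: Q_def K_def)
  have QW: "AE v in N. 0 < Q (W v)"
    using P.AE_IY_pos[OF F_unbdd] by eventually_elim (simp add: Q_def W_def)
  note cmt = integral_LIMSEQ_off_null_set[OF probS N.prob_space_axioms VS WS VK WK conv Qm Qc Q0 _ _ _ QW]
  have Tm [measurable]: "T \<in> borel_measurable borel"
  proof -
    have [measurable]: "(fst :: real \<times> real \<times> real \<Rightarrow> real) \<in> borel_measurable borel"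
      "(\<lambda>v :: real \<times> real \<times> real. fst (snd v)) \<in> borel_measurable borel"
      "(\<lambda>v :: real \<times> real \<times> real. snd (snd v)) \<in> borel_measurable borel"
      by (intro borel_measurable_continuous_onI continuous_intros)+
    show ?thesis unfolding T_def by measurable
  qed
  have Tc: "continuous_on {v \<in> K. 0 < Q v} T"
  proof -
    define S where "S = {v \<in> K. 0 < Q v}"
    have pos: "0 < fst v" "0 < fst (snd v)" "0 < snd (snd v)" "snd (snd v) < 1" if "v \<in> S" for v
      using that by (auto simp: S_def K_def Q_def zero_less_mult_iff)
    have nz: "fst v \<noteq> 0" "fst (snd v) \<noteq> 0" "snd (snd v) \<noteq> 0" "- ln (snd (snd v)) \<noteq> 0" if "v \<in> S" for v
      using pos[OF that] by auto
    have "continuous_on S T"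
      unfolding T_def by (intro continuous_intros ballI nz)
    then show ?thesis by (simp only: S_def)
  qed
  \<comment> \<open>The indicator is 0 wherever \<open>Q\<close> is positive, so it is an admissible
    discontinuous integrand. The conclusion is that the probability of C = 0, where the estimator
    divides by zero, tends to 0.\<close>
  have null: "(\<lambda>n. \<integral>v. indicat_real {v. Q v = 0} (V (Suc n) v) \<partial>M (Suc n)) \<longlonglongrightarrow> 0"
  proof -
    have "(\<lambda>n. \<integral>v. indicat_real {v. Q v = 0} (V (Suc n) v) \<partial>M (Suc n))
        \<longlonglongrightarrow> (\<integral>v. indicat_real {v. Q v = 0} (W v) \<partial>N)"
    proof (rule cmt)
      show "continuous_on {v \<in> K. 0 < Q v} (indicat_real {v. Q v = 0})"
        by (rule continuous_on_eq[OF continuous_on_const[of _ 0]]) (auto simp: indicator_def)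
    qed (auto simp: indicator_def)
    also have "(\<integral>v. indicat_real {v. Q v = 0} (W v) \<partial>N) = (\<integral>v. 0 \<partial>N)"
      by (rule integral_cong_AE) (use QW in \<open>auto elim!: eventually_mono simp: indicator_def\<close>)
    finally show ?thesis by simp
  qed
  have Rd_eq: "\<forall>\<^sub>F n in sequentially. Rd n = n * (m n - 1)"
    using Rd_def m_def eventually_ge_at_top[of 1]
    by eventually_elim (rule Rfun_derivative_at_0[OF b_pos])
  \<comment> \<open>Away from C = 0 the gap between \<open>G n v\<close> and
    \<open>T (V n v)\<close> is the deterministic number \<open>a - Rd n\<close>.\<close>
  have GT: "G n v = T (V n v) + a - Rd n" if "Rd n = n * (m n - 1)" "n \<ge> 1" "Q (V n v) \<noteq> 0" for n v
  proof -
    have bn: "0 < b n" using b_pos that by simp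
    have "C n v \<noteq> 0" using that(3) by (auto simp: Q_def V_def)
    then have "(\<Sum>k=1..n. real (bpi (\<xi> n) (\<eta> n) (k - 1) v)) \<noteq> 0" by (auto simp: C_def)
    from mcheck_eq[OF this, of "m n"]
    have "G n v = (A n v - B n v) / C n v - Rd n"
      using bn that unfolding G_def A_def B_def C_def by (simp add: diff_divide_distrib[symmetric])
    then show ?thesis by (simp add: T_def V_def)
  qed
  define H where "H = (\<lambda>v. (Y 1 v - a * integral {0..1} (\<lambda>s. Y s v) - Y' 1 v) / integral {0..1} (\<lambda>t. Y t v))"
  have H: "H v = (Y 1 v - a * P.IY v - Y' 1 v) / P.IY v" for v by (simp add: H_def P.IY_def)
  have Hm [measurable]: "H \<in> borel_measurable N" unfolding H[abs_def] by measurable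
  have "(\<lambda>n. \<integral>x. cts_step x0 x1 x \<partial>distr (M (Suc n)) borel (G (Suc n)))
     \<longlonglongrightarrow> (\<integral>x. cts_step x0 x1 x \<partial>distr N borel H)" if x: "x0 < x1" for x0 x1
  proof -
    let ?f = "cts_step x0 x1"
    have uc: "uniformly_continuous_on UNIV ?f" by (rule cts_step_uniformly_continuous[OF x])
    then have fc: "continuous_on UNIV ?f" by (rule uniformly_continuous_imp_continuous)
    then have fm [measurable]: "?f \<in> borel_measurable borel" by (rule borel_measurable_continuous_onI)
    have f01: "0 \<le> ?f y" "?f y \<le> 1" for y using x by (auto simp: cts_step_def)
    have "(\<lambda>n. \<integral>v. ?f (T (V (Suc n) v)) \<partial>M (Suc n)) \<longlonglongrightarrow> (\<integral>v. ?f (T (W v)) \<partial>N)"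
    proof (rule cmt)
      show "continuous_on {v \<in> K. 0 < Q v} (\<lambda>v. ?f (T v))"
        by (rule continuous_on_compose2[OF fc Tc]) simp
    qed (use f01 in \<open>auto simp: abs_le_iff\<close>)
    also have "(\<integral>v. ?f (T (W v)) \<partial>N) = (\<integral>v. ?f (H v) \<partial>N)"
    proof (rule integral_cong_AE)
      show "AE v in N. ?f (T (W v)) = ?f (H v)"
        using P.AE_IY_pos[OF F_unbdd]
      proof eventually_elim
        case (elim v)
        have "T (W v) = H v" using elim by (simp add: T_def W_def H field_simps)
        then show ?case by simp
      qed
    qed measurable
    finally have main: "(\<lambda>n. \<integral>v. ?f (T (V (Suc n) v)) \<partial>M (Suc n)) \<longlonglongrightarrow> (\<integral>v. ?f (H v) \<partial>N)" .
    \<comment> \<open>Slutsky-type argument: uniform continuity of the test function absorbs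
      \<open>a - Rd n\<close>, and the event that \<open>Q\<close> vanishes, where the two arguments
      may be far apart, costs at most its probability because the test function takes values in
      [0, 1].\<close>
    have "(\<lambda>n. (\<integral>v. ?f (G (Suc n) v) \<partial>M (Suc n)) - (\<integral>v. ?f (T (V (Suc n) v)) \<partial>M (Suc n))) \<longlonglongrightarrow> 0"
    proof (rule LIMSEQ_I)
      fix e :: real assume e: "0 < e"
      then have "0 < e / 2" by simp
      then obtain d where d: "0 < d" "\<And>y z. \<bar>y - z\<bar> < d \<Longrightarrow> \<bar>?f y - ?f z\<bar> < e / 2"
        using uc unfolding uniformly_continuous_on_def dist_real_def by blast
      have "\<forall>\<^sub>F n in sequentially. dist (Rd (Suc n)) a < d"
        using d(1) by (intro tendstoD LIMSEQ_Suc[OF Rd_lim])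
      moreover have "\<forall>\<^sub>F n in sequentially. Rd (Suc n) = Suc n * (m (Suc n) - 1)"
        using Rd_eq by (subst eventually_sequentially_Suc)
      moreover have "\<forall>\<^sub>F n in sequentially. (\<integral>v. indicat_real {v. Q v = 0} (V (Suc n) v) \<partial>M (Suc n)) < e / 2"
        using e by (intro order_tendstoD(2)[OF null]) simp
      ultimately have "\<forall>\<^sub>F n in sequentially.
          norm ((\<integral>v. ?f (G (Suc n) v) \<partial>M (Suc n)) - (\<integral>v. ?f (T (V (Suc n) v)) \<partial>M (Suc n))) < e"
      proof eventually_elim
        case (elim n)
        interpret Mn: prob_space "M (Suc n)" by (rule probS)
        have [measurable]: "G (Suc n) \<in> borel_measurable (M (Suc n))" by simp
        have i1: "integrable (M (Suc n)) (\<lambda>v. ?f (G (Suc n) v))"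
          by (rule Mn.integrable_const_bound[where B = 1]) (use f01 in auto)
        have i2: "integrable (M (Suc n)) (\<lambda>v. ?f (T (V (Suc n) v)))"
          by (rule Mn.integrable_const_bound[where B = 1]) (use f01 in auto)
        have i3: "integrable (M (Suc n)) (\<lambda>v. indicat_real {v. Q v = 0} (V (Suc n) v))"
          by (rule Mn.integrable_const_bound[where B = 1]) (auto simp: indicator_def)
        have "\<bar>(\<integral>v. ?f (G (Suc n) v) \<partial>M (Suc n)) - (\<integral>v. ?f (T (V (Suc n) v)) \<partial>M (Suc n))\<bar>
            = \<bar>\<integral>v. ?f (G (Suc n) v) - ?f (T (V (Suc n) v)) \<partial>M (Suc n)\<bar>"
          using i1 i2 by simp
        also have "\<dots> \<le> (\<integral>v. \<bar>?f (G (Suc n) v) - ?f (T (V (Suc n) v))\<bar> \<partial>M (Suc n))"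
          by (rule integral_abs_bound)
        also have "\<dots> \<le> (\<integral>v. e / 2 + indicat_real {v. Q v = 0} (V (Suc n) v) \<partial>M (Suc n))"
        proof (rule integral_mono)
          show "integrable (M (Suc n)) (\<lambda>v. \<bar>?f (G (Suc n) v) - ?f (T (V (Suc n) v))\<bar>)"
            by (intro integrable_abs Bochner_Integration.integrable_diff i1 i2)
          show "integrable (M (Suc n)) (\<lambda>v. e / 2 + indicat_real {v. Q v = 0} (V (Suc n) v))"
            by (intro Bochner_Integration.integrable_add i3) simp
          fix v
          show "\<bar>?f (G (Suc n) v) - ?f (T (V (Suc n) v))\<bar> \<le> e / 2 + indicat_real {v. Q v = 0} (V (Suc n) v)"
          proof (cases "Q (V (Suc n) v) = 0")
            case True
            then show ?thesis
              using f01[of "G (Suc n) v"] f01[of "T (V (Suc n) v)"] e by (simp add: abs_le_iff)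
          next
            case False
            then have "\<bar>G (Suc n) v - T (V (Suc n) v)\<bar> < d"
              using GT[OF elim(2) _ False] elim(1) by (simp add: dist_real_def abs_minus_commute)
            then show ?thesis using d(2) False by (auto simp: less_imp_le)
          qed
        qed
        also have "\<dots> < e" using i3 elim by (simp add: Mn.prob_space)
        finally show ?case by simp
      qed
      then show "\<exists>no. \<forall>n\<ge>no. norm ((\<integral>v. ?f (G (Suc n) v) \<partial>M (Suc n)) - (\<integral>v. ?f (T (V (Suc n) v)) \<partial>M (Suc n)) - 0) < e"
        by (simp add: eventually_sequentially)
    qed
    from tendsto_add[OF this main]
    have "(\<lambda>n. \<integral>v. ?f (G (Suc n) v) \<partial>M (Suc n)) \<longlonglongrightarrow> (\<integral>v. ?f (H v) \<partial>N)" by simp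
    then show ?thesis by (simp add: integral_distr)
  qed
  then have "weak_conv_m (\<lambda>n. distr (M (Suc n)) borel (G (Suc n))) (distr N borel H)"
    by (intro integral_cts_step_conv_imp_weak_conv prob_space.real_distribution_distr probS N.prob_space_axioms) simp_all
  then have "weak_conv_m (\<lambda>n. distr (M n) borel (G n)) (distr N borel H)"
    unfolding weak_conv_m_def weak_conv_def
    by (blast intro: LIMSEQ_imp_Suc)
  then show ?thesis by (simp only: G_def H_def)
qed

end
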